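(* Consider the generalized equation $0\in\Phi x=Fx+Tx$ under the standing assumptions (A1)--(A4) of the context, and assume $L\rho<1$. Let $\hat L>L$ be such that $\hat L\rho<1$, and let $\bar\beta:=\frac{\lambda(4-\hat L\lambda)-4\rho}{4(1-\rho\hat L)}$ and $\Lambda:=\frac{\hat L-L}{L\hat L}$. Let $\{(x^k,u^k)\}$ be generated by the VFOSA$_-$ iteration (see context) using an estimator $\widetilde F^k$ of $Fx^k$ satisfying the $\mathbf{VR}(\Delta_k;\kappa_k,\Theta_k,\sigma_k)$ property (see context). Assume that $$2\rho\le\lambda<\tfrac{2(1+\sqrt{1-\hat L\rho})}{\hat L},\quad 0<\mu<\tfrac23,\quad r\ge 2+\tfrac1\mu,\quad \nu:=\tfrac\mu2,\quad 0<\beta\le\tfrac{(2-\mu)\bar\beta}{2+\mu},\quad t_k:=\mu(k+r),\quad \eta_k:=\tfrac{2\beta(t_k-1)}{t_k-\nu},$$ that there are $\Gamma_k>0$ such that for all $k\ge0$: $\kappa_k\ge 1-\frac{\Gamma_{k-1}t_{k-2}(t_{k-2}-1)}{\Gamma_kt_{k-1}(t_{k-1}-1)}+\frac{5\beta}{\mu\Gamma_k}$ and $\Gamma_k\Theta_k\le2\Lambda$, and that $B_\infty:=\frac\Lambda\beta\sum_{k=0}^\infty t_{k-1}(t_{k-1}-1)\frac{\sigma_k^2}{\Theta_k}<+\infty$. Let $\xi^k:=\frac1\lambda(u^k-x^k)\in Tx^k$, and for $u^\star\in\mathrm{zer}(S_\lambda)$ let $\bar\Psi_0^2:=\mu^2r^2\,\mathbb{E}[\|Fx^0+\xi^0\|^2]+\frac{2r-1}{4\beta^2(\mu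 r-1)}\|u^0-u^\star\|^2$ and $\bar E_0^2:=\frac{\mu r^2(\mu\Gamma_0+\beta)\sigma_0^2}{2\beta}$. Then for all $k\ge0$, $$\mathbb{E}[\|Fx^k+\xi^k\|^2]\le\frac{2(\bar\Psi_0^2+\bar E_0^2+B_\infty)}{\mu^2(k+r-1)^2}.$$ We have the summability bounds $$\sum_{k=0}^\infty(k+1)\mathbb{E}[\|Fx^k+\xi^k\|^2]<+\infty,\qquad \sum_{k=0}^\infty(k+1)^2\mathbb{E}[\|\widetilde F^k-Fx^k\|^2]<+\infty,$$ $$\sum_{k=0}^\infty(k+1)\mathbb{E}[\|u^{k+1}-u^k\|^2]<+\infty,\qquad \sum_{k=0}^\infty(k+1)\mathbb{E}[\|x^{k+1}-x^k\|^2]<+\infty,$$ where the last three of these four bounds require $0<\beta<\frac{(2-\mu)\bar\beta}{2+\mu}$. We also have the limits $$\lim_{k\to\infty}k^2\mathbb{E}[\|u^{k+1}-u^k\|^2]=0,\qquad \lim_{k\to\infty}k^2\mathbb{E}[\|x^{k+1}-x^k\|^2]=0,\qquad \lim_{k\to\infty}k^2\mathbb{E}[\|Fx^k+\xi^k\|^2]=0.$$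
   Context: Problem: $F:\mathbb{R}^p\to\mathbb{R}^p$ is single-valued, $T:\mathbb{R}^p\rightrightarrows2^{\mathbb{R}^p}$ is possibly multi-valued, $\Phi:=F+T$, $\mathrm{dom}(\Phi)=\{x:\Phi x\ne\emptyset\}$, $\mathrm{zer}(\Phi):=\{x:0\in\Phi x\}$. There are two settings: the finite-sum setting $Fx=\frac1n\sum_{i=1}^nF_ix$, and the expectation setting $Fx=\mathbb{E}_\xi[\mathbf F(x,\xi)]$ for a random variable $\xi$. (In the finite-sum setting, $\mathbf F(x,\xi)$ means $F_ix$ with $i$ uniform on $\{1,\dots,n\}$.) Standing assumptions. (A1) $\mathrm{zer}(\Phi)\neq\emptyset$. (A2) In the expectation setting there is $\sigma\ge0$ with $\mathbb{E}_\xi[\|\mathbf F(x,\xi)-Fx\|^2]\le\sigma^2$ for all $x\in\mathrm{dom}(F)$. (A3) $T$ is maximally $\rho$-co-hypomonotone for some $\rho\ge0$: $\langle u-v,x-y\rangle\ge-\rho\|u-v\|^2$ for all $(x,u),(y,v)$ in the graph of $T$, and the graph is not properly contained in that of another such operator. (A4) There is $L>0$ such that for all $x,y\in\mathrm{dom}(F)$: in the finite-sum setting, $\langle Fx-Fy,x-y\rangle\ge\frac1{nL}\sum_{i=1}^n\|F_ix-F_iy\|^2$; in the expectation setting, $\langle Fx-Fy,x-y\rangle\ge\frac1L\mathbb{E}_\xi[\|\mathbf F(x,\xi)-\mathbf F(y,\xi)\|^2]$. Operators: for $\lambda>0$, $J_{\lambda T}u:=\{w:u\in w+\lambda Tw\}$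 is the resolvent of $\lambda T$, and $S_\lambda u:=F(J_{\lambda T}u)+\frac1\lambda(u-J_{\lambda T}u)$ is the backward-forward splitting residual; $\mathrm{zer}(S_\lambda)=\{u:S_\lambda u=0\}$. VFOSA$_-$ iteration: take $x^0\in\mathrm{dom}(\Phi)$, $\xi^0\in Tx^0$, $u^0:=x^0+\lambda\xi^0$, $s^0:=u^0$; for $k\ge0$: $x^k:=J_{\lambda T}u^k$; construct a stochastic estimator $\widetilde F^k$ of $Fx^k$; $v^k:=\frac{t_k-1}{t_k}u^k+\frac1{t_k}s^k$; $u^{k+1}:=v^k-\eta_k\big(\widetilde F^k+\frac1\lambda(u^k-x^k)\big)$; $s^{k+1}:=s^k+\nu(u^{k+1}-v^k)$. The formula $t_k=\mu(k+r)$ is used for all integers $k\ge-2$. $\mathcal F_k$ is the $\sigma$-algebra generated by all the randomness of the algorithm up to the current iterates with index at most $k$ (the samples drawn at iteration $k$ to build $\widetilde F^k$ are not included), and $\mathbb{E}_k[\cdot]=\mathbb{E}[\cdot\mid\mathcal F_k]$. $\mathbf{VR}(\Delta_k;\kappa_k,\Theta_k,\sigma_k)$ property: there are parameters $\kappa_k\in(0,1]$, $\Theta_k\ge0$, $\sigma_k\ge0$ and random quantities $\Delta_k\ge0$ such that almost surely for all $k\ge0$: $\mathbb{E}_k[\|\widetilde F^k-Fx^k\|^2]\le\mathbb{E}_k[\Delta_k]$ and $\mathbb{E}_k[\Delta_k]\le(1-\kappa_k)\Delta_{k-1}+\Theta_k\bar{\mathcal E}_k+\sigma_k^2$, where $\bar{\mathcal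 E}_k:=\mathbb{E}_\xi[\|\mathbf F(x^k,\xi)-\mathbf F(x^{k-1},\xi)\|^2]$ (i.e. $\frac1n\sum_i\|F_ix^k-F_ix^{k-1}\|^2$ in the finite-sum setting), $x^{-1}:=x^0$, $\Delta_{-1}:=0$. Whenever $\Theta_k$ appears in a denominator it is taken positive. *)

theory Defs
  imports "HOL-Probability.Probability"
begin

subsection \<open>Set-valued operators\<close>

definition graph_op :: "('a \<Rightarrow> 'a set) \<Rightarrow> ('a \<times> 'a) set" where
  "graph_op A = {(x, y). y \<in> A x}"

definition dom_op :: "('a \<Rightarrow> 'a set) \<Rightarrow> 'a set" where
  "dom_op A = {x. A x \<noteq> {}}"

definition zer :: "('a::zero \<Rightarrow> 'a set) \<Rightarrow> 'a set" where
  "zer A = {x. 0 \<in> A x}"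

definition sum_op :: "('a::ab_group_add \<Rightarrow> 'a) \<Rightarrow> ('a \<Rightarrow> 'a set) \<Rightarrow> 'a \<Rightarrow> 'a set" where
  "sum_op F T x = {F x + y | y. y \<in> T x}"

definition co_hypomonotone :: "real \<Rightarrow> ('a::real_inner \<Rightarrow> 'a set) \<Rightarrow> bool" where
  "co_hypomonotone \<rho> T \<longleftrightarrow>
    (\<forall>(x, a) \<in> graph_op T. \<forall>(y, b) \<in> graph_op T.
      (a - b) \<bullet> (x - y) \<ge> - \<rho> * (norm (a - b))\<^sup>2)"

definition max_co_hypomonotone :: "real \<Rightarrow> ('a::real_inner \<Rightarrow> 'a set) \<Rightarrow> bool" where
  "max_co_hypomonotone \<rho> T \<longleftrightarrow>
    co_hypomonotone \<rho> T \<and> (\<nexists>T'. co_hypomonotone \<rho> T' \<and> graph_op T \<subset> graph_op T')"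

text \<open>The resolvent is kept set-valued, so that no choice is made where it could be empty or
  multi-valued; for maximally co-hypomonotone operators and the stepsizes considered here its
  values are singletons.\<close>

definition resolvent :: "real \<Rightarrow> ('a::real_vector \<Rightarrow> 'a set) \<Rightarrow> 'a \<Rightarrow> 'a set" where
  "resolvent lam T u = {w. u \<in> {w + lam *\<^sub>R y | y. y \<in> T w}}"

definition bfs_residual ::
  "('a::real_vector \<Rightarrow> 'a) \<Rightarrow> real \<Rightarrow> ('a \<Rightarrow> 'a set) \<Rightarrow> 'a \<Rightarrow> 'a set" where
  "bfs_residual F lam T u = {F w + (1 / lam) *\<^sub>R (u - w) | w. w \<in> resolvent lam T u}"

subsection \<open>The finite-sum and the expectation setting\<close>

datatype ('s, 'a) stoch_op =
    Finite_Sum nat "nat \<Rightarrow> 'a \<Rightarrow> 'a"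
  | Expectation "'s measure" "'a \<Rightarrow> 's \<Rightarrow> 'a"

primrec represents ::
  "('s, 'a::euclidean_space) stoch_op \<Rightarrow> ('a \<Rightarrow> 'a) \<Rightarrow> bool" where
  "represents (Finite_Sum n f) F \<longleftrightarrow>
    n \<ge> 1 \<and> (\<forall>x. F x = (1 / real n) *\<^sub>R (\<Sum>i = 1..n. f i x))"
| "represents (Expectation P f) F \<longleftrightarrow>
    prob_space P \<and> (\<forall>x. integrable P (f x) \<and> F x = (\<integral>s. f x s \<partial>P))"

primrec bounded_variance ::
  "('s, 'a::euclidean_space) stoch_op \<Rightarrow> ('a \<Rightarrow> 'a) \<Rightarrow> bool" where
  "bounded_variance (Finite_Sum n f) F \<longleftrightarrow> True"
| "bounded_variance (Expectation P f) F \<longleftrightarrow>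
    (\<exists>\<sigma>\<ge>0. \<forall>x. (\<integral>\<^sup>+s. ennreal ((norm (f x s - F x))\<^sup>2) \<partial>P) \<le> ennreal (\<sigma>\<^sup>2))"

text \<open>Under the bounded variance assumption the integrand below is integrable, so the Bochner
  integral is the genuine expectation.\<close>

primrec mean_sq_diff ::
  "('s, 'a::euclidean_space) stoch_op \<Rightarrow> 'a \<Rightarrow> 'a \<Rightarrow> real" where
  "mean_sq_diff (Finite_Sum n f) x y = (1 / real n) * (\<Sum>i = 1..n. (norm (f i x - f i y))\<^sup>2)"
| "mean_sq_diff (Expectation P f) x y = (\<integral>s. (norm (f x s - f y s))\<^sup>2 \<partial>P)"

definition cocoercive_in_mean ::
  "('s, 'a::euclidean_space) stoch_op \<Rightarrow> ('a \<Rightarrow> 'a) \<Rightarrow> real \<Rightarrow> bool" where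
  "cocoercive_in_mean Fs F L \<longleftrightarrow>
    (\<forall>x y. (F x - F y) \<bullet> (x - y) \<ge> (1 / L) * mean_sq_diff Fs x y)"

subsection \<open>The algorithm and its estimators\<close>

text \<open>Expectations of squared norms are taken in \<open>[0, \<infinity>]\<close>, so that no integrability has to be
  presupposed and a finite bound includes integrability.\<close>

definition mean_sq :: "'w measure \<Rightarrow> ('w \<Rightarrow> 'a::real_normed_vector) \<Rightarrow> ennreal" where
  "mean_sq M X = (\<integral>\<^sup>+\<omega>. ennreal ((norm (X \<omega>))\<^sup>2) \<partial>M)"

text \<open>The \<open>\<sigma>\<close>-algebra \<open>\<F> k\<close> is any term of a filtration for which the iterates are adapted and
  the estimator \<open>Ft k\<close> is known at time \<open>k + 1\<close>; the one generated by the randomness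
  preceding step \<open>k\<close> is an instance.\<close>

definition vfosa_minus ::
  "'w measure \<Rightarrow> (nat \<Rightarrow> 'w measure) \<Rightarrow> ('a::euclidean_space \<Rightarrow> 'a) \<Rightarrow> ('a \<Rightarrow> 'a set) \<Rightarrow>
   real \<Rightarrow> real \<Rightarrow> (int \<Rightarrow> real) \<Rightarrow> (nat \<Rightarrow> real) \<Rightarrow> 'a \<Rightarrow> 'a \<Rightarrow>
   (nat \<Rightarrow> 'w \<Rightarrow> 'a) \<Rightarrow> (nat \<Rightarrow> 'w \<Rightarrow> 'a) \<Rightarrow> (nat \<Rightarrow> 'w \<Rightarrow> 'a) \<Rightarrow> (nat \<Rightarrow> 'w \<Rightarrow> 'a) \<Rightarrow>
   (nat \<Rightarrow> 'w \<Rightarrow> 'a) \<Rightarrow> bool" where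
  "vfosa_minus M \<F> F T lam \<nu> t \<eta> x0 \<xi>0 x u s v Ft \<longleftrightarrow>
    filtration (space M) \<F> \<and> (\<forall>k. subalgebra M (\<F> k)) \<and>
    (\<forall>k. x k \<in> borel_measurable (\<F> k) \<and> u k \<in> borel_measurable (\<F> k) \<and>
         s k \<in> borel_measurable (\<F> k) \<and> Ft k \<in> borel_measurable (\<F> (Suc k))) \<and>
    x0 \<in> dom_op (sum_op F T) \<and> \<xi>0 \<in> T x0 \<and>
    (\<forall>\<omega>\<in>space M.
      u 0 \<omega> = x0 + lam *\<^sub>R \<xi>0 \<and> s 0 \<omega> = u 0 \<omega> \<and>
      (\<forall>k. x k \<omega> \<in> resolvent lam T (u k \<omega>) \<and>
           v k \<omega> = ((t (int k) - 1) / t (int k)) *\<^sub>R u k \<omega> + (1 / t (int k)) *\<^sub>R s k \<omega> \<and>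
           u (Suc k) \<omega> = v k \<omega> - \<eta> k *\<^sub>R (Ft k \<omega> + (1 / lam) *\<^sub>R (u k \<omega> - x k \<omega>)) \<and>
           s (Suc k) \<omega> = s k \<omega> + \<nu> *\<^sub>R (u (Suc k) \<omega> - v k \<omega>)))"

text \<open>Conditional expectations are those of nonnegative functions with values in \<open>[0, \<infinity>]\<close>,
  since \<^const>\<open>real_cond_exp\<close> would turn an infinite value into \<open>0\<close>. The truncated subtraction in
  \<open>x (k - 1)\<close> realises the convention that the iterate with
  index \<open>-1\<close> is \<open>x 0\<close>, and the case distinction the convention that \<open>\<Delta>\<close> vanishes at \<open>-1\<close>.\<close>

definition VR ::
  "'w measure \<Rightarrow> (nat \<Rightarrow> 'w measure) \<Rightarrow> ('s, 'a::euclidean_space) stoch_op \<Rightarrow> ('a \<Rightarrow> 'a) \<Rightarrow>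
   (nat \<Rightarrow> 'w \<Rightarrow> 'a) \<Rightarrow> (nat \<Rightarrow> 'w \<Rightarrow> 'a) \<Rightarrow>
   (nat \<Rightarrow> 'w \<Rightarrow> real) \<Rightarrow> (nat \<Rightarrow> real) \<Rightarrow> (nat \<Rightarrow> real) \<Rightarrow> (nat \<Rightarrow> real) \<Rightarrow> bool" where
  "VR M \<F> Fs F x Ft \<Delta> \<kappa> \<Theta> \<sigma> \<longleftrightarrow>
    (\<forall>k. 0 < \<kappa> k \<and> \<kappa> k \<le> 1 \<and> 0 \<le> \<Theta> k \<and> 0 \<le> \<sigma> k) \<and>
    (\<forall>k. \<Delta> k \<in> borel_measurable M \<and> (\<forall>\<omega>\<in>space M. 0 \<le> \<Delta> k \<omega>)) \<and>
    (AE \<omega> in M. \<forall>k.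
      nn_cond_exp M (\<F> k) (\<lambda>\<omega>'. ennreal ((norm (Ft k \<omega>' - F (x k \<omega>')))\<^sup>2)) \<omega>
        \<le> nn_cond_exp M (\<F> k) (\<lambda>\<omega>'. ennreal (\<Delta> k \<omega>')) \<omega> \<and>
      nn_cond_exp M (\<F> k) (\<lambda>\<omega>'. ennreal (\<Delta> k \<omega>')) \<omega>
        \<le> ennreal ((1 - \<kappa> k) * (case k of 0 \<Rightarrow> 0 | Suc j \<Rightarrow> \<Delta> j \<omega>)
            + \<Theta> k * mean_sq_diff Fs (x k \<omega>) (x (k - 1) \<omega>) + (\<sigma> k)\<^sup>2))"

end

theory Submission
  imports Defs
begin

text \<open>Write \<open>w = F x + \<xi>\<close> for the residual, \<open>e = Ft - F x\<close> for the estimator error, \<open>z = s - u\<close> for the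
lag between the two sequences of the scheme, and place a zero of the splitting residual at the
origin. Then \<open>u' = u + z / t - \<eta> (w + e)\<close> and \<open>s' = s - \<nu> \<eta> (w + e)\<close>.

The residual is a cocoercive function of \<open>u\<close> with modulus \<open>\<beta>bar\<close>, and because \<open>Lh > L\<close> the
inequality leaves a surplus of \<open>\<Lambda>\<close> times the mean square difference of the sampled operators
(\<open>splitting_residual_cocoercive\<close>). The step size \<open>\<eta>\<close> is chosen so that the increment has two
descriptions, \<open>t (u' - u) = z - t \<eta> (w + e)\<close> and \<open>(t - 1) (u' - u) = z' - 2 \<beta> (t - 1) (w + e)\<close>
(\<open>step_identities\<close>). Inserting the first into \<open>w \<bullet> (u' - u)\<close> and the second into \<open>w' \<bullet> (u' - u)\<close>,
cocoercivity between consecutive iterates, weighted by \<open>2 t (t - 1)\<close>, becomes the decrease of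
\<open>2 \<beta> t (t - 1) |w|\<^sup>2 - 2 t (w \<bullet> z)\<close> up to a multiple of \<open>w \<bullet> z\<close>. Suitable multiples of \<open>|s|\<^sup>2\<close> and
\<open>|z|\<^sup>2\<close> cancel that multiple, using \<open>w \<bullet> u \<ge> \<beta>bar |w|\<^sup>2\<close> (\<open>lyapunov_step\<close>, \<open>lyapunov_decrease\<close>).
The resulting Lyapunov function dominates \<open>\<beta> t\<^sup>2 |w|\<^sup>2\<close> (\<open>lyapunov_ge\<close>), which is the claimed rate.

The estimator may be biased, so \<open>e \<bullet> s\<close> does not vanish in expectation. The weight of \<open>|s|\<^sup>2\<close> is a
multiple of \<open>1 / \<eta>\<close>, and \<open>1 / \<eta>\<close> decreases by an amount of order \<open>1 / t\<^sup>2\<close> per step; this is just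
enough to absorb \<open>e \<bullet> s\<close> at the price of \<open>t\<^sup>2 |e|\<^sup>2\<close> (\<open>anchor_weight_slack\<close>). All error terms together
cost strictly less than \<open>(5 \<beta> / \<mu>) t (t - 1) |e|\<^sup>2\<close> (\<open>error_coefficient_bound\<close>), which is what the
condition on \<open>\<kappa>\<close> lets the variance reduction recursion pay for. That recursion in turn consumes
mean square differences, and these are paid for by the surplus \<open>\<Lambda>\<close> (\<open>D_decrease\<close>,
\<open>potential_decrease\<close>). Telescoping gives the rate and the sums.

For the limits the anchor term \<open>|s|\<^sup>2\<close> is dropped. The remaining quantity, with a large enough
multiple of \<open>|z|\<^sup>2\<close>, is comparable to \<open>t\<^sup>2 |w|\<^sup>2 + |z|\<^sup>2\<close>, increases in expectation only by summable
amounts (\<open>mean_energy_quasi_decreasing\<close>), and is summable after division by the index. Such a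
sequence tends to zero (\<open>tendsto_0_of_quasi_decreasing\<close>), and \<open>u' - u\<close> is controlled by \<open>w\<close>, \<open>z\<close>
and \<open>e\<close>. The statements about \<open>x\<close> follow since the resolvent is nonexpansive for \<open>lam \<ge> 2 \<rho>\<close>.\<close>

section \<open>Young inequality and real sequences\<close>

text \<open>The squared norm of \<open>2 c x - g y\<close> is nonnegative. The sign of \<open>g\<close> is free, which lets one lemma serve
all the absorption steps below.\<close>

lemma inner_young:
  fixes x y :: "'a::real_inner" and c d g :: real
  assumes "0 < c" "0 \<le> d" "g^2 \<le> 4 * c * d"
  shows "g * (x \<bullet> y) \<le> c * (norm x)\<^sup>2 + d * (norm y)\<^sup>2"
proof -
  have "0 \<le> (norm ((2*c) *\<^sub>R x - g *\<^sub>R y))\<^sup>2" by simp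
  also have "\<dots> = 4*c * (c * (norm x)\<^sup>2 - g * (x \<bullet> y)) + g^2 * (norm y)\<^sup>2"
    unfolding power2_norm_eq_inner by (simp add: inner_simps inner_commute algebra_simps power2_eq_square)
  also have "\<dots> \<le> 4*c * (c * (norm x)\<^sup>2 - g * (x \<bullet> y)) + (4*c*d) * (norm y)\<^sup>2"
    using assms by (intro add_left_mono mult_right_mono) auto
  also have "\<dots> = 4*c * (c * (norm x)\<^sup>2 + d * (norm y)\<^sup>2 - g * (x \<bullet> y))"
    by (simp add: algebra_simps)
  finally show ?thesis using assms(1) by (simp add: zero_le_mult_iff)
qed

lemma summable_dominated:
  fixes f g :: "nat \<Rightarrow> real"
  assumes "summable g" "\<And>k. 0 \<le> f k" "\<And>k. f k \<le> C * g k"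
  shows "summable f"
  by (rule summable_comparison_test'[where N = 0, OF summable_mult[OF assms(1), of C]]) (use assms in auto)

lemma tendsto_0_of_le:
  fixes f g :: "nat \<Rightarrow> real"
  assumes "g \<longlonglongrightarrow> 0" "\<And>k. f k \<le> g k" "\<And>k. 0 \<le> f k"
  shows "f \<longlonglongrightarrow> 0"
  by (rule tendsto_sandwich[OF _ _ tendsto_const assms(1)]) (use assms in auto)

lemma telescoping_bound:
  fixes X d \<tau> :: "nat \<Rightarrow> real"
  assumes "\<And>k. 0 \<le> X k" "\<And>k. 0 \<le> d k" "\<And>k. 0 \<le> \<tau> k" "summable \<tau>"
    and step: "\<And>k. X (Suc k) + d k \<le> X k + \<tau> k"
  shows "summable d" and "X n \<le> X 0 + suminf \<tau>"
proof -
  have *: "X n + (\<Sum>k<n. d k) \<le> X 0 + (\<Sum>k<n. \<tau> k)" for n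
  proof (induction n)
    case (Suc n)
    then show ?case using step[of n] by simp
  qed simp
  have \<tau>: "(\<Sum>k<n. \<tau> k) \<le> suminf \<tau>" for n using assms by (intro sum_le_suminf) auto
  have d: "0 \<le> (\<Sum>k<n. d k)" for n using assms by (intro sum_nonneg) auto
  show "X n \<le> X 0 + suminf \<tau>" using *[of n] \<tau>[of n] d[of n] by linarith
  show "summable d"
  proof (rule summableI_nonneg_bounded)
    show "(\<Sum>k<n. d k) \<le> X 0 + suminf \<tau>" for n using *[of n] \<tau>[of n] assms(1)[of n] by linarith
  qed (use assms in auto)
qed

text \<open>Subtracting the partial sums of \<open>\<tau>\<close> makes the sequence decreasing, so it has a limit; a positive limit
would make the harmonic series converge.\<close>

lemma tendsto_0_of_quasi_decreasing:
  fixes X \<tau> :: "nat \<Rightarrow> real"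
  assumes X0: "\<And>k. 0 \<le> X k" and \<tau>0: "\<And>k. 0 \<le> \<tau> k" and \<tau>: "summable \<tau>"
    and step: "\<And>k. X (Suc k) \<le> X k + \<tau> k"
    and sum: "summable (\<lambda>k. X k / real (Suc k))"
  shows "X \<longlonglongrightarrow> 0"
proof -
  define Y where "Y n = X n - (\<Sum>k<n. \<tau> k)" for n
  have "decseq Y" using step by (intro decseq_SucI) (simp add: Y_def algebra_simps)
  moreover have "- suminf \<tau> \<le> Y n" for n
    using sum_le_suminf[OF \<tau>, of "{..<n}"] \<tau>0 X0[of n] by (simp add: Y_def)
  ultimately obtain l where l: "Y \<longlonglongrightarrow> l" using decseq_convergent by metis
  have "(\<lambda>n. Y n + (\<Sum>k<n. \<tau> k)) \<longlonglongrightarrow> l + suminf \<tau>" by (intro tendsto_add l summable_LIMSEQ \<tau>)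
  then have X: "X \<longlonglongrightarrow> l + suminf \<tau>" by (simp add: Y_def)
  have "0 \<le> l + suminf \<tau>" using X0 by (intro LIMSEQ_le_const[OF X]) auto
  moreover have False if pos: "0 < l + suminf \<tau>"
  proof -
    define h where "h = (l + suminf \<tau>) / 2"
    have h: "0 < h" "h < l + suminf \<tau>" using pos by (auto simp: h_def)
    have "eventually (\<lambda>k. h < X k) sequentially" using X h(2) by (rule order_tendstoD)
    then have "eventually (\<lambda>k. norm (1 / real (Suc k)) \<le> (1 / h) * (X k / real (Suc k))) sequentially"
    proof eventually_elim
      case (elim k)
      have "1 \<le> X k / h" using elim h by simp
      then have "1 / real (Suc k) \<le> (X k / h) / real (Suc k)" by (intro divide_right_mono) auto
      then show ?case by simp
    qed
    from summable_comparison_test_ev[OF this summable_mult[OF sum]]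
    have "summable (\<lambda>k. 1 / real (Suc k))" .
    then have "summable (\<lambda>k. inverse (real (Suc k)))" by (simp add: inverse_eq_divide)
    then show False
      using not_summable_harmonic[where 'a=real] summable_Suc_iff[of "\<lambda>k. inverse (real k)"] by blast
  qed
  ultimately have "l + suminf \<tau> = 0" by fastforce
  with X show ?thesis by simp
qed

section \<open>One step of the scheme\<close>

text \<open>Here \<open>g\<close> is the search direction, \<open>a\<close> and \<open>b\<close> are the residuals before and after the step. In the first
identity \<open>u' - u\<close> is expressed through the old lag where it meets \<open>a\<close> and through the new lag
where it meets \<open>b\<close>; the formula for \<open>\<eta>\<close> is what makes the second expression have the constant
coefficient \<open>2 \<beta>\<close>.\<close>

lemma step_identities:
  fixes a b g u s u' s' :: "'a::real_inner"
  assumes "t > 1" "\<nu> < 1" "0 < \<nu>" "\<beta> > 0"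
    and \<eta>: "\<eta> = 2 * \<beta> * (t - 1) / (t - \<nu>)"
    and u': "u' = u + (1 / t) *\<^sub>R (s - u) - \<eta> *\<^sub>R g"
    and s': "s' = s - (\<nu> * \<eta>) *\<^sub>R g"
  shows "2 * (t * (t - 1)) * ((b - a) \<bullet> (u' - u)) = 2 * t * (b \<bullet> (s' - u')) - 4 * \<beta> * (t * (t - 1)) * (b \<bullet> g)
           - 2 * (t - 1) * (a \<bullet> (s - u)) + 2 * (t * (t - 1)) * \<eta> * (a \<bullet> g)"
    and "(1 - \<nu>) / (\<nu> * \<eta>) * (norm s')\<^sup>2
           = (1 - \<nu>) / (\<nu> * \<eta>) * (norm s)\<^sup>2 - 2 * (1 - \<nu>) * (g \<bullet> s) + (1 - \<nu>) * \<nu> * \<eta> * (norm g)\<^sup>2"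
    and "s' - u' = (1 - 1 / t) *\<^sub>R (s - u) + ((1 - \<nu>) * \<eta>) *\<^sub>R g"
proof -
  have \<eta>0: "\<eta> > 0" and \<eta>t: "(t - \<nu>) * \<eta> = 2 * \<beta> * (t - 1)" using assms by auto
  define c where cdef: "c = 1 / t"
  have c1: "(t - 1) * c = 1 - c" using \<open>t > 1\<close> by (simp add: cdef field_simps)
  show z': "s' - u' = (1 - 1 / t) *\<^sub>R (s - u) + ((1 - \<nu>) * \<eta>) *\<^sub>R g"
    unfolding u' s' cdef[symmetric] by (simp add: algebra_simps)
  have h1: "t *\<^sub>R (u' - u) = (s - u) - (t * \<eta>) *\<^sub>R g"
    unfolding u' using \<open>t > 1\<close> by (simp add: algebra_simps)
  have "(t - 1) *\<^sub>R (u' - u) = (s' - u') - ((t - \<nu>) * \<eta>) *\<^sub>R g"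
  proof -
    have "(t - 1) *\<^sub>R (u' - u) = ((t - 1) * c) *\<^sub>R (s - u) - ((t - 1) * \<eta>) *\<^sub>R g"
      unfolding u' cdef by (simp add: algebra_simps)
    also have "\<dots> = (s' - u') - ((t - \<nu>) * \<eta>) *\<^sub>R g"
      unfolding z' c1 cdef[symmetric] by (simp add: algebra_simps)
    finally show ?thesis .
  qed
  then have h2: "(t - 1) *\<^sub>R (u' - u) = (s' - u') - (2 * \<beta> * (t - 1)) *\<^sub>R g" by (simp only: \<eta>t)
  have "2 * (t * (t - 1)) * ((b - a) \<bullet> (u' - u))
      = 2 * t * (b \<bullet> ((t - 1) *\<^sub>R (u' - u))) - 2 * (t - 1) * (a \<bullet> (t *\<^sub>R (u' - u)))"
    by (simp add: inner_diff_left algebra_simps)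
  then show "2 * (t * (t - 1)) * ((b - a) \<bullet> (u' - u)) = 2 * t * (b \<bullet> (s' - u')) - 4 * \<beta> * (t * (t - 1)) * (b \<bullet> g)
           - 2 * (t - 1) * (a \<bullet> (s - u)) + 2 * (t * (t - 1)) * \<eta> * (a \<bullet> g)"
    unfolding h1 h2 by (simp add: inner_diff_right algebra_simps)
  have "(norm s')\<^sup>2 = (norm s)\<^sup>2 - 2 * (\<nu> * \<eta>) * (g \<bullet> s) + (\<nu> * \<eta>)\<^sup>2 * (norm g)\<^sup>2"
    unfolding s' power2_norm_eq_inner by (simp add: inner_simps inner_commute algebra_simps power2_eq_square)
  then show "(1 - \<nu>) / (\<nu> * \<eta>) * (norm s')\<^sup>2
           = (1 - \<nu>) / (\<nu> * \<eta>) * (norm s)\<^sup>2 - 2 * (1 - \<nu>) * (g \<bullet> s) + (1 - \<nu>) * \<nu> * \<eta> * (norm g)\<^sup>2"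
    using \<eta>0 \<open>0 < \<nu>\<close> by (simp only: \<open>(norm s')\<^sup>2 = _\<close>) (simp add: field_simps power2_eq_square)
qed

text \<open>This balances all multiples of \<open>|w|\<^sup>2\<close> in one step: the left side collects what the step and the Young
inequalities produce, the right side is the old weight (recall \<open>\<mu> = 2 \<nu>\<close>) minus a dissipation linear
in \<open>t\<close>. Up to bounded terms the difference of the two weights is \<open>2 \<beta> (2 - 6 \<nu>) t\<close>, which is where
the bound \<open>\<mu> < 2 / 3\<close> comes from.\<close>

lemma residual_coefficient_bound:
  fixes t \<nu> \<beta> :: real
  assumes "0 < \<nu>" "\<nu> < 1/3" "t \<ge> 1 + 4 * \<nu>" "\<beta> > 0"
    and \<eta>: "\<eta> = 2 * \<beta> * (t - 1) / (t - \<nu>)"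
  shows "2 * (t * (t - 1)) * (\<eta> - \<beta>) + 2 * \<nu> * (1 - \<nu>) * \<eta> - 2 * \<beta> * (1 + \<nu>)
     + 8 * \<beta> * \<nu> * (1 - \<nu>) / t + 8 * \<beta> * \<nu> * (1 - \<nu>)\<^sup>2
   \<le> 2 * \<beta> * ((t - 2 * \<nu>) * (t - 2 * \<nu> - 1)) - \<beta> * (1 - 3 * \<nu>) / 10 * t"
proof -
  \<comment> \<open>The contributions of \<open>t (t - 1) \<eta>\<close> and of \<open>\<nu> (1 -
    \<nu>) \<eta>\<close> combine without remainder.\<close>
  have \<eta>': "(t * (t - 1)) * (\<eta> - 2 * \<beta>) + \<nu> * (1 - \<nu>) * \<eta> = - 2 * \<beta> * (1 - \<nu>) * (t - 1)"
  proof -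
    have "(t - \<nu>) * ((t * (t - 1)) * (\<eta> - 2 * \<beta>) + \<nu> * (1 - \<nu>) * \<eta>)
      = (t * (t - 1)) * ((t - \<nu>) * \<eta> - 2 * \<beta> * (t - \<nu>)) + \<nu> * (1 - \<nu>) * ((t - \<nu>) * \<eta>)"
      by (simp add: algebra_simps)
    also have "(t - \<nu>) * \<eta> = 2 * \<beta> * (t - 1)" using assms by simp
    finally have "(t - \<nu>) * ((t * (t - 1)) * (\<eta> - 2 * \<beta>) + \<nu> * (1 - \<nu>) * \<eta>)
      = (t - \<nu>) * (- 2 * \<beta> * (1 - \<nu>) * (t - 1))" by (simp add: algebra_simps)
    moreover have "t - \<nu> \<noteq> 0" using assms by simp
    ultimately show ?thesis by (metis mult_left_cancel)
  qed
  have tinv: "4 * \<nu> * (1 - \<nu>) / t \<le> 4 * \<nu> * (1 - \<nu>) / (1 + 4 * \<nu>)"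
    using assms by (intro divide_left_mono mult_pos_pos) auto
  have cubic: "4 * \<nu> * (1 - \<nu>) / (1 + 4 * \<nu>) + 4 * \<nu> * (1 - \<nu>)\<^sup>2 + (1 - 3*\<nu>) / 20 * (1 + 4 * \<nu>)
      \<le> 1 + 7 * \<nu> - 20 * \<nu>\<^sup>2"
  proof -
    have "0 \<le> (1 + 7 * \<nu> - 20 * \<nu>\<^sup>2 - 4 * \<nu> * (1 - \<nu>)\<^sup>2 - (1 - 3*\<nu>) / 20 * (1 + 4 * \<nu>)) * (1 + 4 * \<nu>) - 4 * \<nu> * (1 - \<nu>)"
    proof -
      have n2: "\<nu>\<^sup>2 \<le> \<nu> / 3" "\<nu>^3 \<le> \<nu>\<^sup>2 / 3" "\<nu>^4 \<le> \<nu>\<^sup>2 / 9"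
      proof -
        show 1: "\<nu>\<^sup>2 \<le> \<nu> / 3" using mult_left_mono[of \<nu> "1/3" \<nu>] assms by (simp add: power2_eq_square)
        show 2: "\<nu>^3 \<le> \<nu>\<^sup>2 / 3" using mult_left_mono[of \<nu> "1/3" "\<nu>\<^sup>2"] assms by (simp add: eval_nat_numeral mult_ac)
        show "\<nu>^4 \<le> \<nu>\<^sup>2 / 9" using mult_left_mono[of "\<nu>\<^sup>2" "1/9" "\<nu>\<^sup>2"] 1 assms by (simp flip: power_add)
      qed
      have "0 \<le> 19/20 + 11/4 * \<nu> + 22/5 * \<nu>\<^sup>2 - 248/5 * \<nu>^3 - 16 * \<nu>^4" using n2 assms by linarith
      also have "\<dots> = (1 + 7 * \<nu> - 20 * \<nu>\<^sup>2 - 4 * \<nu> * (1 - \<nu>)\<^sup>2 - (1 - 3*\<nu>) / 20 * (1 + 4 * \<nu>)) * (1 + 4 * \<nu>) - 4 * \<nu> * (1 - \<nu>)"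
        by (simp add: field_simps eval_nat_numeral)
      finally show ?thesis .
    qed
    then show ?thesis using assms by (simp add: field_simps)
  qed
  \<comment> \<open>What is needed is affine in \<open>t\<close> apart from the decreasing \<open>1
    / t\<close> term, so the smallest admissible value \<open>1 + 4 \<nu>\<close> is the worst
    case.\<close>
  have X: "(2 - 6 * \<nu> - (1 - 3 * \<nu>) / 20) * (t - (1 + 4 * \<nu>)) \<ge> 0"
    using assms by (intro mult_nonneg_nonneg) auto
  have "(2 - 6 * \<nu>) * t - 1 + 5 * \<nu> + 4 * \<nu>\<^sup>2 - (1 - 3 * \<nu>) / 20 * t
      = (2 - 6 * \<nu> - (1 - 3 * \<nu>) / 20) * (t - (1 + 4 * \<nu>)) + (1 + 7 * \<nu> - 20 * \<nu>\<^sup>2) - (1 - 3*\<nu>) / 20 * (1 + 4 * \<nu>)"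
    by (simp add: field_simps power2_eq_square)
  with tinv cubic X have "0 \<le> (2 - 6 * \<nu>) * t - 1 + 5 * \<nu> + 4 * \<nu>\<^sup>2 - 4 * \<nu> * (1 - \<nu>) / t - 4 * \<nu> * (1 - \<nu>)\<^sup>2 - (1 - 3 * \<nu>) / 20 * t"
    by linarith
  then have "0 \<le> 2 * \<beta> * ((2 - 6 * \<nu>) * t - 1 + 5 * \<nu> + 4 * \<nu>\<^sup>2 - 4 * \<nu> * (1 - \<nu>) / t - 4 * \<nu> * (1 - \<nu>)\<^sup>2 - (1 - 3 * \<nu>) / 20 * t)"
    using assms(4) by (intro mult_nonneg_nonneg) auto
  also have "\<dots> = (2 * \<beta> * ((t - 2 * \<nu>) * (t - 2 * \<nu> - 1)) - \<beta> * (1 - 3 * \<nu>) / 10 * t)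
     - (2 * (- 2 * \<beta> * (1 - \<nu>) * (t - 1)) + 2 * (t * (t - 1)) * \<beta> - 2 * \<beta> * (1 + \<nu>)
     + 8 * \<beta> * \<nu> * (1 - \<nu>) / t + 8 * \<beta> * \<nu> * (1 - \<nu>)\<^sup>2)"
  proof -
    define K where "K = (1 - \<nu>) / t"
    have "4 * \<nu> * (1 - \<nu>) / t = 4 * \<nu> * K" "8 * \<beta> * \<nu> * (1 - \<nu>) / t = 8 * \<beta> * \<nu> * K" by (simp_all add: K_def)
    then show ?thesis by (simp only:) (simp add: field_simps power2_eq_square)
  qed
  finally show ?thesis unfolding \<eta>'[symmetric] by (simp add: algebra_simps)
qed

text \<open>Apart from the search direction, a step contracts the lag by the factor \<open>1 - 1 / t\<close>; the part of \<open>|z|\<^sup>2\<close> lost in this way is used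
to absorb its products with the error and with the residual.\<close>

lemma lag_coefficient_bound:
  fixes t \<nu> \<beta> :: real
  assumes "0 < \<nu>" "\<nu> < 1" "t > 1" "\<beta> > 0"
    and \<eta>: "\<eta> = 2 * \<beta> * (t - 1) / (t - \<nu>)"
  shows "\<nu> / ((1 - \<nu>) * \<eta>) * (1 - 1 / t)\<^sup>2 \<le> \<nu> / ((1 - \<nu>) * \<eta>) - \<nu> / (2 * \<beta> * (1 - \<nu>) * t)"
proof -
  have \<eta>0: "\<eta> > 0" using assms by auto
  have "\<eta> \<le> 2 * \<beta>" using assms by (auto simp: divide_le_eq intro!: mult_left_mono)
  then have "\<nu> / (2 * \<beta> * (1 - \<nu>) * t) \<le> \<nu> / (\<eta> * (1 - \<nu>) * t)"
    using assms \<eta>0 by (intro divide_left_mono mult_right_mono mult_pos_pos) auto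
  also have "\<dots> = \<nu> / ((1 - \<nu>) * \<eta>) * (1 / t)" by (simp add: field_simps)
  also have "\<dots> \<le> \<nu> / ((1 - \<nu>) * \<eta>) * (1 - (1 - 1 / t)\<^sup>2)"
    using assms \<eta>0 by (intro mult_left_mono) (auto simp: field_simps power2_eq_square)
  finally show ?thesis by (simp add: algebra_simps)
qed

text \<open>The summands are, in order, the costs of absorbing the products of \<open>e\<close> with the difference of
residuals, with the anchor \<open>s\<close>, with the lag together with \<open>|e|\<^sup>2\<close> itself, and with the residual. Their sum
stays strictly below \<open>5 \<beta> / \<mu>\<close>, and the reserve is what makes the weighted errors summable.\<close>

lemma error_coefficient_bound:
  fixes \<nu> \<beta> :: real
  assumes "0 < \<mu>" "\<mu> < 2/3" "\<beta> > 0" "\<nu> = \<mu> / 2"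
  shows "\<beta> * (2 - \<mu>) / \<mu> + 2 * \<beta> + 8 * \<beta> * \<nu> * (1 - \<nu>) + \<beta> / \<mu> \<le> 5 * \<beta> / \<mu> - \<beta> / (10 * \<mu>)"
proof -
  have \<nu>: "0 < \<nu>" "\<nu> \<le> 1/3" using assms by auto
  have "\<nu> * (1 - \<nu>) \<le> 1/3 * (2/3)"
  proof -
    have "0 \<le> (1/3 - \<nu>) * (2/3 - \<nu>)" using \<nu> by simp
    also have "\<dots> = 2/9 - \<nu> * (1 - \<nu>)" by (simp add: field_simps)
    finally show ?thesis by simp
  qed
  then have "\<mu> * (1 + 8 * (\<nu> * (1 - \<nu>))) \<le> 2/3 * (1 + 8 * (2/9))"
    using assms \<nu> by (intro mult_mono) auto
  then have "\<beta> * (\<mu> * (1 + 8 * (\<nu> * (1 - \<nu>)))) \<le> \<beta> * (19/10)"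
    using assms by (intro mult_left_mono) auto
  then have "\<beta> * (\<mu> * (1 + 8 * (\<nu> * (1 - \<nu>)))) / \<mu> \<le> \<beta> * (19/10) / \<mu>"
    using assms by (intro divide_right_mono) auto
  moreover have "\<beta> * (2 - \<mu>) / \<mu> + 2 * \<beta> + 8 * \<beta> * \<nu> * (1 - \<nu>) + \<beta> / \<mu>
     = \<beta> * (\<mu> * (1 + 8 * (\<nu> * (1 - \<nu>)))) / \<mu> + 3 * \<beta> / \<mu>"
    using assms(1) by (simp add: diff_divide_distrib add_divide_distrib algebra_simps)
  moreover have "5 * \<beta> / \<mu> - \<beta> / (10 * \<mu>) = \<beta> * (19/10) / \<mu> + 3 * \<beta> / \<mu>"
    by (simp add: field_simps)
  ultimately show ?thesis by linarith
qed

text \<open>The last two bounds concern the coefficients of the product of residual and error. That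
\<open>2 \<beta> - \<eta>\<close> is of order \<open>1 / t\<close> makes them of order \<open>t\<close>, hence their squares of order \<open>t (t - 1)\<close>.\<close>

lemma stepsize_bounds:
  fixes t \<nu> \<beta> :: real
  assumes "0 < \<nu>" "\<nu> < 1/2" "t \<ge> 1 + 4 * \<nu>" "\<beta> > 0"
    and \<eta>: "\<eta> = 2 * \<beta> * (t - 1) / (t - \<nu>)"
  shows "0 < \<eta>" "\<eta> \<le> 2 * \<beta>" "\<eta> \<le> 2 * \<beta> * (t * (t - 1))"
    and "(2 * (t * (t - 1)) * (2 * \<beta> - \<eta>))\<^sup>2 \<le> 16 * \<beta>\<^sup>2 * (1 - \<nu>)\<^sup>2 * (t * (t - 1))"
    and "(2 * (t * (t - 1)) * (2 * \<beta> - \<eta>) - 4 * \<nu> * (1 - \<nu>) * \<eta>)\<^sup>2 \<le> 16 * \<beta>\<^sup>2 * (1 - \<nu>)\<^sup>2 * (t * (t - 1))"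
proof -
  have t: "t > 1" "t - \<nu> > 0" using assms by auto
  show \<eta>0: "\<eta> > 0" using assms by auto
  show "\<eta> \<le> 2 * \<beta>" using assms by (auto simp: divide_le_eq intro!: mult_left_mono)
  have "(t - 1) * 1 \<le> (t - 1) * (t * (t - \<nu>))"
  proof (intro mult_left_mono)
    have "1 * 1 \<le> t * (t - \<nu>)" using assms by (intro mult_mono) auto
    then show "1 \<le> t * (t - \<nu>)" by simp
  qed (use assms in auto)
  then have "2 * \<beta> * ((t - 1) * 1) \<le> 2 * \<beta> * ((t - 1) * (t * (t - \<nu>)))"
    using assms by (intro mult_left_mono) auto
  then have "2 * \<beta> * (t - 1) \<le> 2 * \<beta> * (t * (t - 1)) * (t - \<nu>)" by (simp only: mult_ac mult_1)
  then show "\<eta> \<le> 2 * \<beta> * (t * (t - 1))"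
    unfolding \<eta> using t by (simp add: pos_divide_le_eq)
  have 1: "(2 * \<beta> - \<eta>) = 2 * \<beta> * (1 - \<nu>) / (t - \<nu>)"
    using t by (simp add: \<eta> field_simps)
  define q where "q = t * (t - 1) / (t - \<nu>)"
  have q0: "q \<ge> 0" using t by (simp add: q_def)
  have "0 \<le> (1 - 2 * \<nu>) * t + \<nu>\<^sup>2" using assms by simp
  then have "t * (t - 1) \<le> (t - \<nu>) * (t - \<nu>)" by (simp add: algebra_simps power2_eq_square)
  then have "q \<le> t - \<nu>" using t by (simp add: q_def divide_le_eq)
  then have "q * q \<le> q * (t - \<nu>)" using q0 by (rule mult_left_mono)
  also have "\<dots> = t * (t - 1)" using t by (simp add: q_def)
  finally have q2: "q\<^sup>2 \<le> t * (t - 1)" by (simp add: power2_eq_square)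
  have 2: "2 * (t * (t - 1)) * (2 * \<beta> - \<eta>) = 4 * \<beta> * (1 - \<nu>) * q" unfolding 1 q_def by simp
  have 3: "4 * \<beta> * (1 - \<nu>) * q - 4 * \<nu> * (1 - \<nu>) * \<eta> = 4 * \<beta> * (1 - \<nu>) * ((t - 1) * (t - 2 * \<nu>) / (t - \<nu>))"
    unfolding \<eta> q_def divide_inverse by (simp add: algebra_simps)
  have 4: "\<dots> \<ge> 0" using assms t by (intro mult_nonneg_nonneg divide_nonneg_nonneg) auto
  have 5: "(4 * \<beta> * (1 - \<nu>) * q)\<^sup>2 \<le> 16 * \<beta>\<^sup>2 * (1 - \<nu>)\<^sup>2 * (t * (t - 1))"
    using q2 by (simp add: power_mult_distrib mult_left_mono)
  then show "(2 * (t * (t - 1)) * (2 * \<beta> - \<eta>))\<^sup>2 \<le> 16 * \<beta>\<^sup>2 * (1 - \<nu>)\<^sup>2 * (t * (t - 1))" unfolding 2 .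
  have "(4 * \<beta> * (1 - \<nu>) * q - 4 * \<nu> * (1 - \<nu>) * \<eta>)\<^sup>2 \<le> (4 * \<beta> * (1 - \<nu>) * q)\<^sup>2"
  proof (rule power_mono)
    have "4 * \<nu> * (1 - \<nu>) * \<eta> \<ge> 0" using \<eta>0 assms(1,2) by simp
    then show "4 * \<beta> * (1 - \<nu>) * q - 4 * \<nu> * (1 - \<nu>) * \<eta> \<le> 4 * \<beta> * (1 - \<nu>) * q" by linarith
    show "0 \<le> 4 * \<beta> * (1 - \<nu>) * q - 4 * \<nu> * (1 - \<nu>) * \<eta>" using 3 4 by linarith
  qed
  with 5 show "(2 * (t * (t - 1)) * (2 * \<beta> - \<eta>) - 4 * \<nu> * (1 - \<nu>) * \<eta>)\<^sup>2 \<le> 16 * \<beta>\<^sup>2 * (1 - \<nu>)\<^sup>2 * (t * (t - 1))" unfolding 2 by linarith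
qed

text \<open>The restriction of \<open>\<beta>\<close> is equivalent to \<open>\<beta>bar - \<beta> \<ge> 2 \<mu> \<beta> / (2 - \<mu>)\<close>, and this lower bound is the constant
used in Young's inequality.\<close>

lemma difference_absorbs_error:
  fixes x e :: "'a::real_inner"
  assumes \<mu>: "0 < \<mu>" "\<mu> < 2/3" and \<beta>: "0 < \<beta>" "\<beta> * (2 + \<mu>) \<le> (2 - \<mu>) * \<beta>bar" and p: "0 \<le> p"
  shows "- 2 * p * (\<beta>bar - \<beta>) * (norm x)\<^sup>2 + (- (4 * \<beta> * p)) * (x \<bullet> e) \<le> (\<beta> * (2 - \<mu>) / \<mu> * p) * (norm e)\<^sup>2"
proof -
  define B' where "B' = 2 * \<mu> * \<beta> / (2 - \<mu>)"
  have "\<beta> + B' = \<beta> * (2 + \<mu>) / (2 - \<mu>)" using \<mu> by (simp add: B'_def field_simps)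
  also have "\<dots> \<le> \<beta>bar" using \<beta>(2) \<mu> by (simp add: divide_le_eq mult_ac)
  finally have "2 * p * B' * (norm x)\<^sup>2 \<le> 2 * p * (\<beta>bar - \<beta>) * (norm x)\<^sup>2"
    using p by (intro mult_right_mono mult_left_mono) auto
  moreover have "p * ((- (4 * \<beta>)) * (x \<bullet> e)) \<le> p * ((2 * B') * (norm x)\<^sup>2 + (\<beta> * (2 - \<mu>) / \<mu>) * (norm e)\<^sup>2)"
    using \<mu> \<beta> by (intro mult_left_mono inner_young p) (auto simp: B'_def power2_eq_square field_simps)
  ultimately show ?thesis by (simp add: algebra_simps)
qed

lemma residual_absorbs_error:
  fixes a e :: "'a::real_inner"
  assumes "0 < \<mu>" "0 < \<beta>" "0 < p" "x\<^sup>2 \<le> 16 * \<beta>\<^sup>2 * (1 - \<nu>)\<^sup>2 * p"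
  shows "(- x) * (e \<bullet> a) \<le> (\<beta> / \<mu> * p) * (norm e)\<^sup>2 + (4 * \<beta> * (1 - \<nu>)\<^sup>2 * \<mu>) * (norm a)\<^sup>2"
proof (rule inner_young)
  have "16 * \<beta>\<^sup>2 * (1 - \<nu>)\<^sup>2 * p = 4 * (\<beta> / \<mu> * p) * (4 * \<beta> * (1 - \<nu>)\<^sup>2 * \<mu>)"
    using assms(1) by (simp add: power2_eq_square[of \<beta>])
  then show "(- x)\<^sup>2 \<le> 4 * (\<beta> / \<mu> * p) * (4 * \<beta> * (1 - \<nu>)\<^sup>2 * \<mu>)" using assms(4) by simp
qed (use assms in auto)

text \<open>One step of the Lyapunov estimate, with a zero of the residual at the origin; \<open>a\<close> and \<open>b\<close> are the values
of the residual \<open>w\<close> before and after the step. The number \<open>\<delta>\<close> is the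
amount by which the weight of \<open>|s|\<^sup>2\<close> drops; its lower bound is exactly what Young's inequality needs
to trade \<open>e \<bullet> s\<close> for \<open>t (t - 1) |e|\<^sup>2\<close>.

With the weight \<open>(1 - \<mu>) / (\<nu> \<eta>)\<close> of \<open>|s|\<^sup>2\<close> alone the products \<open>w \<bullet> z\<close> would already cancel, but the
Lyapunov function would dominate \<open>\<beta> t\<^sup>2 |w|\<^sup>2\<close> only for \<open>\<mu> \<le> 1 / 2\<close>. The weights used here add
\<open>1 / \<eta>\<close> times \<open>|s|\<^sup>2 + \<nu> / (1 - \<nu>) |s - u|\<^sup>2\<close>. Writing \<open>s = \<nu> u + (1 - \<nu>) q\<close>, this sum equals
\<open>\<nu> |u|\<^sup>2 + (1 - \<nu>) |q|\<^sup>2\<close>, which does not grow under the averaging part of the step because \<open>u\<close> and \<open>q\<close>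
only move towards each other.\<close>

lemma lyapunov_step:
  fixes a b e u s u' s' :: "'a::real_inner"
  assumes \<mu>: "0 < \<mu>" "\<mu> < 2/3" and \<nu>: "\<nu> = \<mu> / 2" and t: "t \<ge> 1 + 2 * \<mu>"
    and \<beta>: "0 < \<beta>" "\<beta> * (2 + \<mu>) \<le> (2 - \<mu>) * \<beta>bar"
    and \<eta>: "\<eta> = 2 * \<beta> * (t - 1) / (t - \<nu>)"
    and u': "u' = u + (1 / t) *\<^sub>R (s - u) - \<eta> *\<^sub>R (a + e)"
    and s': "s' = s - (\<nu> * \<eta>) *\<^sub>R (a + e)"
    and au: "\<beta>bar * (norm a)\<^sup>2 \<le> a \<bullet> u"
    and \<delta>: "0 < \<delta>" "(1 - \<nu>)\<^sup>2 \<le> 2 * \<beta> * (t * (t - 1)) * \<delta>"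
  shows "2 * \<beta> * (t * (t - 1)) * (norm b)\<^sup>2 - 2 * t * (b \<bullet> (s' - u'))
         + (1 - \<nu>) / (\<nu> * \<eta>) * (norm s')\<^sup>2 + \<nu> / ((1 - \<nu>) * \<eta>) * (norm (s' - u'))\<^sup>2
         + 2 * (t * (t - 1)) * ((b - a) \<bullet> (u' - u) - \<beta>bar * (norm (b - a))\<^sup>2)
         + \<beta> * (1 - 3 * \<nu>) / 10 * t * (norm a)\<^sup>2
         + \<nu> / (8 * \<beta> * (1 - \<nu>) * t) * (norm (s - u))\<^sup>2
    \<le> 2 * \<beta> * ((t - \<mu>) * (t - \<mu> - 1)) * (norm a)\<^sup>2 - 2 * (t - \<mu>) * (a \<bullet> (s - u))
         + ((1 - \<nu>) / (\<nu> * \<eta>) + \<delta>) * (norm s)\<^sup>2 + \<nu> / ((1 - \<nu>) * \<eta>) * (norm (s - u))\<^sup>2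
         + (5 * \<beta> / \<mu> - \<beta> / (10 * \<mu>)) * (t * (t - 1)) * (norm e)\<^sup>2"
proof -
  have \<nu>1: "0 < \<nu>" "\<nu> < 1/3" "\<nu> < 1/2" "\<nu> < 1" "\<mu> = 2 * \<nu>" "t \<ge> 1 + 4 * \<nu>" "t > 1" using \<mu> \<nu> t by auto
  define p where "p = t * (t - 1)"
  define z where "z = s - u"
  define c where "c = 1 - 1 / t"
  have p0: "p > 0" using \<nu>1 by (simp add: p_def)
  have c: "0 \<le> c" "c\<^sup>2 * t \<le> p"
  proof -
    show "0 \<le> c" using \<nu>1 by (simp add: c_def)
    have "c\<^sup>2 * t = (t - 1) * c" using \<nu>1 by (simp add: c_def field_simps power2_eq_square)
    also have "\<dots> \<le> (t - 1) * t"
    proof (intro mult_left_mono)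
      have "c \<le> 1" using \<nu>1 by (simp add: c_def)
      then show "c \<le> t" using \<nu>1 by linarith
    qed (use \<nu>1 in auto)
    finally show "c\<^sup>2 * t \<le> p" by (simp add: p_def mult_ac)
  qed
  note eb = stepsize_bounds[OF \<nu>1(1,3,6) \<beta>(1) \<eta>, folded p_def]
  note I = step_identities(1)[OF \<nu>1(7,4,1) \<beta>(1) \<eta> u' s', where a=a and b=b, folded p_def z_def]
    step_identities(2)[OF \<nu>1(7,4,1) \<beta>(1) \<eta> u' s']
    step_identities(3)[OF \<nu>1(7,4,1) \<beta>(1) \<eta> u' s', folded z_def, folded c_def]
  note Y1 = difference_absorbs_error[OF \<mu> \<beta> less_imp_le[OF p0], of "b - a" e]
  have Y2: "(- (2 * (1 - \<nu>))) * (s \<bullet> e) \<le> \<delta> * (norm s)\<^sup>2 + (2 * \<beta> * p) * (norm e)\<^sup>2"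
  proof (rule inner_young)
    have "(- (2 * (1 - \<nu>)))\<^sup>2 = 4 * (1 - \<nu>)\<^sup>2" by (simp only: power2_minus power_mult_distrib) simp
    also have "\<dots> \<le> 4 * (2 * \<beta> * p * \<delta>)" using \<delta>(2)[folded p_def] by (rule mult_left_mono) simp
    finally show "(- (2 * (1 - \<nu>)))\<^sup>2 \<le> 4 * \<delta> * (2 * \<beta> * p)" by (simp add: mult_ac)
  qed (use \<delta> \<beta> p0 in auto)
  have Y3: "(2 * \<nu> * c) * (z \<bullet> e) \<le> \<nu> / (4 * \<beta> * (1 - \<nu>) * t) * (norm z)\<^sup>2 + (4 * \<beta> * \<nu> * (1 - \<nu>) * p) * (norm e)\<^sup>2"
  proof (rule inner_young)
    have "(2 * \<nu> * c)\<^sup>2 * t = 4 * \<nu>\<^sup>2 * (c\<^sup>2 * t)" by (simp add: power_mult_distrib)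
    also have "\<dots> \<le> 4 * \<nu>\<^sup>2 * p" using c by (intro mult_left_mono) auto
    also have "\<dots> = (4 * (\<nu> / (4 * \<beta> * (1 - \<nu>) * t)) * (4 * \<beta> * \<nu> * (1 - \<nu>) * p)) * t"
      using \<nu>1 \<beta> by (simp add: field_simps power2_eq_square)
    finally show "(2 * \<nu> * c)\<^sup>2 \<le> 4 * (\<nu> / (4 * \<beta> * (1 - \<nu>) * t)) * (4 * \<beta> * \<nu> * (1 - \<nu>) * p)"
      using \<nu>1 by (simp add: mult_le_cancel_right)
  qed (use \<nu>1 \<beta> p0 in auto)
  have Y4: "(- (2 * \<nu> / t)) * (z \<bullet> a) \<le> \<nu> / (8 * \<beta> * (1 - \<nu>) * t) * (norm z)\<^sup>2 + (8 * \<beta> * \<nu> * (1 - \<nu>) / t) * (norm a)\<^sup>2"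
    using \<nu>1 \<beta> by (intro inner_young) (auto simp: power2_eq_square field_simps)
  have Y5: "(- (2 * p * (2 * \<beta> - \<eta>) - 4 * \<nu> * (1 - \<nu>) * \<eta>)) * (e \<bullet> a) \<le> (\<beta> / \<mu> * p) * (norm e)\<^sup>2 + (4 * \<beta> * (1 - \<nu>)\<^sup>2 * \<mu>) * (norm a)\<^sup>2"
    using \<mu> \<beta> p0 eb(5) by (intro residual_absorbs_error) auto
  have Y6: "2 * \<nu> * (1 - \<nu>) * \<eta> * (norm e)\<^sup>2 \<le> (4 * \<beta> * \<nu> * (1 - \<nu>) * p) * (norm e)\<^sup>2"
    using mult_left_mono[OF eb(3), of "2 * \<nu> * (1 - \<nu>)"] \<nu>1 by (intro mult_right_mono) (auto simp: mult_ac)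
  have Y7: "- (2 * (1 - \<nu>) * (a \<bullet> u)) \<le> - (2 * \<beta> * (1 + \<nu>)) * (norm a)\<^sup>2"
  proof -
    have "2 * \<beta> * (1 + \<nu>) * (norm a)\<^sup>2 \<le> 2 * ((1 - \<nu>) * \<beta>bar) * (norm a)\<^sup>2"
      using \<beta>(2) \<nu> by (intro mult_right_mono) (auto simp: field_simps)
    also have "\<dots> \<le> 2 * (1 - \<nu>) * (a \<bullet> u)" using mult_left_mono[OF au, of "2 * (1 - \<nu>)"] \<nu>1 by (simp add: mult_ac)
    finally show ?thesis by simp
  qed
  have Y8: "\<nu> / ((1 - \<nu>) * \<eta>) * c\<^sup>2 * (norm z)\<^sup>2 \<le> (\<nu> / ((1 - \<nu>) * \<eta>) - \<nu> / (2 * \<beta> * (1 - \<nu>) * t)) * (norm z)\<^sup>2"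
    using lag_coefficient_bound[OF \<nu>1(1,4,7) \<beta>(1) \<eta>] by (intro mult_right_mono) (auto simp: c_def)
  have Na: "(2 * p * (\<eta> - \<beta>) + 2 * \<nu> * (1 - \<nu>) * \<eta> - 2 * \<beta> * (1 + \<nu>)
     + 8 * \<beta> * \<nu> * (1 - \<nu>) / t + 8 * \<beta> * \<nu> * (1 - \<nu>)\<^sup>2) * (norm a)\<^sup>2
    \<le> (2 * \<beta> * ((t - \<mu>) * (t - \<mu> - 1)) - \<beta> * (1 - 3 * \<nu>) / 10 * t) * (norm a)\<^sup>2"
    using residual_coefficient_bound[OF \<nu>1(1,2,6) \<beta>(1) \<eta>, folded p_def] \<nu>1(5) by (intro mult_right_mono) auto
  have Ne: "(\<beta> * (2 - \<mu>) / \<mu> + 2 * \<beta> + 8 * \<beta> * \<nu> * (1 - \<nu>) + \<beta> / \<mu>) * p * (norm e)\<^sup>2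
     \<le> (5 * \<beta> / \<mu> - \<beta> / (10 * \<mu>)) * p * (norm e)\<^sup>2"
    using error_coefficient_bound[OF \<mu> \<beta>(1) \<nu>] p0 by (intro mult_right_mono) auto
  define g where "g = a + e"
  have zz: "s' - u' = c *\<^sub>R z + ((1 - \<nu>) * \<eta>) *\<^sub>R g" using I(3) by (simp add: g_def)
  have "(norm (s' - u'))\<^sup>2 = c\<^sup>2 * (norm z)\<^sup>2 + 2 * c * ((1 - \<nu>) * \<eta>) * (g \<bullet> z) + ((1 - \<nu>) * \<eta>)\<^sup>2 * (norm g)\<^sup>2"
    unfolding zz power2_norm_eq_inner by (simp add: inner_simps inner_commute algebra_simps power2_eq_square)
  then have I4: "\<nu> / ((1 - \<nu>) * \<eta>) * (norm (s' - u'))\<^sup>2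
     = \<nu> / ((1 - \<nu>) * \<eta>) * c\<^sup>2 * (norm z)\<^sup>2 + 2 * \<nu> * c * (g \<bullet> z) + \<nu> * (1 - \<nu>) * \<eta> * (norm g)\<^sup>2"
    using eb(1) \<nu>1 by (simp only: \<open>(norm (s' - u'))\<^sup>2 = _\<close>) (simp add: field_simps power2_eq_square)
  have tc: "1 / t = 1 - c" by (simp add: c_def)
  have ea: "(norm (b - a))\<^sup>2 = (norm b)\<^sup>2 - 2 * (b \<bullet> a) + (norm a)\<^sup>2"
      "(norm g)\<^sup>2 = (norm a)\<^sup>2 + 2 * (e \<bullet> a) + (norm e)\<^sup>2"
      "g \<bullet> z = z \<bullet> a + z \<bullet> e" "b \<bullet> g = b \<bullet> a + b \<bullet> e" "(b - a) \<bullet> e = b \<bullet> e - e \<bullet> a"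
      "g \<bullet> s = a \<bullet> u + z \<bullet> a + s \<bullet> e" "a \<bullet> g = (norm a)\<^sup>2 + e \<bullet> a" "a \<bullet> z = z \<bullet> a"
    unfolding power2_norm_eq_inner g_def z_def by (simp_all add: inner_simps inner_commute)
  have key: "2 * \<beta> * p * (norm b)\<^sup>2 - 2 * t * (b \<bullet> (s' - u'))
         + (1 - \<nu>) / (\<nu> * \<eta>) * (norm s')\<^sup>2 + \<nu> / ((1 - \<nu>) * \<eta>) * (norm (s' - u'))\<^sup>2
         + 2 * p * ((b - a) \<bullet> (u' - u) - \<beta>bar * (norm (b - a))\<^sup>2)
     = - 2 * (t - \<mu>) * (a \<bullet> z) + (1 - \<nu>) / (\<nu> * \<eta>) * (norm s)\<^sup>2 + \<nu> / ((1 - \<nu>) * \<eta>) * c\<^sup>2 * (norm z)\<^sup>2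
        - 2 * p * (\<beta>bar - \<beta>) * (norm (b - a))\<^sup>2
        + (2 * p * (\<eta> - \<beta>) + 2 * \<nu> * (1 - \<nu>) * \<eta>) * (norm a)\<^sup>2
        - 2 * (1 - \<nu>) * (a \<bullet> u) + (- (4 * \<beta> * p)) * ((b - a) \<bullet> e)
        + (- (2 * p * (2 * \<beta> - \<eta>) - 4 * \<nu> * (1 - \<nu>) * \<eta>)) * (e \<bullet> a)
        + 2 * \<nu> * (1 - \<nu>) * \<eta> * (norm e)\<^sup>2
        + (- (2 * (1 - \<nu>))) * (s \<bullet> e) + (2 * \<nu> * c) * (z \<bullet> e) + (- (2 * \<nu> / t)) * (z \<bullet> a)"
  proof -
    have tc': "2 * \<nu> / t = 2 * \<nu> * (1 - c)" using tc by (metis times_divide_eq_right mult.right_neutral)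
    show ?thesis
      using I(1)[folded g_def] I(2)[folded g_def] I4 unfolding ea tc' right_diff_distrib[of "2 * p"]
      unfolding \<open>\<mu> = 2 * \<nu>\<close> by (simp add: algebra_simps)
  qed
  define D where "D = \<nu> / (8 * \<beta> * (1 - \<nu>) * t)"
  have D: "\<nu> / (4 * \<beta> * (1 - \<nu>) * t) = 2 * D" "\<nu> / (2 * \<beta> * (1 - \<nu>) * t) = 4 * D"
    using \<nu>1 \<beta> by (simp_all add: D_def field_simps)
  show ?thesis
    using key Y1 Y2 Y3 Y4 Y5 Y6 Y7 Y8 Na Ne unfolding p_def[symmetric] z_def[symmetric] D D_def[symmetric] \<open>\<mu> = 2 * \<nu>\<close>
    unfolding distrib_right left_diff_distrib by (simp add: algebra_simps)
qed

text \<open>The same step without the anchor term, for an arbitrary weight of \<open>|z|\<^sup>2\<close>. The product \<open>w \<bullet> z\<close> that is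
no longer cancelled is of the size \<open>t |w|\<^sup>2 + |z|\<^sup>2 / t\<close>, which is summable once the Lyapunov estimate
is known.\<close>

lemma energy_step:
  fixes a b e u s u' s' :: "'a::real_inner"
  assumes \<mu>: "0 < \<mu>" "\<mu> < 2/3" and \<nu>: "\<nu> = \<mu> / 2" and t: "t \<ge> 1 + 2 * \<mu>"
    and \<beta>: "0 < \<beta>" "\<beta> * (2 + \<mu>) \<le> (2 - \<mu>) * \<beta>bar"
    and \<eta>: "\<eta> = 2 * \<beta> * (t - 1) / (t - \<nu>)"
    and u': "u' = u + (1 / t) *\<^sub>R (s - u) - \<eta> *\<^sub>R (a + e)"
    and s': "s' = s - (\<nu> * \<eta>) *\<^sub>R (a + e)"
    and gap: "\<beta>bar * (norm (b - a))\<^sup>2 \<le> (b - a) \<bullet> (u' - u)"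
    and K: "K \<ge> 0"
  shows "2 * \<beta> * (t * (t - 1)) * (norm b)\<^sup>2 - 2 * t * (b \<bullet> (s' - u')) + K * (norm (s' - u'))\<^sup>2
    \<le> 2 * \<beta> * ((t - \<mu>) * (t - \<mu> - 1)) * (norm a)\<^sup>2 - 2 * (t - \<mu>) * (a \<bullet> (s - u)) + K * (norm (s - u))\<^sup>2
     + (8 * \<beta> * \<mu> + 1 + 16 * K * \<beta>\<^sup>2) * t * (norm a)\<^sup>2 + (1 + K) * ((norm (s - u))\<^sup>2 / t)
     + (3 * \<beta> / \<mu> + 8 * K * \<beta>\<^sup>2 / \<mu>) * (t * (t - 1)) * (norm e)\<^sup>2"
proof -
  have \<nu>1: "0 < \<nu>" "\<nu> < 1/3" "\<nu> < 1/2" "\<nu> < 1" "\<mu> = 2 * \<nu>" "t \<ge> 1 + 4 * \<nu>" "t > 1" using \<mu> \<nu> t by auto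
  define p where "p = t * (t - 1)"
  define z where "z = s - u"
  define c where "c = 1 - 1 / t"
  define g where "g = a + e"
  have p0: "p > 0" using \<nu>1 by (simp add: p_def)
  note eb = stepsize_bounds[OF \<nu>1(1,3,6) \<beta>(1) \<eta>, folded p_def]
  note I = step_identities(1)[OF \<nu>1(7,4,1) \<beta>(1) \<eta> u' s', where a=a and b=b, folded p_def z_def, folded g_def]
    step_identities(3)[OF \<nu>1(7,4,1) \<beta>(1) \<eta> u' s', folded z_def, folded c_def g_def]
  note Y1 = difference_absorbs_error[OF \<mu> \<beta> less_imp_le[OF p0], of "b - a" e]
  have Y5: "(- (2 * p * (2 * \<beta> - \<eta>))) * (e \<bullet> a) \<le> (\<beta> / \<mu> * p) * (norm e)\<^sup>2 + (4 * \<beta> * (1 - \<nu>)\<^sup>2 * \<mu>) * (norm a)\<^sup>2"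
    using \<mu> \<beta> p0 eb(4) by (intro residual_absorbs_error) auto
  have G: "2 * p * (\<beta>bar * (norm (b - a))\<^sup>2) \<le> 2 * p * ((b - a) \<bullet> (u' - u))"
    using gap p0 by (intro mult_left_mono) auto
  have ea: "(norm (b - a))\<^sup>2 = (norm b)\<^sup>2 - 2 * (b \<bullet> a) + (norm a)\<^sup>2"
      "b \<bullet> g = b \<bullet> a + b \<bullet> e" "(b - a) \<bullet> e = b \<bullet> e - e \<bullet> a"
      "a \<bullet> g = (norm a)\<^sup>2 + e \<bullet> a"
    unfolding power2_norm_eq_inner g_def z_def by (simp_all add: inner_simps inner_commute)
  have key: "2 * \<beta> * p * (norm b)\<^sup>2 - 2 * t * (b \<bullet> (s' - u'))
         + 2 * p * ((b - a) \<bullet> (u' - u)) - 2 * p * (\<beta>bar * (norm (b - a))\<^sup>2)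
     = - 2 * (t - 1) * (a \<bullet> z)
        - 2 * p * (\<beta>bar - \<beta>) * (norm (b - a))\<^sup>2
        + 2 * p * (\<eta> - \<beta>) * (norm a)\<^sup>2
        + (- (4 * \<beta> * p)) * ((b - a) \<bullet> e)
        + (- (2 * p * (2 * \<beta> - \<eta>))) * (e \<bullet> a)"
    using I(1) unfolding ea by (simp add: algebra_simps)
  have Y10: "(2 * (1 - \<mu>)) * (a \<bullet> z) \<le> t * (norm a)\<^sup>2 + (1 / t) * (norm z)\<^sup>2"
  proof (rule inner_young)
    have "(1 - \<mu>)\<^sup>2 \<le> 1" using \<mu> by (intro power_le_one) auto
    moreover have "(2 * (1 - \<mu>))\<^sup>2 = 4 * (1 - \<mu>)\<^sup>2" by (simp only: power_mult_distrib) simp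
    moreover have "4 * t * (1 / t) = 4" using \<nu>1(7) by simp
    ultimately show "(2 * (1 - \<mu>))\<^sup>2 \<le> 4 * t * (1 / t)" by linarith
  qed (use \<nu>1 in auto)
  have Na: "(2 * p * (\<eta> - \<beta>) + 4 * \<beta> * (1 - \<nu>)\<^sup>2 * \<mu>) * (norm a)\<^sup>2
      \<le> (2 * \<beta> * ((t - \<mu>) * (t - \<mu> - 1)) + 8 * \<beta> * \<mu> * t) * (norm a)\<^sup>2"
  proof (intro mult_right_mono)
    have "2 * p * (\<eta> - \<beta>) \<le> 2 * p * \<beta>" using eb p0 by (intro mult_left_mono) auto
    also have "\<dots> = 2 * \<beta> * ((t - \<mu>) * (t - \<mu> - 1)) + 4 * \<beta> * \<mu> * t - 2 * \<beta> * (\<mu> + \<mu>\<^sup>2)"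
      by (simp add: p_def algebra_simps power2_eq_square)
    finally have 1: "2 * p * (\<eta> - \<beta>) \<le> 2 * \<beta> * ((t - \<mu>) * (t - \<mu> - 1)) + 4 * \<beta> * \<mu> * t - 2 * \<beta> * (\<mu> + \<mu>\<^sup>2)" .
    have "2 * \<beta> * (\<mu> + \<mu>\<^sup>2) \<ge> 0" using \<mu> \<beta> by simp
    have "(1 - \<nu>)\<^sup>2 \<le> 1" using \<nu>1 by (intro power_le_one) auto
    then have "(4 * \<beta> * \<mu>) * (1 - \<nu>)\<^sup>2 \<le> (4 * \<beta> * \<mu>) * t"
      using \<nu>1(7) by (intro mult_left_mono) (use \<mu> \<beta> in \<open>linarith, simp\<close>)
    then have "4 * \<beta> * (1 - \<nu>)\<^sup>2 * \<mu> \<le> 4 * \<beta> * \<mu> * t" by (simp only: mult_ac)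
    then show "2 * p * (\<eta> - \<beta>) + 4 * \<beta> * (1 - \<nu>)\<^sup>2 * \<mu> \<le> 2 * \<beta> * ((t - \<mu>) * (t - \<mu> - 1)) + 8 * \<beta> * \<mu> * t"
      using 1 \<open>2 * \<beta> * (\<mu> + \<mu>\<^sup>2) \<ge> 0\<close> by linarith
  qed simp
  have Ne: "(\<beta> * (2 - \<mu>) / \<mu> + \<beta> / \<mu>) * (p * (norm e)\<^sup>2) \<le> (3 * \<beta> / \<mu>) * (p * (norm e)\<^sup>2)"
    using \<mu> \<beta> p0 by (intro mult_right_mono) (auto simp: field_simps)
  have main: "2 * \<beta> * p * (norm b)\<^sup>2 - 2 * t * (b \<bullet> (s' - u'))
     \<le> 2 * \<beta> * ((t - \<mu>) * (t - \<mu> - 1)) * (norm a)\<^sup>2 - 2 * (t - \<mu>) * (a \<bullet> z)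
      + (8 * \<beta> * \<mu> + 1) * t * (norm a)\<^sup>2 + (norm z)\<^sup>2 / t + 3 * \<beta> / \<mu> * (p * (norm e)\<^sup>2)"
    using key Y1 Y5 G Y10 Na Ne by (simp add: algebra_simps)
  have zz: "(norm (s' - u'))\<^sup>2 = c\<^sup>2 * (norm z)\<^sup>2 + (2 * c * ((1 - \<nu>) * \<eta>)) * (g \<bullet> z) + ((1 - \<nu>) * \<eta>)\<^sup>2 * (norm g)\<^sup>2"
    unfolding I(2) power2_norm_eq_inner by (simp add: inner_simps inner_commute algebra_simps power2_eq_square)
  have c: "0 \<le> c" "c \<le> 1" using \<nu>1 by (auto simp: c_def)
  have f: "0 \<le> (1 - \<nu>) * \<eta>" "(1 - \<nu>) * \<eta> \<le> 2 * \<beta>"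
    using mult_mono[of "1 - \<nu>" 1 \<eta> "2 * \<beta>"] eb \<nu>1 \<beta> by auto
  have f2: "((1 - \<nu>) * \<eta>)\<^sup>2 \<le> 4 * \<beta>\<^sup>2" using power_mono[OF f(2,1), of 2] by (simp add: power_mult_distrib)
  have "(2 * c * ((1 - \<nu>) * \<eta>)) * (g \<bullet> z) \<le> (4 * \<beta>\<^sup>2 * t) * (norm g)\<^sup>2 + (1 / t) * (norm z)\<^sup>2"
  proof (rule inner_young)
    have "(2 * c * ((1 - \<nu>) * \<eta>))\<^sup>2 = 4 * (c\<^sup>2 * ((1 - \<nu>) * \<eta>)\<^sup>2)" by (simp add: power_mult_distrib)
    also have "\<dots> \<le> 4 * (1 * (4 * \<beta>\<^sup>2))" using c f2 by (intro mult_left_mono mult_mono) (auto intro: power_le_one)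
    finally show "(2 * c * ((1 - \<nu>) * \<eta>))\<^sup>2 \<le> 4 * (4 * \<beta>\<^sup>2 * t) * (1 / t)" using \<nu>1 by simp
  qed (use \<nu>1 \<beta> in auto)
  moreover have "((1 - \<nu>) * \<eta>)\<^sup>2 * (norm g)\<^sup>2 \<le> (4 * \<beta>\<^sup>2 * t) * (norm g)\<^sup>2"
  proof (rule mult_right_mono)
    have "4 * \<beta>\<^sup>2 * 1 \<le> 4 * \<beta>\<^sup>2 * t" using \<nu>1 by (intro mult_left_mono) auto
    then show "((1 - \<nu>) * \<eta>)\<^sup>2 \<le> 4 * \<beta>\<^sup>2 * t" using f2 by linarith
  qed simp
  moreover have "c\<^sup>2 * (norm z)\<^sup>2 \<le> 1 * (norm z)\<^sup>2" using c by (intro mult_right_mono power_le_one) auto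
  ultimately have z1: "(norm (s' - u'))\<^sup>2 \<le> (norm z)\<^sup>2 + (norm z)\<^sup>2 / t + 8 * \<beta>\<^sup>2 * (t * (norm g)\<^sup>2)"
    unfolding zz by simp
  have "(norm g)\<^sup>2 \<le> 2 * (norm a)\<^sup>2 + 2 * (norm e)\<^sup>2"
  proof -
    have "2 * (a \<bullet> e) \<le> 1 * (norm a)\<^sup>2 + 1 * (norm e)\<^sup>2" by (rule inner_young) auto
    then show ?thesis by (simp add: g_def power2_norm_eq_inner inner_simps inner_commute)
  qed
  then have "t * (norm g)\<^sup>2 \<le> t * (2 * (norm a)\<^sup>2 + 2 * (norm e)\<^sup>2)" using \<nu>1 by (intro mult_left_mono) auto
  also have "\<dots> = 2 * t * (norm a)\<^sup>2 + 2 * t * (norm e)\<^sup>2" by (simp add: algebra_simps)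
  also have "\<dots> \<le> 2 * t * (norm a)\<^sup>2 + p / \<mu> * (norm e)\<^sup>2"
  proof (intro add_left_mono mult_right_mono)
    have "t * (2 * \<mu>) \<le> p" unfolding p_def using t \<nu>1 by (intro mult_left_mono) auto
    then show "2 * t \<le> p / \<mu>" using \<mu> by (simp add: field_simps)
  qed simp
  finally have z2: "8 * \<beta>\<^sup>2 * (t * (norm g)\<^sup>2) \<le> 8 * \<beta>\<^sup>2 * (2 * t * (norm a)\<^sup>2 + p / \<mu> * (norm e)\<^sup>2)"
    by (intro mult_left_mono) auto
  have "K * (norm (s' - u'))\<^sup>2 \<le> K * ((norm z)\<^sup>2 + (norm z)\<^sup>2 / t + 8 * \<beta>\<^sup>2 * (2 * t * (norm a)\<^sup>2 + p / \<mu> * (norm e)\<^sup>2))"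
    using z1 z2 K by (intro mult_left_mono) linarith+
  also have "\<dots> = K * (norm z)\<^sup>2 + K * ((norm z)\<^sup>2 / t) + 16 * K * \<beta>\<^sup>2 * t * (norm a)\<^sup>2 + 8 * K * \<beta>\<^sup>2 / \<mu> * (p * (norm e)\<^sup>2)"
    by (simp add: field_simps)
  finally show ?thesis using main unfolding p_def[symmetric] z_def[symmetric]
    by (simp add: distrib_right mult.assoc add_divide_distrib)
qed

lemma lyapunov_lower:
  fixes a u s :: "'a::real_inner"
  assumes "0 < \<beta>" "\<beta> \<le> \<beta>bar" "0 \<le> t" "1 / \<beta> \<le> c" and au: "\<beta>bar * (norm a)\<^sup>2 \<le> a \<bullet> u"
  shows "\<beta> * t\<^sup>2 * (norm a)\<^sup>2 \<le> 2 * \<beta> * (t * (t - 1)) * (norm a)\<^sup>2 - 2 * t * (a \<bullet> (s - u)) + c * (norm s)\<^sup>2"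
proof -
  have "(2 * t) * (s \<bullet> a) \<le> (1 / \<beta>) * (norm s)\<^sup>2 + (\<beta> * t\<^sup>2) * (norm a)\<^sup>2"
    using assms by (intro inner_young) (auto simp: power_mult_distrib)
  moreover have "(1 / \<beta>) * (norm s)\<^sup>2 \<le> c * (norm s)\<^sup>2" using assms by (intro mult_right_mono) auto
  moreover have "2 * t * (\<beta> * (norm a)\<^sup>2) \<le> 2 * t * (a \<bullet> u)"
  proof -
    have "\<beta> * (norm a)\<^sup>2 \<le> \<beta>bar * (norm a)\<^sup>2" using assms by (intro mult_right_mono) auto
    then show ?thesis using au assms by (intro mult_left_mono) auto
  qed
  ultimately show ?thesis by (simp add: inner_diff_right inner_commute algebra_simps power2_eq_square)
qed

section \<open>Square-integrable random vectors and conditional moments\<close>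

definition sq_integrable :: "'w measure \<Rightarrow> ('w \<Rightarrow> 'a::euclidean_space) \<Rightarrow> bool" where
  "sq_integrable M X \<longleftrightarrow> X \<in> borel_measurable M \<and> integrable M (\<lambda>\<omega>. (norm (X \<omega>))\<^sup>2)"

lemma sq_integrable_measurable: "sq_integrable M X \<Longrightarrow> X \<in> borel_measurable M"
  and sq_integrable_norm: "sq_integrable M X \<Longrightarrow> integrable M (\<lambda>\<omega>. (norm (X \<omega>))\<^sup>2)"
  by (simp_all add: sq_integrable_def)

lemma sq_integrable_inner:
  assumes "sq_integrable M X" "sq_integrable M Y"
  shows "integrable M (\<lambda>\<omega>. X \<omega> \<bullet> Y \<omega>)"
proof (rule Bochner_Integration.integrable_bound)
  show "integrable M (\<lambda>\<omega>. (norm (X \<omega>))\<^sup>2 + (norm (Y \<omega>))\<^sup>2)"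
    using assms by (intro Bochner_Integration.integrable_add sq_integrable_norm)
  show "(\<lambda>\<omega>. X \<omega> \<bullet> Y \<omega>) \<in> borel_measurable M"
    using assms by (intro borel_measurable_inner sq_integrable_measurable)
  have "\<bar>X \<omega> \<bullet> Y \<omega>\<bar> \<le> (norm (X \<omega>))\<^sup>2 + (norm (Y \<omega>))\<^sup>2" for \<omega>
    using inner_young[of 1 1 1 "X \<omega>" "Y \<omega>"] inner_young[of 1 1 "-1" "X \<omega>" "Y \<omega>"] by simp
  then show "AE \<omega> in M. norm (X \<omega> \<bullet> Y \<omega>) \<le> norm ((norm (X \<omega>))\<^sup>2 + (norm (Y \<omega>))\<^sup>2)" by simp
qed

lemma sq_integrable_scaleR: "sq_integrable M X \<Longrightarrow> sq_integrable M (\<lambda>\<omega>. c *\<^sub>R X \<omega>)"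
  unfolding sq_integrable_def by (auto simp: power_mult_distrib)

lemma sq_integrable_add:
  assumes "sq_integrable M X" "sq_integrable M Y"
  shows "sq_integrable M (\<lambda>\<omega>. X \<omega> + Y \<omega>)"
proof -
  have "(\<lambda>\<omega>. (norm (X \<omega> + Y \<omega>))\<^sup>2) = (\<lambda>\<omega>. (norm (X \<omega>))\<^sup>2 + 2 * (X \<omega> \<bullet> Y \<omega>) + (norm (Y \<omega>))\<^sup>2)"
    unfolding power2_norm_eq_inner by (simp add: inner_simps inner_commute algebra_simps)
  moreover have "integrable M \<dots>"
    using assms by (intro Bochner_Integration.integrable_add integrable_mult_right sq_integrable_norm sq_integrable_inner)
  ultimately show ?thesis using assms by (auto simp: sq_integrable_def)
qed

lemma sq_integrable_diff:
  assumes "sq_integrable M X" "sq_integrable M Y"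
  shows "sq_integrable M (\<lambda>\<omega>. X \<omega> - Y \<omega>)"
  using sq_integrable_add[OF assms(1) sq_integrable_scaleR[OF assms(2), of "-1"]] by simp

lemma sq_integrable_const: "finite_measure M \<Longrightarrow> sq_integrable M (\<lambda>\<omega>. c)"
  by (auto simp: sq_integrable_def finite_measure.integrable_const)

lemma sq_integrable_bound:
  assumes "sq_integrable M Y" "X \<in> borel_measurable M" "\<And>\<omega>. \<omega> \<in> space M \<Longrightarrow> norm (X \<omega>) \<le> C * norm (Y \<omega>)"
  shows "sq_integrable M X"
  unfolding sq_integrable_def
proof (intro conjI assms)
  show "integrable M (\<lambda>\<omega>. (norm (X \<omega>))\<^sup>2)"
  proof (rule Bochner_Integration.integrable_bound)
    show "integrable M (\<lambda>\<omega>. C\<^sup>2 * (norm (Y \<omega>))\<^sup>2)" using assms by (intro integrable_mult_right sq_integrable_norm)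
    have "(norm (X \<omega>))\<^sup>2 \<le> C\<^sup>2 * (norm (Y \<omega>))\<^sup>2" if "\<omega> \<in> space M" for \<omega>
      using power_mono[OF assms(3)[OF that], of 2] by (simp add: power_mult_distrib)
    then show "AE \<omega> in M. norm ((norm (X \<omega>))\<^sup>2) \<le> norm (C\<^sup>2 * (norm (Y \<omega>))\<^sup>2)" by auto
  qed (use assms(2) in measurable)
qed

lemma sq_integrable_of_nn_integral:
  assumes "X \<in> borel_measurable M" "(\<integral>\<^sup>+\<omega>. ennreal ((norm (X \<omega>))\<^sup>2) \<partial>M) < \<infinity>"
  shows "sq_integrable M X"
  using assms by (auto simp: sq_integrable_def intro!: integrableI_bounded)

lemma mean_sq_eq: "sq_integrable M X \<Longrightarrow> mean_sq M X = ennreal (\<integral>\<omega>. (norm (X \<omega>))\<^sup>2 \<partial>M)"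
  unfolding mean_sq_def by (intro nn_integral_eq_integral sq_integrable_norm) auto

lemma sq_integrable_cong:
  "(\<And>\<omega>. \<omega> \<in> space M \<Longrightarrow> X \<omega> = Y \<omega>) \<Longrightarrow> sq_integrable M X \<longleftrightarrow> sq_integrable M Y"
  unfolding sq_integrable_def
  by (intro conj_cong measurable_cong Bochner_Integration.integrable_cong) auto

lemma nn_integral_nn_cond_exp:
  assumes "prob_space M" "subalgebra M G" "g \<in> borel_measurable M"
  shows "(\<integral>\<^sup>+\<omega>. nn_cond_exp M G g \<omega> \<partial>M) = (\<integral>\<^sup>+\<omega>. g \<omega> \<partial>M)"
proof -
  interpret prob_space M by fact
  interpret finite_measure_subalgebra M G by unfold_locales fact
  show ?thesis using nn_cond_exp_intg[of "\<lambda>_. 1" g] assms(3) by simp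
qed

lemma suminf_ennreal_less_top:
  assumes "summable f" "\<And>k. 0 \<le> f k"
  shows "(\<Sum>k. ennreal (f k)) < \<infinity>"
  unfolding suminf_ennreal2[OF assms(2,1)] by simp

lemma weighted_mean_sq:
  assumes "sq_integrable M X" "0 \<le> c"
  shows "ennreal c * mean_sq M X = ennreal (c * (\<integral>\<omega>. (norm (X \<omega>))\<^sup>2 \<partial>M))"
  using assms by (simp add: mean_sq_eq ennreal_mult)

text \<open>Integrating the two conditional bounds. The mean square difference need not be a measurable function
of the sample point, so it enters only through a measurable upper bound \<open>g\<close>. Integrability of the new
\<open>\<Delta>\<close> is part of the conclusion, so that it can be propagated along the iteration.\<close>

lemma VR_moments:
  assumes M: "prob_space M" and sub: "subalgebra M (\<F> k)" and vr: "VR M \<F> Fs F x Ft \<Delta> \<kappa> \<Theta> \<sigma>"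
    and meas: "(\<lambda>\<omega>. Ft k \<omega> - F (x k \<omega>)) \<in> borel_measurable M"
    and prev: "integrable M (\<lambda>\<omega>. case k of 0 \<Rightarrow> 0 | Suc j \<Rightarrow> \<Delta> j \<omega>)"
    and g: "integrable M g" "\<And>\<omega>. \<omega> \<in> space M \<Longrightarrow> 0 \<le> g \<omega>"
      "\<And>\<omega>. \<omega> \<in> space M \<Longrightarrow> mean_sq_diff Fs (x k \<omega>) (x (k - 1) \<omega>) \<le> g \<omega>"
  shows "integrable M (\<Delta> k)" and "sq_integrable M (\<lambda>\<omega>. Ft k \<omega> - F (x k \<omega>))"
    and "(\<integral>\<omega>. (norm (Ft k \<omega> - F (x k \<omega>)))\<^sup>2 \<partial>M) \<le> (\<integral>\<omega>. \<Delta> k \<omega> \<partial>M)"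
    and "(\<integral>\<omega>. \<Delta> k \<omega> \<partial>M) \<le> (1 - \<kappa> k) * (\<integral>\<omega>. (case k of 0 \<Rightarrow> 0 | Suc j \<Rightarrow> \<Delta> j \<omega>) \<partial>M)
      + \<Theta> k * (\<integral>\<omega>. g \<omega> \<partial>M) + (\<sigma> k)\<^sup>2"
proof -
  interpret prob_space M by fact
  let ?e = "\<lambda>\<omega>. (norm (Ft k \<omega> - F (x k \<omega>)))\<^sup>2"
  let ?prev = "\<lambda>\<omega>. case k of 0 \<Rightarrow> 0 | Suc j \<Rightarrow> \<Delta> j \<omega>"
  define h where "h \<omega> = (1 - \<kappa> k) * ?prev \<omega> + \<Theta> k * g \<omega> + (\<sigma> k)\<^sup>2" for \<omega>
  have par: "\<kappa> k \<le> 1" "0 \<le> \<Theta> k" and \<Delta>m: "\<Delta> k \<in> borel_measurable M"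
    and \<Delta>0: "\<And>j \<omega>. \<omega> \<in> space M \<Longrightarrow> 0 \<le> \<Delta> j \<omega>"
    using vr by (auto simp: VR_def)
  have "AE \<omega> in M. nn_cond_exp M (\<F> k) (\<lambda>\<omega>. ennreal (?e \<omega>)) \<omega> \<le> nn_cond_exp M (\<F> k) (\<lambda>\<omega>. ennreal (\<Delta> k \<omega>)) \<omega> \<and>
      nn_cond_exp M (\<F> k) (\<lambda>\<omega>. ennreal (\<Delta> k \<omega>)) \<omega> \<le> ennreal (h \<omega>)"
  proof -
    have "AE \<omega> in M. nn_cond_exp M (\<F> k) (\<lambda>\<omega>. ennreal (?e \<omega>)) \<omega> \<le> nn_cond_exp M (\<F> k) (\<lambda>\<omega>. ennreal (\<Delta> k \<omega>)) \<omega> \<and>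
      nn_cond_exp M (\<F> k) (\<lambda>\<omega>. ennreal (\<Delta> k \<omega>)) \<omega> \<le> ennreal ((1 - \<kappa> k) * ?prev \<omega>
            + \<Theta> k * mean_sq_diff Fs (x k \<omega>) (x (k - 1) \<omega>) + (\<sigma> k)\<^sup>2)"
      using vr unfolding VR_def AE_all_countable by blast
    with AE_space show ?thesis
    proof eventually_elim
      case (elim \<omega>)
      have "(1 - \<kappa> k) * ?prev \<omega> + \<Theta> k * mean_sq_diff Fs (x k \<omega>) (x (k - 1) \<omega>) + (\<sigma> k)\<^sup>2 \<le> h \<omega>"
        unfolding h_def using g(3)[OF elim(1)] par by (intro add_right_mono add_left_mono mult_left_mono)
      then show ?case using elim(2) by (meson ennreal_leI order_trans)
    qed
  qed
  then have ae: "AE \<omega> in M. nn_cond_exp M (\<F> k) (\<lambda>\<omega>. ennreal (?e \<omega>)) \<omega> \<le> nn_cond_exp M (\<F> k) (\<lambda>\<omega>. ennreal (\<Delta> k \<omega>)) \<omega>"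
    "AE \<omega> in M. nn_cond_exp M (\<F> k) (\<lambda>\<omega>. ennreal (\<Delta> k \<omega>)) \<omega> \<le> ennreal (h \<omega>)"
    by auto
  have hi: "integrable M h" unfolding h_def using prev g(1)
    by (intro Bochner_Integration.integrable_add integrable_mult_right) auto
  have h0: "0 \<le> h \<omega>" if "\<omega> \<in> space M" for \<omega>
    unfolding h_def using par g(2)[OF that] \<Delta>0[OF that] by (intro add_nonneg_nonneg mult_nonneg_nonneg) (auto split: nat.split)
  have "(\<integral>\<^sup>+\<omega>. ennreal (\<Delta> k \<omega>) \<partial>M) \<le> (\<integral>\<^sup>+\<omega>. ennreal (h \<omega>) \<partial>M)"
    using nn_integral_mono_AE[OF ae(2)] nn_integral_nn_cond_exp[OF M sub, of "\<lambda>\<omega>. ennreal (\<Delta> k \<omega>)"] \<Delta>m by simp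
  also have "\<dots> = ennreal (\<integral>\<omega>. h \<omega> \<partial>M)" using hi h0 by (intro nn_integral_eq_integral) auto
  finally have \<Delta>h: "(\<integral>\<^sup>+\<omega>. ennreal (\<Delta> k \<omega>) \<partial>M) \<le> ennreal (\<integral>\<omega>. h \<omega> \<partial>M)" .
  then show \<Delta>i: "integrable M (\<Delta> k)"
    using \<Delta>m \<Delta>0 by (intro integrableI_nonneg) (auto simp: order_le_less_trans)
  have \<Delta>eq: "(\<integral>\<^sup>+\<omega>. ennreal (\<Delta> k \<omega>) \<partial>M) = ennreal (\<integral>\<omega>. \<Delta> k \<omega> \<partial>M)"
    using \<Delta>i \<Delta>0 by (intro nn_integral_eq_integral) auto
  have "(\<integral>\<omega>. \<Delta> k \<omega> \<partial>M) \<le> (\<integral>\<omega>. h \<omega> \<partial>M)"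
    using \<Delta>h unfolding \<Delta>eq by (subst (asm) ennreal_le_iff) (auto intro!: integral_nonneg_AE h0)
  also have "\<dots> = (1 - \<kappa> k) * (\<integral>\<omega>. ?prev \<omega> \<partial>M) + \<Theta> k * (\<integral>\<omega>. g \<omega> \<partial>M) + (\<sigma> k)\<^sup>2"
    unfolding h_def using prev g(1) by (simp add: prob_space)
  finally show "(\<integral>\<omega>. \<Delta> k \<omega> \<partial>M) \<le> (1 - \<kappa> k) * (\<integral>\<omega>. ?prev \<omega> \<partial>M) + \<Theta> k * (\<integral>\<omega>. g \<omega> \<partial>M) + (\<sigma> k)\<^sup>2" .
  have em: "(\<lambda>\<omega>. ennreal (?e \<omega>)) \<in> borel_measurable M" using meas by measurable
  have "(\<integral>\<^sup>+\<omega>. ennreal (?e \<omega>) \<partial>M) \<le> (\<integral>\<^sup>+\<omega>. ennreal (\<Delta> k \<omega>) \<partial>M)"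
    using nn_integral_mono_AE[OF ae(1)] nn_integral_nn_cond_exp[OF M sub em]
      nn_integral_nn_cond_exp[OF M sub, of "\<lambda>\<omega>. ennreal (\<Delta> k \<omega>)"] \<Delta>m by simp
  then have e\<Delta>: "(\<integral>\<^sup>+\<omega>. ennreal (?e \<omega>) \<partial>M) \<le> ennreal (\<integral>\<omega>. \<Delta> k \<omega> \<partial>M)" unfolding \<Delta>eq .
  show esq: "sq_integrable M (\<lambda>\<omega>. Ft k \<omega> - F (x k \<omega>))"
    by (rule sq_integrable_of_nn_integral[OF meas]) (use e\<Delta> in \<open>simp add: order_le_less_trans\<close>)
  have "(\<integral>\<^sup>+\<omega>. ennreal (?e \<omega>) \<partial>M) = ennreal (\<integral>\<omega>. ?e \<omega> \<partial>M)"
    by (intro nn_integral_eq_integral sq_integrable_norm esq) auto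
  with e\<Delta> have "ennreal (\<integral>\<omega>. ?e \<omega> \<partial>M) \<le> ennreal (\<integral>\<omega>. \<Delta> k \<omega> \<partial>M)" by simp
  then show "(\<integral>\<omega>. ?e \<omega> \<partial>M) \<le> (\<integral>\<omega>. \<Delta> k \<omega> \<partial>M)"
    by (subst (asm) ennreal_le_iff) (auto intro!: integral_nonneg_AE \<Delta>0)
qed

section \<open>Cocoercivity of the splitting residual\<close>

lemma mean_sq_diff_same: "mean_sq_diff Fs x x = 0"
  by (cases Fs) auto

text \<open>Jensen's inequality for the norm squared; in the expectation setting the variance bound provides the
square integrability.\<close>

lemma norm_diff_le_mean_sq_diff:
  assumes "represents Fs F" "bounded_variance Fs F"
  shows "(norm (F x - F y))\<^sup>2 \<le> mean_sq_diff Fs x y"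
proof (cases Fs)
  case (Finite_Sum n f)
  have n: "n \<ge> 1" and F: "\<And>x. F x = (1 / real n) *\<^sub>R (\<Sum>i = 1..n. f i x)"
    using assms Finite_Sum by auto
  have "F x - F y = (1 / real n) *\<^sub>R (\<Sum>i = 1..n. f i x - f i y)"
    by (simp add: F sum_subtractf scaleR_diff_right)
  then have "norm (F x - F y) \<le> 1 / real n * (\<Sum>i = 1..n. norm (f i x - f i y))"
    using norm_sum[of "\<lambda>i. f i x - f i y" "{1..n}"] by (simp add: divide_right_mono)
  then have "(norm (F x - F y))\<^sup>2 \<le> (1 / real n * (\<Sum>i = 1..n. norm (f i x - f i y)))\<^sup>2"
    by (intro power_mono) auto
  also have "\<dots> = (1 / real n)\<^sup>2 * (\<Sum>i = 1..n. norm (f i x - f i y))\<^sup>2" by (rule power_mult_distrib)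
  also have "\<dots> \<le> (1 / real n)\<^sup>2 * ((\<Sum>i = 1..n. (norm (f i x - f i y))\<^sup>2) * real (card {1..n}))"
    by (intro mult_left_mono sum_squared_le_sum_of_squares) auto
  also have "\<dots> = mean_sq_diff Fs x y" using n by (simp add: Finite_Sum power2_eq_square)
  finally show ?thesis .
next
  case (Expectation P f)
  interpret prob_space P using assms Expectation by simp
  have fi: "integrable P (f x)" and F: "F x = (\<integral>s. f x s \<partial>P)" for x using assms Expectation by auto
  obtain \<sigma> where \<sigma>: "\<And>x. (\<integral>\<^sup>+s. ennreal ((norm (f x s - F x))\<^sup>2) \<partial>P) \<le> ennreal (\<sigma>\<^sup>2)"
    using assms Expectation by auto
  have centred: "sq_integrable P (\<lambda>s. f x s - F x)" for x
    using \<sigma>[of x] fi[of x] by (intro sq_integrable_of_nn_integral) (auto simp: order_le_less_trans)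
  have "sq_integrable P (f x)" for x
    using sq_integrable_add[OF centred[of x] sq_integrable_const[OF finite_measure_axioms, of "F x"]] by simp
  then have d: "sq_integrable P (\<lambda>s. f x s - f y s)" by (intro sq_integrable_diff)
  have di: "integrable P (\<lambda>s. f x s - f y s)" using fi by simp
  have "norm (F x - F y) \<le> (\<integral>s. norm (f x s - f y s) \<partial>P)"
    using integral_norm_bound[of P "\<lambda>s. f x s - f y s"] fi by (simp add: F)
  then have "(norm (F x - F y))\<^sup>2 \<le> (\<integral>s. norm (f x s - f y s) \<partial>P)\<^sup>2" by (intro power_mono) auto
  also have "\<dots> \<le> (\<integral>s. (norm (f x s - f y s))\<^sup>2 \<partial>P)"
    using variance_eq[of "\<lambda>s. norm (f x s - f y s)"] variance_positive[of "\<lambda>s. norm (f x s - f y s)"]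
      integrable_norm[OF di] sq_integrable_norm[OF d] by simp
  finally show ?thesis by (simp add: Expectation)
qed

lemma resolvent_iff:
  assumes "lam > 0"
  shows "w \<in> resolvent lam T u \<longleftrightarrow> (1 / lam) *\<^sub>R (u - w) \<in> T w"
proof
  assume "w \<in> resolvent lam T u"
  then obtain y where "y \<in> T w" "u = w + lam *\<^sub>R y" by (auto simp: resolvent_def)
  then show "(1 / lam) *\<^sub>R (u - w) \<in> T w" using assms by simp
next
  assume "(1 / lam) *\<^sub>R (u - w) \<in> T w"
  moreover have "u = w + lam *\<^sub>R ((1 / lam) *\<^sub>R (u - w))" using assms by simp
  ultimately show "w \<in> resolvent lam T u" unfolding resolvent_def by blast
qed

lemma co_hypomonotoneD:
  assumes "co_hypomonotone \<rho> T" "a \<in> T x" "b \<in> T y"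
  shows "- \<rho> * (norm (a - b))\<^sup>2 \<le> (a - b) \<bullet> (x - y)"
  using assms unfolding co_hypomonotone_def graph_op_def by blast

text \<open>With \<open>d\<close> the difference of the chosen elements of \<open>T\<close>, expanding \<open>|(x - y) + lam d|\<^sup>2\<close> produces
\<open>lam (lam - 2 \<rho>) |d|\<^sup>2\<close> after co-hypomonotonicity.\<close>

lemma resolvent_nonexpansive:
  assumes T: "co_hypomonotone \<rho> T" and lam: "lam > 0" "2 * \<rho> \<le> lam"
    and x: "x \<in> resolvent lam T u" and y: "y \<in> resolvent lam T v"
  shows "norm (x - y) \<le> norm (u - v)"
proof -
  define d where "d = (1 / lam) *\<^sub>R (u - x) - (1 / lam) *\<^sub>R (v - y)"
  have mono: "- \<rho> * (norm d)\<^sup>2 \<le> d \<bullet> (x - y)"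
    unfolding d_def using x y resolvent_iff[OF lam(1)] by (intro co_hypomonotoneD[OF T]) auto
  have "u - v = (x - y) + lam *\<^sub>R d" using lam by (simp add: d_def algebra_simps)
  then have "(norm (u - v))\<^sup>2 = (norm (x - y))\<^sup>2 + 2 * lam * (d \<bullet> (x - y)) + lam\<^sup>2 * (norm d)\<^sup>2"
    unfolding power2_norm_eq_inner by (simp add: inner_simps inner_commute power2_eq_square)
  moreover have "2 * lam * (- \<rho> * (norm d)\<^sup>2) \<le> 2 * lam * (d \<bullet> (x - y))" using mono lam by (intro mult_left_mono) auto
  moreover have "lam * (lam - 2 * \<rho>) * (norm d)\<^sup>2 \<ge> 0" using lam by simp
  ultimately have "(norm (x - y))\<^sup>2 \<le> (norm (u - v))\<^sup>2" by (simp add: algebra_simps power2_eq_square)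
  then show ?thesis by (simp add: abs_le_square_iff[symmetric])
qed

text \<open>Split \<open>1 / L\<close> as \<open>\<Lambda> + 1 / Lh\<close>: the first part keeps the mean square difference, the second becomes
\<open>|f|\<^sup>2 / Lh\<close>. What remains is a quadratic form in the differences \<open>f\<close> of \<open>F\<close> and \<open>d\<close> of \<open>T\<close>,
and \<open>\<beta>bar\<close> is the modulus for which its discriminant vanishes.\<close>

lemma splitting_residual_cocoercive:
  assumes Fs: "represents Fs F" "bounded_variance Fs F" "cocoercive_in_mean Fs F L"
    and T: "co_hypomonotone \<rho> T"
    and L: "L > 0" "Lh > L" "Lh * \<rho> < 1" and lam: "lam > 0"
    and \<beta>bar: "\<beta>bar = (lam * (4 - Lh * lam) - 4 * \<rho>) / (4 * (1 - \<rho> * Lh))"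
    and \<xi>: "\<xi> \<in> T x" and \<zeta>: "\<zeta> \<in> T y"
  shows "\<beta>bar * (norm ((F x + \<xi>) - (F y + \<zeta>)))\<^sup>2 + (Lh - L) / (L * Lh) * mean_sq_diff Fs x y
     \<le> ((F x + \<xi>) - (F y + \<zeta>)) \<bullet> ((x + lam *\<^sub>R \<xi>) - (y + lam *\<^sub>R \<zeta>))"
proof -
  define f where "f = F x - F y"
  define d where "d = \<xi> - \<zeta>"
  define m where "m = mean_sq_diff Fs x y"
  have m: "(norm f)\<^sup>2 \<le> m" unfolding f_def m_def by (rule norm_diff_le_mean_sq_diff) fact+
  have 1: "1 / L * m \<le> f \<bullet> (x - y)"
    using Fs(3) unfolding f_def m_def cocoercive_in_mean_def by auto
  have 2: "- \<rho> * (norm d)\<^sup>2 \<le> d \<bullet> (x - y)" unfolding d_def by (intro co_hypomonotoneD[OF T] \<xi> \<zeta>)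
  have 3: "1 / L * m = (Lh - L) / (L * Lh) * m + 1 / Lh * m" using L by (simp add: field_simps)
  have 4: "1 / Lh * (norm f)\<^sup>2 \<le> 1 / Lh * m" using m L by (intro mult_left_mono) auto
  have eq: "(lam - \<rho>) / Lh - lam\<^sup>2 / 4 = \<beta>bar * (1 / Lh - \<rho>)"
  proof -
    have "1 - \<rho> * Lh \<noteq> 0" "Lh \<noteq> 0" using L by (auto simp: mult.commute)
    then have "\<beta>bar * (4 * (1 - \<rho> * Lh)) = lam * (4 - Lh * lam) - 4 * \<rho>" by (simp add: \<beta>bar)
    moreover have "4 * Lh * ((lam - \<rho>) / Lh - lam\<^sup>2 / 4) = 4 * (lam - \<rho>) - Lh * lam\<^sup>2"
      using \<open>Lh \<noteq> 0\<close> by (simp add: field_simps)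
    moreover have "4 * Lh * (\<beta>bar * (1 / Lh - \<rho>)) = \<beta>bar * (4 * (1 - \<rho> * Lh))"
      using \<open>Lh \<noteq> 0\<close> by (simp add: field_simps)
    ultimately have "4 * Lh * ((lam - \<rho>) / Lh - lam\<^sup>2 / 4) = 4 * Lh * (\<beta>bar * (1 / Lh - \<rho>))"
      by (simp add: algebra_simps power2_eq_square)
    then show ?thesis using \<open>Lh \<noteq> 0\<close> by simp
  qed
  have p: "1 / Lh - \<rho> > 0" using L by (simp add: field_simps)
  have sq: "(1 / Lh - \<beta>bar) * (1 / Lh - \<rho>) = (1 / Lh - lam / 2)\<^sup>2"
    using eq L by (simp add: algebra_simps power2_eq_square add_divide_distrib diff_divide_distrib)
  have det: "(1 / Lh - \<beta>bar) * (lam - \<rho> - \<beta>bar) = (lam / 2 - \<beta>bar)\<^sup>2"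
    using eq L by (simp add: algebra_simps power2_eq_square add_divide_distrib diff_divide_distrib)
  have c0: "1 / Lh - \<beta>bar \<ge> 0" using sq p by (metis zero_le_mult_iff zero_le_power2 less_le_not_le)
  \<comment> \<open>The leading coefficient vanishes when \<open>lam = 2 / Lh\<close>; then the
    mixed coefficient vanishes as well.\<close>
  have quad: "0 \<le> (1 / Lh - \<beta>bar) * (norm f)\<^sup>2 + (lam - 2 * \<beta>bar) * (f \<bullet> d) + (lam - \<rho> - \<beta>bar) * (norm d)\<^sup>2"
  proof (cases "1 / Lh - \<beta>bar = 0")
    case True
    then have "lam = 2 * \<beta>bar" using det by simp
    moreover have "\<rho> < \<beta>bar" using p True by simp
    ultimately show ?thesis using True by simp
  next
    case False
    then have c: "1 / Lh - \<beta>bar > 0" using c0 by simp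
    have "lam - \<rho> - \<beta>bar \<ge> 0"
      using det c by (metis zero_le_mult_iff zero_le_power2 less_le_not_le)
    moreover have "(- (lam - 2 * \<beta>bar))\<^sup>2 \<le> 4 * (1 / Lh - \<beta>bar) * (lam - \<rho> - \<beta>bar)"
    proof -
      have "(- (lam - 2 * \<beta>bar))\<^sup>2 = 4 * (lam / 2 - \<beta>bar)\<^sup>2" by (simp add: power2_eq_square algebra_simps)
      then show ?thesis unfolding mult.assoc det by simp
    qed
    ultimately have "(- (lam - 2 * \<beta>bar)) * (f \<bullet> d) \<le> (1 / Lh - \<beta>bar) * (norm f)\<^sup>2 + (lam - \<rho> - \<beta>bar) * (norm d)\<^sup>2"
      using c by (intro inner_young)
    then show ?thesis unfolding mult_minus_left by linarith
  qed
  have e: "(F x + \<xi>) - (F y + \<zeta>) = f + d" "(x + lam *\<^sub>R \<xi>) - (y + lam *\<^sub>R \<zeta>) = (x - y) + lam *\<^sub>R d"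
    by (simp_all add: f_def d_def algebra_simps)
  have i: "(f + d) \<bullet> ((x - y) + lam *\<^sub>R d) = f \<bullet> (x - y) + d \<bullet> (x - y) + lam * (f \<bullet> d) + lam * (norm d)\<^sup>2"
    "(norm (f + d))\<^sup>2 = (norm f)\<^sup>2 + 2 * (f \<bullet> d) + (norm d)\<^sup>2"
    unfolding power2_norm_eq_inner by (simp_all add: inner_simps inner_commute algebra_simps)
  show ?thesis using 1 2 3 4 quad unfolding e i m_def[symmetric] by (simp add: algebra_simps)
qed

lemma cocoercive_in_mean_lipschitz:
  assumes Fs: "represents Fs F" "bounded_variance Fs F" "cocoercive_in_mean Fs F L" "L > 0"
  shows "norm (F x - F y) \<le> L * norm (x - y)"
proof -
  have "1 / L * (norm (F x - F y))\<^sup>2 \<le> 1 / L * mean_sq_diff Fs x y"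
    using norm_diff_le_mean_sq_diff[OF Fs(1,2)] Fs(4) by (intro mult_left_mono) auto
  also have "\<dots> \<le> (F x - F y) \<bullet> (x - y)" using Fs(3) by (auto simp: cocoercive_in_mean_def)
  also have "\<dots> \<le> norm (F x - F y) * norm (x - y)" by (rule norm_cauchy_schwarz)
  finally have "norm (F x - F y) * norm (F x - F y) \<le> norm (F x - F y) * (L * norm (x - y))"
    using Fs(4) by (simp add: field_simps power2_eq_square)
  then show ?thesis using Fs(4) by (cases "norm (F x - F y) = 0") auto
qed

lemma zer_bfs_residual_iff:
  assumes "lam > 0"
  shows "ustar \<in> zer (bfs_residual F lam T) \<longleftrightarrow> (\<exists>y. - F y \<in> T y \<and> ustar = y - lam *\<^sub>R F y)"
proof
  assume "ustar \<in> zer (bfs_residual F lam T)"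
  then obtain y where y: "y \<in> resolvent lam T ustar" "0 = F y + (1 / lam) *\<^sub>R (ustar - y)"
    by (auto simp: zer_def bfs_residual_def)
  have 1: "(1 / lam) *\<^sub>R (ustar - y) = - F y" using y(2) by (metis add_eq_0_iff)
  have "ustar - y = lam *\<^sub>R ((1 / lam) *\<^sub>R (ustar - y))" using assms by simp
  also have "\<dots> = lam *\<^sub>R (- F y)" by (simp only: 1)
  finally have "ustar = y - lam *\<^sub>R F y" by (simp add: algebra_simps)
  then show "\<exists>y. - F y \<in> T y \<and> ustar = y - lam *\<^sub>R F y"
    using y(1) 1 resolvent_iff[OF assms] by metis
next
  assume "\<exists>y. - F y \<in> T y \<and> ustar = y - lam *\<^sub>R F y"
  then obtain y where y: "- F y \<in> T y" "ustar = y - lam *\<^sub>R F y" by blast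
  have 1: "(1 / lam) *\<^sub>R (ustar - y) = - F y" using y(2) assms by simp
  then have "y \<in> resolvent lam T ustar" using y(1) resolvent_iff[OF assms] by metis
  moreover have "0 = F y + (1 / lam) *\<^sub>R (ustar - y)" using 1 by simp
  ultimately show "ustar \<in> zer (bfs_residual F lam T)" unfolding zer_def bfs_residual_def by blast
qed

section \<open>Step sizes and the Lyapunov function\<close>

text \<open>The parameters of the scheme; the upper bound for \<open>\<beta>\<close> is cleared of its denominator.\<close>

locale vfosa_step_sizes =
  fixes \<mu> \<nu> \<beta> \<beta>bar r :: real and t :: "int \<Rightarrow> real" and \<eta> :: "nat \<Rightarrow> real"
  assumes \<mu>: "0 < \<mu>" "\<mu> < 2 / 3" and r: "r \<ge> 2 + 1 / \<mu>" and \<nu>: "\<nu> = \<mu> / 2"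
    and \<beta>: "0 < \<beta>" "\<beta> * (2 + \<mu>) \<le> (2 - \<mu>) * \<beta>bar"
    and t: "\<And>k. t k = \<mu> * (real_of_int k + r)"
    and \<eta>: "\<And>k. \<eta> k = 2 * \<beta> * (t (int k) - 1) / (t (int k) - \<nu>)"
begin

lemma \<nu>_bounds: "0 < \<nu>" "\<nu> < 1 / 3"
  using \<mu> \<nu> by auto

lemma t_pred: "t (k - 1) = t k - \<mu>"
  by (simp add: t algebra_simps)

lemma t_Suc: "t (int (Suc k) - 1) = t (int k)"
  by simp

lemma t_lower: "1 + \<mu> * (real_of_int k + 2) \<le> t k"
proof -
  have "\<mu> * (2 + 1 / \<mu>) \<le> \<mu> * r" using \<mu> r by (intro mult_left_mono) auto
  then show ?thesis using \<mu> by (simp add: t algebra_simps)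
qed

lemma t_nat: "1 + 2 * \<mu> \<le> t (int k)" "1 + \<mu> \<le> t (int k - 1)"
proof -
  have "0 \<le> \<mu> * real k" using \<mu> by simp
  then show "1 + 2 * \<mu> \<le> t (int k)" "1 + \<mu> \<le> t (int k - 1)"
    using t_lower[of "int k"] t_lower[of "int k - 1"] by (auto simp: algebra_simps)
qed

lemma t_linear: "\<mu> * real (Suc k) \<le> t (int k)" "t (int k) \<le> \<mu> * r * real (Suc k)"
proof -
  have r1: "r \<ge> 1" using r \<mu> by (smt (verit) divide_pos_pos)
  show "\<mu> * real (Suc k) \<le> t (int k)" unfolding t using r1 \<mu> by (intro mult_left_mono) auto
  have "0 \<le> (r - 1) * real k" using r1 by simp
  then have "real k + r \<le> r * real (Suc k)" by (simp add: algebra_simps)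
  then show "t (int k) \<le> \<mu> * r * real (Suc k)" using \<mu> by (simp add: t mult.assoc)
qed

lemma \<beta>_le_\<beta>bar: "\<beta> \<le> \<beta>bar"
proof -
  have "\<beta> * (2 - \<mu>) \<le> \<beta> * (2 + \<mu>)" using \<mu> \<beta> by (intro mult_left_mono) auto
  then have "(2 - \<mu>) * \<beta> \<le> (2 - \<mu>) * \<beta>bar" using \<beta>(2) unfolding mult.commute[of \<beta>] by linarith
  then show ?thesis using \<mu> by simp
qed

lemma \<eta>_bounds: "0 < \<eta> k" "\<eta> k \<le> 2 * \<beta>"
  using stepsize_bounds[of \<nu> "t (int k)" \<beta> "\<eta> k"] \<nu>_bounds t_nat(1)[of k] \<nu> \<beta> \<eta> by auto

lemma inverse_\<eta>: "1 / \<eta> k = (1 + (1 - \<nu>) / (t (int k) - 1)) / (2 * \<beta>)"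
proof -
  have "t (int k) - 1 > 0" "t (int k) - \<nu> > 0" using t_nat(1)[of k] \<mu> \<nu> by auto
  then show ?thesis using \<beta> by (simp add: \<eta> field_simps)
qed

text \<open>For positive indices this is the weight left over by the preceding step. At index 0 it is the
larger value \<open>1 / (\<nu> \<eta>)\<close>: the first step also needs a drop of the weight, and this is the
coefficient of the initial distance in the final bound.\<close>

definition anchor_weight :: "nat \<Rightarrow> real" where
  "anchor_weight k = (if k = 0 then 1 / (\<nu> * \<eta> 0) else (1 - \<nu>) / (\<nu> * \<eta> (k - 1)))"

text \<open>Index 0 has no preceding step; there the truncated \<open>k - 1\<close> selects \<open>\<eta> 0\<close>, so that the weight of the lag
does not grow in the first step.\<close>

definition lyapunov :: "nat \<Rightarrow> 'a::real_inner \<Rightarrow> 'a \<Rightarrow> 'a \<Rightarrow> real" where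
  "lyapunov k w u s = 2 * \<beta> * (t (int k - 1) * (t (int k - 1) - 1)) * (norm w)\<^sup>2
     - 2 * t (int k - 1) * (w \<bullet> (s - u)) + anchor_weight k * (norm s)\<^sup>2
     + \<nu> / ((1 - \<nu>) * \<eta> (k - 1)) * (norm (s - u))\<^sup>2"

text \<open>Since \<open>1 / \<eta> k\<close> equals a constant plus \<open>(1 - \<nu>) / (2 \<beta> (t k - 1))\<close>, consecutive values differ by a quantity of
order \<open>1 / t\<^sup>2\<close>, so that the product with \<open>t (t - 1)\<close> stays bounded below.\<close>

lemma anchor_weight_slack:
  shows "0 < anchor_weight k - (1 - \<nu>) / (\<nu> * \<eta> k)"
    and "(1 - \<nu>)\<^sup>2 \<le> 2 * \<beta> * (t (int k) * (t (int k) - 1)) * (anchor_weight k - (1 - \<nu>) / (\<nu> * \<eta> k))"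
proof -
  have \<mu>2: "\<mu> = 2 * \<nu>" using \<nu> by simp
  have tk: "t (int k) > 1" "t (int k) \<ge> 1" using t_nat(1)[of k] \<mu> by auto
  have *: "0 < anchor_weight k - (1 - \<nu>) / (\<nu> * \<eta> k) \<and>
    (1 - \<nu>)\<^sup>2 \<le> 2 * \<beta> * (t (int k) * (t (int k) - 1)) * (anchor_weight k - (1 - \<nu>) / (\<nu> * \<eta> k))"
  proof (cases k)
    case 0
    have "anchor_weight k - (1 - \<nu>) / (\<nu> * \<eta> k) = 1 / \<eta> 0"
      using 0 \<nu>_bounds \<eta>_bounds(1)[of 0] by (simp add: anchor_weight_def field_simps)
    moreover have "1 * (1 - \<nu>) \<le> t 0 * (t 0 - \<nu>)" using tk 0 \<nu>_bounds by (intro mult_mono) auto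
    moreover have "2 * \<beta> * (t 0 * (t 0 - 1)) * (1 / \<eta> 0) = t 0 * (t 0 - \<nu>)"
      using tk 0 \<beta> \<nu>_bounds by (simp add: \<eta> field_simps)
    moreover have "(1 - \<nu>)\<^sup>2 \<le> 1 - \<nu>" using \<nu>_bounds by (simp add: power2_eq_square mult_left_le)
    ultimately show ?thesis using \<eta>_bounds(1)[of 0] 0 by simp
  next
    case (Suc j)
    have tj: "t (int j) > 1" "t (int j) = t (int k) - \<mu>" using t_nat(1)[of j] \<mu> t_pred[of "int k"] Suc by auto
    have "anchor_weight k - (1 - \<nu>) / (\<nu> * \<eta> k) = (1 - \<nu>) / \<nu> * (1 / \<eta> j - 1 / \<eta> k)"
      using Suc by (simp add: anchor_weight_def algebra_simps)
    also have "\<dots> = (1 - \<nu>)\<^sup>2 / (\<beta> * (t (int k) - 1) * (t (int j) - 1))"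
      unfolding inverse_\<eta> using tk(1) tj \<beta> \<nu>_bounds
      by (simp add: divide_simps) (simp add: \<mu>2 algebra_simps power2_eq_square)
    finally have eq: "anchor_weight k - (1 - \<nu>) / (\<nu> * \<eta> k) = (1 - \<nu>)\<^sup>2 / (\<beta> * (t (int k) - 1) * (t (int j) - 1))" .
    have "t (int j) - 1 \<le> 2 * t (int k)" using tj \<mu> tk by linarith
    then have "(1 - \<nu>)\<^sup>2 * (t (int j) - 1) \<le> (1 - \<nu>)\<^sup>2 * (2 * t (int k))" by (intro mult_left_mono) auto
    then have "(1 - \<nu>)\<^sup>2 \<le> (1 - \<nu>)\<^sup>2 * (2 * t (int k)) / (t (int j) - 1)" using tj by (simp add: pos_le_divide_eq)
    also have "\<dots> = 2 * \<beta> * (t (int k) * (t (int k) - 1)) * ((1 - \<nu>)\<^sup>2 / (\<beta> * (t (int k) - 1) * (t (int j) - 1)))"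
    proof -
      have "q * (2 * a) / c = 2 * \<beta> * (a * b) * (q / (\<beta> * b * c))" if "b \<noteq> 0" "c \<noteq> 0" for a b c q
        using that \<beta> by (simp add: mult_ac)
      then show ?thesis using tk(1) tj(1) by simp
    qed
    finally show ?thesis unfolding eq using tk(1) tj \<beta> \<nu>_bounds by simp
  qed
  then show "0 < anchor_weight k - (1 - \<nu>) / (\<nu> * \<eta> k)"
    "(1 - \<nu>)\<^sup>2 \<le> 2 * \<beta> * (t (int k) * (t (int k) - 1)) * (anchor_weight k - (1 - \<nu>) / (\<nu> * \<eta> k))" by auto
qed

lemma \<eta>_mono: "\<eta> (k - 1) \<le> \<eta> k"
proof (cases k)
  case (Suc j)
  have tj: "t (int j) > 1" "t (int j) = t (int k) - \<mu>" using t_nat(1)[of j] \<mu> t_pred[of "int k"] Suc by auto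
  have "1 / \<eta> k \<le> 1 / \<eta> j" unfolding inverse_\<eta> using tj \<beta> \<mu> \<nu>_bounds
    by (intro divide_right_mono add_left_mono divide_left_mono mult_pos_pos) auto
  then show ?thesis using \<eta>_bounds(1)[of j] \<eta>_bounds(1)[of k] Suc by (simp add: field_simps)
qed simp

lemma lyapunov_decrease:
  fixes w w' e u s u' s' :: "'a::real_inner"
  assumes u': "u' = u + (1 / t (int k)) *\<^sub>R (s - u) - \<eta> k *\<^sub>R (w + e)"
    and s': "s' = s - (\<nu> * \<eta> k) *\<^sub>R (w + e)"
    and wu: "\<beta>bar * (norm w)\<^sup>2 \<le> w \<bullet> u"
  shows "lyapunov (Suc k) w' u' s'
         + 2 * (t (int k) * (t (int k) - 1)) * ((w' - w) \<bullet> (u' - u) - \<beta>bar * (norm (w' - w))\<^sup>2)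
         + \<beta> * (1 - 3 * \<nu>) / 10 * t (int k) * (norm w)\<^sup>2
         + \<nu> / (8 * \<beta> * (1 - \<nu>) * t (int k)) * (norm (s - u))\<^sup>2
    \<le> lyapunov k w u s
         + (5 * \<beta> / \<mu> - \<beta> / (10 * \<mu>)) * (t (int k) * (t (int k) - 1)) * (norm e)\<^sup>2"
proof -
  have "\<nu> / ((1 - \<nu>) * \<eta> k) \<le> \<nu> / ((1 - \<nu>) * \<eta> (k - 1))"
    using \<eta>_mono[of k] \<eta>_bounds(1) \<nu>_bounds by (intro divide_left_mono mult_left_mono mult_pos_pos) auto
  then have "\<nu> / ((1 - \<nu>) * \<eta> k) * (norm (s - u))\<^sup>2 \<le> \<nu> / ((1 - \<nu>) * \<eta> (k - 1)) * (norm (s - u))\<^sup>2"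
    by (intro mult_right_mono) auto
  with lyapunov_step[OF \<mu> \<nu> t_nat(1) \<beta> \<eta> u' s' wu anchor_weight_slack, of w']
  show ?thesis unfolding lyapunov_def by (simp add: t_pred anchor_weight_def)
qed

text \<open>The anchor weight is at least \<open>(1 - \<nu>) / (2 \<nu> \<beta>)\<close>, and this is at least \<open>1 / \<beta>\<close> exactly for
\<open>\<mu> \<le> 2 / 3\<close>.\<close>

lemma lyapunov_ge:
  assumes wu: "\<beta>bar * (norm w)\<^sup>2 \<le> w \<bullet> u"
  shows "\<beta> * (t (int k - 1))\<^sup>2 * (norm w)\<^sup>2 \<le> lyapunov k w u s"
proof -
  have *: "1 / \<beta> \<le> (1 - \<nu>) / (\<nu> * \<eta> j)" for j
  proof -
    have "\<nu> * \<eta> j \<le> \<nu> * (2 * \<beta>)" using \<eta>_bounds \<nu>_bounds by (intro mult_left_mono) auto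
    also have "\<dots> \<le> (1 - \<nu>) * \<beta>" using mult_right_mono[of "2 * \<nu>" "1 - \<nu>" \<beta>] \<nu>_bounds \<beta> by auto
    finally show ?thesis using \<eta>_bounds(1)[of j] \<nu>_bounds \<beta> by (simp add: field_simps)
  qed
  have "1 / \<beta> \<le> anchor_weight k"
    using *[of "k - 1"] *[of 0] anchor_weight_slack(1)[of 0] by (auto simp: anchor_weight_def)
  moreover have "0 \<le> t (int k - 1)" using t_nat(2)[of k] \<mu> by simp
  ultimately have "\<beta> * (t (int k - 1))\<^sup>2 * (norm w)\<^sup>2 \<le> 2 * \<beta> * (t (int k - 1) * (t (int k - 1) - 1)) * (norm w)\<^sup>2
     - 2 * t (int k - 1) * (w \<bullet> (s - u)) + anchor_weight k * (norm s)\<^sup>2"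
    using \<beta> \<beta>_le_\<beta>bar wu by (intro lyapunov_lower) auto
  moreover have "0 \<le> \<nu> / ((1 - \<nu>) * \<eta> (k - 1)) * (norm (s - u))\<^sup>2"
    using \<eta>_bounds(1)[of "k - 1"] \<nu>_bounds by simp
  ultimately show ?thesis unfolding lyapunov_def by linarith
qed

end

section \<open>Expected decrease, summability and limits\<close>

text \<open>The scheme reduced to what the estimates use: the sequences are shifted so that a zero of the residual lies
at the origin, cocoercivity is required only along the trajectory, and \<open>D k\<close> stands for
the expectation of \<open>\<Delta> k\<close>, with the mean square difference replaced by the cocoercivity gap
divided by \<open>\<Lambda>\<close>.\<close>

locale vfosa_process = vfosa_step_sizes \<mu> \<nu> \<beta> \<beta>bar r t \<eta> + prob_space M
  for \<mu> \<nu> \<beta> \<beta>bar r :: real and t :: "int \<Rightarrow> real" and \<eta> :: "nat \<Rightarrow> real" and M :: "'w measure" +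
  fixes w u s e :: "nat \<Rightarrow> 'w \<Rightarrow> 'a::euclidean_space"
    and D \<kappa> \<Theta> \<sigma> :: "nat \<Rightarrow> real" and \<Gamma> :: "int \<Rightarrow> real" and \<Lambda> :: real
  assumes sq: "\<And>k. sq_integrable M (w k)" "\<And>k. sq_integrable M (u k)"
      "\<And>k. sq_integrable M (s k)" "\<And>k. sq_integrable M (e k)"
    and s_0: "\<And>\<omega>. \<omega> \<in> space M \<Longrightarrow> s 0 \<omega> = u 0 \<omega>"
    and u_Suc: "\<And>k \<omega>. \<omega> \<in> space M \<Longrightarrow>
      u (Suc k) \<omega> = u k \<omega> + (1 / t (int k)) *\<^sub>R (s k \<omega> - u k \<omega>) - \<eta> k *\<^sub>R (w k \<omega> + e k \<omega>)"
    and s_Suc: "\<And>k \<omega>. \<omega> \<in> space M \<Longrightarrow> s (Suc k) \<omega> = s k \<omega> - (\<nu> * \<eta> k) *\<^sub>R (w k \<omega> + e k \<omega>)"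
    and coco_0: "\<And>k \<omega>. \<omega> \<in> space M \<Longrightarrow> \<beta>bar * (norm (w k \<omega>))\<^sup>2 \<le> w k \<omega> \<bullet> u k \<omega>"
    and coco_Suc: "\<And>k \<omega>. \<omega> \<in> space M \<Longrightarrow> \<beta>bar * (norm (w (Suc k) \<omega> - w k \<omega>))\<^sup>2
      \<le> (w (Suc k) \<omega> - w k \<omega>) \<bullet> (u (Suc k) \<omega> - u k \<omega>)"
    and error_le: "\<And>k. (\<integral>\<omega>. (norm (e k \<omega>))\<^sup>2 \<partial>M) \<le> D k"
    and D_0: "D 0 \<le> (\<sigma> 0)\<^sup>2"
    and D_Suc: "\<And>k. D (Suc k) \<le> (1 - \<kappa> (Suc k)) * D k
      + \<Theta> (Suc k) / \<Lambda> * (\<integral>\<omega>. (w (Suc k) \<omega> - w k \<omega>) \<bullet> (u (Suc k) \<omega> - u k \<omega>)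
          - \<beta>bar * (norm (w (Suc k) \<omega> - w k \<omega>))\<^sup>2 \<partial>M) + (\<sigma> (Suc k))\<^sup>2"
    and \<Lambda>: "0 < \<Lambda>" and \<Theta>: "\<And>k. 0 < \<Theta> k" and \<Gamma>: "\<And>k. 0 < \<Gamma> (int k)"
    and \<Gamma>\<Theta>: "\<And>k. \<Gamma> (int k) * \<Theta> k \<le> 2 * \<Lambda>"
    and \<kappa>: "\<And>k. \<kappa> k \<ge> 1
        - (\<Gamma> (int k - 1) * t (int k - 2) * (t (int k - 2) - 1))
            / (\<Gamma> (int k) * t (int k - 1) * (t (int k - 1) - 1))
        + 5 * \<beta> / (\<mu> * \<Gamma> (int k))"
    and \<sigma>_summable: "summable (\<lambda>k. t (int k - 1) * (t (int k - 1) - 1) * ((\<sigma> k)\<^sup>2 / \<Theta> k))"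
begin

text \<open>The suffix \<open>ms\<close> abbreviates mean square.\<close>

definition residual_ms :: "nat \<Rightarrow> real" where "residual_ms k = (\<integral>\<omega>. (norm (w k \<omega>))\<^sup>2 \<partial>M)"

definition error_ms :: "nat \<Rightarrow> real" where "error_ms k = (\<integral>\<omega>. (norm (e k \<omega>))\<^sup>2 \<partial>M)"

definition lag_ms :: "nat \<Rightarrow> real" where "lag_ms k = (\<integral>\<omega>. (norm (s k \<omega> - u k \<omega>))\<^sup>2 \<partial>M)"

definition mean_gap :: "nat \<Rightarrow> real" where
  "mean_gap k = (\<integral>\<omega>. (w (Suc k) \<omega> - w k \<omega>) \<bullet> (u (Suc k) \<omega> - u k \<omega>) - \<beta>bar * (norm (w (Suc k) \<omega> - w k \<omega>))\<^sup>2 \<partial>M)"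

definition mean_lyapunov :: "nat \<Rightarrow> real" where "mean_lyapunov k = (\<integral>\<omega>. lyapunov k (w k \<omega>) (u k \<omega>) (s k \<omega>) \<partial>M)"

lemma integrable_terms [simp, intro]:
  "integrable M (\<lambda>\<omega>. (norm (w k \<omega>))\<^sup>2)" "integrable M (\<lambda>\<omega>. (norm (e k \<omega>))\<^sup>2)"
  "integrable M (\<lambda>\<omega>. (norm (u k \<omega>))\<^sup>2)" "integrable M (\<lambda>\<omega>. (norm (s k \<omega>))\<^sup>2)"
  "integrable M (\<lambda>\<omega>. (norm (s k \<omega> - u k \<omega>))\<^sup>2)"
  "integrable M (\<lambda>\<omega>. w k \<omega> \<bullet> (s k \<omega> - u k \<omega>))"
  "integrable M (\<lambda>\<omega>. (norm (u (Suc k) \<omega> - u k \<omega>))\<^sup>2)"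
  "integrable M (\<lambda>\<omega>. (w (Suc k) \<omega> - w k \<omega>) \<bullet> (u (Suc k) \<omega> - u k \<omega>) - \<beta>bar * (norm (w (Suc k) \<omega> - w k \<omega>))\<^sup>2)"
  by (intro Bochner_Integration.integrable_diff integrable_mult_right sq_integrable_norm sq_integrable_inner sq_integrable_diff sq)+

lemma integrable_lyapunov [simp, intro]: "integrable M (\<lambda>\<omega>. lyapunov k (w k \<omega>) (u k \<omega>) (s k \<omega>))"
  unfolding lyapunov_def by (intro Bochner_Integration.integrable_add Bochner_Integration.integrable_diff integrable_mult_right integrable_terms)

lemma moments_nonneg: "0 \<le> residual_ms k" "0 \<le> error_ms k" "0 \<le> lag_ms k" "0 \<le> mean_gap k"
  unfolding residual_ms_def error_ms_def lag_ms_def mean_gap_def using coco_Suc by (auto intro!: integral_nonneg_AE)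

lemma error_ms_le: "error_ms k \<le> D k"
  unfolding error_ms_def by (rule error_le)

lemma mean_lyapunov_decrease:
  "mean_lyapunov (Suc k) + 2 * (t (int k) * (t (int k) - 1)) * mean_gap k
     + \<beta> * (1 - 3 * \<nu>) / 10 * t (int k) * residual_ms k + \<nu> / (8 * \<beta> * (1 - \<nu>) * t (int k)) * lag_ms k
   \<le> mean_lyapunov k + (5 * \<beta> / \<mu> - \<beta> / (10 * \<mu>)) * (t (int k) * (t (int k) - 1)) * error_ms k"
  (is "_ \<le> _ + ?c * error_ms k")
proof -
  have "(\<integral>\<omega>. lyapunov (Suc k) (w (Suc k) \<omega>) (u (Suc k) \<omega>) (s (Suc k) \<omega>)
         + 2 * (t (int k) * (t (int k) - 1)) * ((w (Suc k) \<omega> - w k \<omega>) \<bullet> (u (Suc k) \<omega> - u k \<omega>) - \<beta>bar * (norm (w (Suc k) \<omega> - w k \<omega>))\<^sup>2)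
         + \<beta> * (1 - 3 * \<nu>) / 10 * t (int k) * (norm (w k \<omega>))\<^sup>2
         + \<nu> / (8 * \<beta> * (1 - \<nu>) * t (int k)) * (norm (s k \<omega> - u k \<omega>))\<^sup>2 \<partial>M)
    \<le> (\<integral>\<omega>. lyapunov k (w k \<omega>) (u k \<omega>) (s k \<omega>) + ?c * (norm (e k \<omega>))\<^sup>2 \<partial>M)"
    by (intro integral_mono Bochner_Integration.integrable_add integrable_mult_right integrable_terms integrable_lyapunov
        lyapunov_decrease u_Suc s_Suc coco_0)
  then show ?thesis
    unfolding mean_lyapunov_def residual_ms_def error_ms_def lag_ms_def mean_gap_def
    by (simp only: Bochner_Integration.integral_add integral_mult_right_zero Bochner_Integration.integrable_add
      integrable_mult_right integrable_terms integrable_lyapunov)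
qed

lemma mean_lyapunov_ge: "\<beta> * (t (int k - 1))\<^sup>2 * residual_ms k \<le> mean_lyapunov k"
proof -
  have "(\<integral>\<omega>. \<beta> * (t (int k - 1))\<^sup>2 * (norm (w k \<omega>))\<^sup>2 \<partial>M) \<le> mean_lyapunov k"
    unfolding mean_lyapunov_def by (intro integral_mono integrable_mult_right integrable_terms integrable_lyapunov lyapunov_ge coco_0)
  then show ?thesis by (simp add: residual_ms_def)
qed

lemma D_nonneg: "0 \<le> D k"
  using error_ms_le[of k] moments_nonneg(2)[of k] by linarith

text \<open>The condition on \<open>\<kappa>\<close>, multiplied by \<open>\<Gamma> t (t - 1)\<close>, turns the recursion for \<open>D\<close> into a decrease that pays for
the error terms, and \<open>\<Gamma> \<Theta> \<le> 2 \<Lambda>\<close> matches its right-hand side with the gap released by the Lyapunov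
function.\<close>

lemma D_decrease:
  defines "p \<equiv> \<lambda>k. t (int k) * (t (int k) - 1)"
  shows "\<Gamma> (int (Suc k)) * p k * D (Suc k) + 5 * \<beta> / \<mu> * p k * D k
    \<le> \<Gamma> (int k) * (t (int k - 1) * (t (int k - 1) - 1)) * D k + 2 * p k * mean_gap k + 2 * \<Lambda> * (p k * ((\<sigma> (Suc k))\<^sup>2 / \<Theta> (Suc k)))"
proof -
  define g where "g = \<Gamma> (int (Suc k))"
  define q where "q = t (int k - 1) * (t (int k - 1) - 1)"
  have p: "p k > 0" using t_nat(1)[of k] \<mu> by (simp add: p_def)
  have g: "g > 0" using \<Gamma>[of "Suc k"] by (simp only: g_def)
  have i: "int (Suc k) - 1 = int k" "int (Suc k) - 2 = int k - 1" by auto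
  have "1 - \<kappa> (Suc k) \<le> \<Gamma> (int k) * q / (g * p k) - 5 * \<beta> / (\<mu> * g)"
    using \<kappa>[of "Suc k"] unfolding i g_def[symmetric] by (simp add: p_def q_def mult.assoc)
  then have "g * p k * (1 - \<kappa> (Suc k)) \<le> g * p k * (\<Gamma> (int k) * q / (g * p k) - 5 * \<beta> / (\<mu> * g))"
    using g p by (intro mult_left_mono) auto
  also have "\<dots> = \<Gamma> (int k) * q - 5 * \<beta> / \<mu> * p k" using g p by (simp add: right_diff_distrib)
  finally have 1: "g * p k * (1 - \<kappa> (Suc k)) * D k \<le> (\<Gamma> (int k) * q - 5 * \<beta> / \<mu> * p k) * D k"
    using D_nonneg by (intro mult_right_mono)
  have "g * \<Theta> (Suc k) * (p k * (mean_gap k / \<Lambda> + (\<sigma> (Suc k))\<^sup>2 / \<Theta> (Suc k))) \<le> 2 * \<Lambda> * (p k * (mean_gap k / \<Lambda> + (\<sigma> (Suc k))\<^sup>2 / \<Theta> (Suc k)))"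
    using p \<Gamma>\<Theta>[of "Suc k"] moments_nonneg(4)[of k] \<Lambda> \<Theta>[of "Suc k"] unfolding g_def
    by (intro mult_right_mono mult_nonneg_nonneg add_nonneg_nonneg divide_nonneg_nonneg) auto
  also have "\<dots> = 2 * p k * mean_gap k + 2 * \<Lambda> * (p k * ((\<sigma> (Suc k))\<^sup>2 / \<Theta> (Suc k)))" using \<Lambda> by (simp add: algebra_simps)
  also have "g * \<Theta> (Suc k) * (p k * (mean_gap k / \<Lambda> + (\<sigma> (Suc k))\<^sup>2 / \<Theta> (Suc k)))
      = g * p k * (\<Theta> (Suc k) / \<Lambda> * mean_gap k + (\<sigma> (Suc k))\<^sup>2)" using \<Theta>[of "Suc k"] \<Lambda> by (simp add: field_simps)
  finally have 2: "g * p k * (\<Theta> (Suc k) / \<Lambda> * mean_gap k + (\<sigma> (Suc k))\<^sup>2) \<le> 2 * p k * mean_gap k + 2 * \<Lambda> * (p k * ((\<sigma> (Suc k))\<^sup>2 / \<Theta> (Suc k)))" .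
  have "g * p k * D (Suc k) \<le> g * p k * ((1 - \<kappa> (Suc k)) * D k + \<Theta> (Suc k) / \<Lambda> * mean_gap k + (\<sigma> (Suc k))\<^sup>2)"
    using D_Suc[of k] g p by (intro mult_left_mono) (auto simp: mean_gap_def)
  then show ?thesis using 1 2 unfolding g_def[symmetric] q_def[symmetric] by (simp add: algebra_simps)
qed

definition potential :: "nat \<Rightarrow> real" where
  "potential k = mean_lyapunov k + \<Gamma> (int k) * (t (int k - 1) * (t (int k - 1) - 1)) * D k"

definition dissipation :: "nat \<Rightarrow> real" where
  "dissipation k = \<beta> * (1 - 3 * \<nu>) / 10 * t (int k) * residual_ms k + \<nu> / (8 * \<beta> * (1 - \<nu>) * t (int k)) * lag_ms k
     + \<beta> / (10 * \<mu>) * (t (int k) * (t (int k) - 1)) * error_ms k"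

lemma t_prod_pos: "0 < t (int k) * (t (int k) - 1)" "0 < t (int k - 1) * (t (int k - 1) - 1)"
  using t_nat[of k] \<mu> by auto

lemma mean_lyapunov_le_potential: "mean_lyapunov k \<le> potential k"
  using D_nonneg[of k] t_prod_pos(2)[of k] \<Gamma>[of k] by (simp add: potential_def)

lemma potential_decrease:
  "potential (Suc k) + dissipation k
    \<le> potential k + 2 * \<Lambda> * (t (int k) * (t (int k) - 1) * ((\<sigma> (Suc k))\<^sup>2 / \<Theta> (Suc k)))"
proof -
  have "5 * \<beta> / \<mu> * (t (int k) * (t (int k) - 1)) * error_ms k \<le> 5 * \<beta> / \<mu> * (t (int k) * (t (int k) - 1)) * D k"
    using t_prod_pos(1)[of k] \<mu> \<beta> error_ms_le[of k] by (intro mult_left_mono) auto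
  then show ?thesis using mean_lyapunov_decrease[of k] D_decrease[of k] unfolding potential_def dissipation_def t_Suc
    by (simp add: left_diff_distrib)
qed

lemma potential_dissipation_nonneg:
  shows potential_nonneg: "0 \<le> potential k" and dissipation_nonneg: "0 \<le> dissipation k"
proof -
  have "0 \<le> \<beta> * (t (int k - 1))\<^sup>2 * residual_ms k" using \<beta> moments_nonneg by simp
  then show "0 \<le> potential k" using mean_lyapunov_ge[of k] mean_lyapunov_le_potential[of k] by linarith
  show "0 \<le> dissipation k" unfolding dissipation_def
    using t_nat(1)[of k] t_prod_pos(1)[of k] \<mu> \<nu>_bounds \<beta> moments_nonneg
    by (intro add_nonneg_nonneg mult_nonneg_nonneg divide_nonneg_nonneg) auto
qed

lemma noise_nonneg: "0 \<le> t (int k - 1) * (t (int k - 1) - 1) * ((\<sigma> k)\<^sup>2 / \<Theta> k)"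
  using t_prod_pos(2)[of k] \<Theta>[of k] by simp

lemma
  shows summable_dissipation: "summable dissipation"
    and potential_le: "potential k \<le> potential 0
      + 2 * \<Lambda> * (\<Sum>k. t (int k - 1) * (t (int k - 1) - 1) * ((\<sigma> k)\<^sup>2 / \<Theta> k))"
proof -
  define n where "n k = t (int k - 1) * (t (int k - 1) - 1) * ((\<sigma> k)\<^sup>2 / \<Theta> k)" for k
  define \<tau> where "\<tau> k = 2 * \<Lambda> * n (Suc k)" for k
  have n: "summable n" using \<sigma>_summable unfolding n_def[abs_def] .
  have n0: "0 \<le> n k" for k unfolding n_def by (rule noise_nonneg)
  have \<tau>: "0 \<le> \<tau> k" for k using n0 \<Lambda> by (simp add: \<tau>_def)
  have \<tau>s: "summable \<tau>" unfolding \<tau>_def using n by (intro summable_mult) (simp add: summable_Suc_iff)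
  have step: "potential (Suc k) + dissipation k \<le> potential k + \<tau> k" for k
    using potential_decrease[of k] by (simp add: \<tau>_def n_def)
  note tb = telescoping_bound[of potential dissipation \<tau>, OF potential_nonneg dissipation_nonneg \<tau> \<tau>s step]
  show "summable dissipation" by (rule tb(1))
  have "suminf \<tau> = 2 * \<Lambda> * (\<Sum>k. n (Suc k))" unfolding \<tau>_def using n by (intro suminf_mult) (simp add: summable_Suc_iff)
  also have "\<dots> \<le> 2 * \<Lambda> * suminf n" using suminf_split_head[OF n] n0[of 0] \<Lambda> by simp
  finally show "potential k \<le> potential 0
      + 2 * \<Lambda> * (\<Sum>k. t (int k - 1) * (t (int k - 1) - 1) * ((\<sigma> k)\<^sup>2 / \<Theta> k))"
    using tb(2)[of k] unfolding n_def by linarith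
qed

text \<open>The lag vanishes at the start, so only the residual and the anchor contribute to the Lyapunov
function.\<close>

lemma potential_0_le: "potential 0 \<le> 2 * \<beta> * \<mu>\<^sup>2 * r\<^sup>2 * residual_ms 0 + 1 / (\<nu> * \<eta> 0) * (\<integral>\<omega>. (norm (u 0 \<omega>))\<^sup>2 \<partial>M)
    + \<Gamma> 0 * (\<mu>\<^sup>2 * r\<^sup>2) * (\<sigma> 0)\<^sup>2"
proof -
  define q where "q = t (- 1) * (t (- 1) - 1)"
  have "t (-1) * (t (-1) - 1) \<le> t 0 * t 0" using t_nat(2)[of 0] t_pred[of 0] \<mu> by (intro mult_mono) auto
  then have q: "0 \<le> q" "q \<le> \<mu>\<^sup>2 * r\<^sup>2" using t_prod_pos(2)[of 0] by (auto simp: t power2_eq_square mult_ac q_def)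
  have "mean_lyapunov 0 = (\<integral>\<omega>. 2 * \<beta> * q * (norm (w 0 \<omega>))\<^sup>2 + 1 / (\<nu> * \<eta> 0) * (norm (u 0 \<omega>))\<^sup>2 \<partial>M)"
    unfolding mean_lyapunov_def by (intro Bochner_Integration.integral_cong) (auto simp: lyapunov_def s_0 anchor_weight_def q_def)
  also have "\<dots> = 2 * \<beta> * q * residual_ms 0 + 1 / (\<nu> * \<eta> 0) * (\<integral>\<omega>. (norm (u 0 \<omega>))\<^sup>2 \<partial>M)"
    unfolding residual_ms_def by (subst Bochner_Integration.integral_add) auto
  finally have "potential 0 = 2 * \<beta> * q * residual_ms 0 + 1 / (\<nu> * \<eta> 0) * (\<integral>\<omega>. (norm (u 0 \<omega>))\<^sup>2 \<partial>M) + \<Gamma> 0 * q * D 0"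
    by (simp add: potential_def q_def)
  moreover have "2 * \<beta> * q * residual_ms 0 \<le> 2 * \<beta> * (\<mu>\<^sup>2 * r\<^sup>2) * residual_ms 0"
    using q \<beta> moments_nonneg(1)[of 0] by (intro mult_right_mono mult_left_mono) auto
  moreover have "\<Gamma> 0 * q * D 0 \<le> \<Gamma> 0 * (\<mu>\<^sup>2 * r\<^sup>2) * (\<sigma> 0)\<^sup>2"
    using q \<Gamma>[of 0] D_0 D_nonneg[of 0] by (intro mult_mono mult_left_mono mult_nonneg_nonneg) auto
  ultimately show ?thesis by (simp add: mult.assoc)
qed

lemma residual_rate:
  "\<beta> * (t (int k - 1))\<^sup>2 * residual_ms k \<le> 2 * \<beta> * \<mu>\<^sup>2 * r\<^sup>2 * residual_ms 0 + 1 / (\<nu> * \<eta> 0) * (\<integral>\<omega>. (norm (u 0 \<omega>))\<^sup>2 \<partial>M)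
    + \<Gamma> 0 * (\<mu>\<^sup>2 * r\<^sup>2) * (\<sigma> 0)\<^sup>2 + 2 * \<Lambda> * (\<Sum>k. t (int k - 1) * (t (int k - 1) - 1) * ((\<sigma> k)\<^sup>2 / \<Theta> k))"
  using mean_lyapunov_ge[of k] mean_lyapunov_le_potential[of k] potential_le[of k] potential_0_le by linarith

lemma
  shows summable_weighted_residual: "summable (\<lambda>k. t (int k) * residual_ms k)"
    and summable_weighted_lag: "summable (\<lambda>k. lag_ms k / t (int k))"
    and summable_weighted_error: "summable (\<lambda>k. t (int k) * (t (int k) - 1) * error_ms k)"
proof -
  have pos: "0 \<le> \<beta> * (1 - 3 * \<nu>) / 10 * t (int k) * residual_ms k" "0 \<le> \<nu> / (8 * \<beta> * (1 - \<nu>) * t (int k)) * lag_ms k"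
      "0 \<le> \<beta> / (10 * \<mu>) * (t (int k) * (t (int k) - 1)) * error_ms k" for k
    using t_nat(1)[of k] t_prod_pos(1)[of k] \<mu> \<nu>_bounds \<beta> moments_nonneg by (auto intro!: mult_nonneg_nonneg divide_nonneg_nonneg)
  have le: "\<beta> * (1 - 3 * \<nu>) / 10 * t (int k) * residual_ms k \<le> dissipation k"
      "\<nu> / (8 * \<beta> * (1 - \<nu>) * t (int k)) * lag_ms k \<le> dissipation k"
      "\<beta> / (10 * \<mu>) * (t (int k) * (t (int k) - 1)) * error_ms k \<le> dissipation k" for k
    unfolding dissipation_def using pos[of k] by linarith+
  have tpos: "t (int k) > 0" for k using t_nat(1)[of k] \<mu> by linarith
  show "summable (\<lambda>k. t (int k) * residual_ms k)"
  proof (rule summable_dominated[OF summable_dissipation, where C = "10 / (\<beta> * (1 - 3 * \<nu>))"])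
    fix k
    show "0 \<le> t (int k) * residual_ms k" using tpos[of k] moments_nonneg by simp
    have "10 / (\<beta> * (1 - 3 * \<nu>)) * (\<beta> * (1 - 3 * \<nu>) / 10 * t (int k) * residual_ms k) \<le> 10 / (\<beta> * (1 - 3 * \<nu>)) * dissipation k"
      using le[of k] \<beta> \<nu>_bounds by (intro mult_left_mono) auto
    then show "t (int k) * residual_ms k \<le> 10 / (\<beta> * (1 - 3 * \<nu>)) * dissipation k" using \<beta> \<nu>_bounds by simp
  qed
  show "summable (\<lambda>k. lag_ms k / t (int k))"
  proof (rule summable_dominated[OF summable_dissipation, where C = "8 * \<beta> * (1 - \<nu>) / \<nu>"])
    fix k
    show "0 \<le> lag_ms k / t (int k)" using tpos[of k] moments_nonneg by simp
    have "8 * \<beta> * (1 - \<nu>) / \<nu> * (\<nu> / (8 * \<beta> * (1 - \<nu>) * t (int k)) * lag_ms k) \<le> 8 * \<beta> * (1 - \<nu>) / \<nu> * dissipation k"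
      using le[of k] \<beta> \<nu>_bounds by (intro mult_left_mono) auto
    then show "lag_ms k / t (int k) \<le> 8 * \<beta> * (1 - \<nu>) / \<nu> * dissipation k" using \<beta> \<nu>_bounds tpos[of k] by simp
  qed
  show "summable (\<lambda>k. t (int k) * (t (int k) - 1) * error_ms k)"
  proof (rule summable_dominated[OF summable_dissipation, where C = "10 * \<mu> / \<beta>"])
    fix k
    show "0 \<le> t (int k) * (t (int k) - 1) * error_ms k" using t_prod_pos(1)[of k] moments_nonneg by simp
    have "10 * \<mu> / \<beta> * (\<beta> / (10 * \<mu>) * (t (int k) * (t (int k) - 1)) * error_ms k) \<le> 10 * \<mu> / \<beta> * dissipation k"
      using le[of k] \<beta> \<mu> by (intro mult_left_mono) auto
    then show "t (int k) * (t (int k) - 1) * error_ms k \<le> 10 * \<mu> / \<beta> * dissipation k" using \<beta> \<mu> by simp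
  qed
qed

lemma t_pos: "0 < t (int k)" "1 < t (int k)"
  using t_nat(1)[of k] \<mu> by auto

lemma t_weights:
  shows "real (k + 1) \<le> 1 / \<mu> * t (int k)"
    and "(real (k + 1))\<^sup>2 \<le> (1 + 2 * \<mu>) / (2 * \<mu> ^ 3) * (t (int k) * (t (int k) - 1))"
    and "(t (int k - 1))\<^sup>2 / real (Suc k) \<le> \<mu> * r * t (int k)"
    and "1 / real (Suc k) \<le> \<mu> * r / t (int k)"
    and "t (int k) \<le> (1 / (2 * \<mu>)) * (t (int k) * (t (int k) - 1))"
proof -
  show 1: "real (k + 1) \<le> 1 / \<mu> * t (int k)" using t_linear(1)[of k] \<mu> by (simp add: field_simps)
  have "2 * \<mu> * t (int k) \<le> (1 + 2 * \<mu>) * (t (int k) - 1)" using t_nat(1)[of k] by (simp add: algebra_simps)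
  then have "t (int k) * (2 * \<mu> * t (int k)) \<le> t (int k) * ((1 + 2 * \<mu>) * (t (int k) - 1))"
    using t_pos[of k] by (intro mult_left_mono) auto
  then have "(t (int k))\<^sup>2 \<le> (1 + 2 * \<mu>) / (2 * \<mu>) * (t (int k) * (t (int k) - 1))"
    using \<mu> by (simp add: field_simps power2_eq_square)
  then have "1 / \<mu>\<^sup>2 * (t (int k))\<^sup>2 \<le> 1 / \<mu>\<^sup>2 * ((1 + 2 * \<mu>) / (2 * \<mu>) * (t (int k) * (t (int k) - 1)))"
    by (intro mult_left_mono) auto
  moreover have "(real (k + 1))\<^sup>2 \<le> (1 / \<mu> * t (int k))\<^sup>2" using 1 by (intro power_mono) auto
  ultimately show "(real (k + 1))\<^sup>2 \<le> (1 + 2 * \<mu>) / (2 * \<mu> ^ 3) * (t (int k) * (t (int k) - 1))"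
    by (simp add: power_divide power_mult_distrib power3_eq_cube power2_eq_square mult_ac)
  have "(t (int k - 1))\<^sup>2 \<le> t (int k) * t (int k)"
    using t_nat(2)[of k] t_pred[of "int k"] \<mu> unfolding power2_eq_square by (intro mult_mono) auto
  also have "\<dots> \<le> t (int k) * (\<mu> * r * real (Suc k))" using t_linear(2)[of k] t_pos[of k] by (intro mult_left_mono) auto
  finally show "(t (int k - 1))\<^sup>2 / real (Suc k) \<le> \<mu> * r * t (int k)"
    by (simp add: divide_le_eq mult_ac del: of_nat_Suc)
  show "1 / real (Suc k) \<le> \<mu> * r / t (int k)" using t_linear(2)[of k] t_pos[of k] by (simp add: field_simps)
  have "t (int k) * (2 * \<mu>) \<le> t (int k) * (t (int k) - 1)" using t_nat(1)[of k] t_pos[of k] by (intro mult_left_mono) auto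
  then show "t (int k) \<le> (1 / (2 * \<mu>)) * (t (int k) * (t (int k) - 1))" using \<mu> by (simp add: field_simps)
qed

lemma summable_residual: "summable (\<lambda>k. real (k + 1) * residual_ms k)"
proof (rule summable_dominated[OF summable_weighted_residual])
  show "real (k + 1) * residual_ms k \<le> 1 / \<mu> * (t (int k) * residual_ms k)" for k
    using mult_right_mono[OF t_weights(1)[of k], of "residual_ms k"] moments_nonneg by simp
qed (simp add: moments_nonneg)

lemma summable_error: "summable (\<lambda>k. (real (k + 1))\<^sup>2 * error_ms k)"
proof (rule summable_dominated[OF summable_weighted_error])
  show "(real (k + 1))\<^sup>2 * error_ms k \<le> (1 + 2 * \<mu>) / (2 * \<mu> ^ 3) * (t (int k) * (t (int k) - 1) * error_ms k)" for k
    using mult_right_mono[OF t_weights(2)[of k], of "error_ms k"] moments_nonneg by (simp add: mult.assoc)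
qed (simp add: moments_nonneg)

definition step_ms :: "nat \<Rightarrow> real" where "step_ms k = (\<integral>\<omega>. (norm (u (Suc k) \<omega> - u k \<omega>))\<^sup>2 \<partial>M)"

lemma step_ms_nonneg: "0 \<le> step_ms k"
  unfolding step_ms_def by simp

lemma step_ms_le: "step_ms k \<le> 3 / (t (int k))\<^sup>2 * lag_ms k + 12 * \<beta>\<^sup>2 * residual_ms k + 12 * \<beta>\<^sup>2 * error_ms k"
proof -
  have "(norm (u (Suc k) \<omega> - u k \<omega>))\<^sup>2 \<le> 3 / (t (int k))\<^sup>2 * (norm (s k \<omega> - u k \<omega>))\<^sup>2
     + 12 * \<beta>\<^sup>2 * (norm (w k \<omega>))\<^sup>2 + 12 * \<beta>\<^sup>2 * (norm (e k \<omega>))\<^sup>2" if "\<omega> \<in> space M" for \<omega>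
  proof -
    define a where "a = norm (s k \<omega> - u k \<omega>) / t (int k)"
    define b where "b = 2 * \<beta> * norm (w k \<omega>)"
    define c where "c = 2 * \<beta> * norm (e k \<omega>)"
    have "u (Suc k) \<omega> - u k \<omega> = (1 / t (int k)) *\<^sub>R (s k \<omega> - u k \<omega>) - \<eta> k *\<^sub>R (w k \<omega> + e k \<omega>)"
      using u_Suc[OF that, of k] by simp
    then have "norm (u (Suc k) \<omega> - u k \<omega>) \<le> a + norm (\<eta> k *\<^sub>R (w k \<omega> + e k \<omega>))"
      using norm_triangle_ineq4[of "(1 / t (int k)) *\<^sub>R (s k \<omega> - u k \<omega>)" "\<eta> k *\<^sub>R (w k \<omega> + e k \<omega>)"] t_pos(1)[of k]
      by (simp add: a_def)
    moreover have "norm (\<eta> k *\<^sub>R (w k \<omega> + e k \<omega>)) \<le> 2 * \<beta> * (norm (w k \<omega>) + norm (e k \<omega>))"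
      using \<eta>_bounds[of k] norm_triangle_ineq[of "w k \<omega>" "e k \<omega>"] unfolding norm_scaleR by (intro mult_mono) auto
    ultimately have "norm (u (Suc k) \<omega> - u k \<omega>) \<le> a + b + c" by (simp add: b_def c_def algebra_simps)
    then have "(norm (u (Suc k) \<omega> - u k \<omega>))\<^sup>2 \<le> (a + b + c)\<^sup>2" by (intro power_mono) auto
    also have "\<dots> \<le> 3 * a\<^sup>2 + 3 * b\<^sup>2 + 3 * c\<^sup>2"
      using zero_le_power2[of "a - b"] zero_le_power2[of "b - c"] zero_le_power2[of "a - c"]
      by (simp add: power2_eq_square algebra_simps)
    finally show ?thesis by (simp add: a_def b_def c_def power_mult_distrib power_divide)
  qed
  then have "step_ms k \<le> (\<integral>\<omega>. 3 / (t (int k))\<^sup>2 * (norm (s k \<omega> - u k \<omega>))\<^sup>2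
     + 12 * \<beta>\<^sup>2 * (norm (w k \<omega>))\<^sup>2 + 12 * \<beta>\<^sup>2 * (norm (e k \<omega>))\<^sup>2 \<partial>M)"
    unfolding step_ms_def by (intro integral_mono Bochner_Integration.integrable_add integrable_mult_right integrable_terms) auto
  then show ?thesis unfolding residual_ms_def error_ms_def lag_ms_def
    by (simp only: Bochner_Integration.integral_add integral_mult_right_zero Bochner_Integration.integrable_add
      integrable_mult_right integrable_terms)
qed

lemma summable_step: "summable (\<lambda>k. real (k + 1) * step_ms k)"
proof (rule summable_dominated)
  show "summable (\<lambda>k. 3 * (lag_ms k / t (int k)) + 12 * \<beta>\<^sup>2 * (t (int k) * residual_ms k)
     + 12 * \<beta>\<^sup>2 * (1 / (2 * \<mu>)) * (t (int k) * (t (int k) - 1) * error_ms k))"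
    by (intro summable_add summable_mult summable_weighted_lag summable_weighted_residual summable_weighted_error)
  fix k
  show "0 \<le> real (k + 1) * step_ms k" by (simp add: step_ms_nonneg)
  have "real (k + 1) * step_ms k \<le> 1 / \<mu> * t (int k) * step_ms k" using t_weights(1)[of k] step_ms_nonneg by (intro mult_right_mono)
  also have "\<dots> \<le> 1 / \<mu> * t (int k) * (3 / (t (int k))\<^sup>2 * lag_ms k + 12 * \<beta>\<^sup>2 * residual_ms k + 12 * \<beta>\<^sup>2 * error_ms k)"
    using t_pos(1)[of k] \<mu> by (intro mult_left_mono step_ms_le) auto
  also have "\<dots> = 1 / \<mu> * (3 * (lag_ms k / t (int k)) + 12 * \<beta>\<^sup>2 * (t (int k) * residual_ms k) + 12 * \<beta>\<^sup>2 * (t (int k) * error_ms k))"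
  proof -
    have "x * (3 / x\<^sup>2 * z) = 3 * (z / x)" if "x > 0" for x z :: real
      using that by (simp add: power2_eq_square)
    from this[OF t_pos(1)[of k], of "lag_ms k"] show ?thesis by (simp only: mult.assoc distrib_left) (simp add: mult_ac)
  qed
  also have "\<dots> \<le> 1 / \<mu> * (3 * (lag_ms k / t (int k)) + 12 * \<beta>\<^sup>2 * (t (int k) * residual_ms k)
      + 12 * \<beta>\<^sup>2 * ((1 / (2 * \<mu>)) * (t (int k) * (t (int k) - 1)) * error_ms k))"
    using \<mu> moments_nonneg t_weights(5)[of k]
    by (intro mult_left_mono add_left_mono mult_right_mono) auto
  finally show "real (k + 1) * step_ms k \<le> 1 / \<mu> * (3 * (lag_ms k / t (int k)) + 12 * \<beta>\<^sup>2 * (t (int k) * residual_ms k)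
     + 12 * \<beta>\<^sup>2 * (1 / (2 * \<mu>)) * (t (int k) * (t (int k) - 1) * error_ms k))" by (simp add: mult_ac)
qed

text \<open>This value makes \<open>3 / lag_weight\<close> the constant in \<open>2 \<beta> t (t - 1) \<ge> (3 / lag_weight) t\<^sup>2\<close>, which holds because \<open>t\<close> is at
least \<open>1 + \<mu>\<close>; half of that constant and two thirds of the weight control the mixed term.\<close>

definition lag_weight :: real where "lag_weight = 3 * (1 + \<mu>) / (2 * \<beta> * \<mu>)"

definition energy :: "nat \<Rightarrow> 'a \<Rightarrow> 'a \<Rightarrow> real" where
  "energy k a z = 2 * \<beta> * (t (int k - 1) * (t (int k - 1) - 1)) * (norm a)\<^sup>2 - 2 * t (int k - 1) * (a \<bullet> z) + lag_weight * (norm z)\<^sup>2"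

definition mean_energy :: "nat \<Rightarrow> real" where "mean_energy k = (\<integral>\<omega>. energy k (w k \<omega>) (s k \<omega> - u k \<omega>) \<partial>M)"

lemma lag_weight_pos: "0 < lag_weight"
  using \<mu> \<beta> by (simp add: lag_weight_def)

lemma energy_bounds:
  shows "1 / lag_weight * (t (int k - 1))\<^sup>2 * (norm a)\<^sup>2 + lag_weight / 3 * (norm z)\<^sup>2 \<le> energy k a z"
    and "energy k a z \<le> (2 * \<beta> + 1) * (t (int k - 1))\<^sup>2 * (norm a)\<^sup>2 + (lag_weight + 1) * (norm z)\<^sup>2"
proof -
  define q where "q = t (int k - 1)"
  have q: "q \<ge> 1 + \<mu>" using t_nat(2)[of k] by (simp add: q_def)
  have y1: "(2 * q) * (a \<bullet> z) \<le> (3 / (2 * lag_weight) * q\<^sup>2) * (norm a)\<^sup>2 + (2 * lag_weight / 3) * (norm z)\<^sup>2"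
    using lag_weight_pos q \<mu> by (intro inner_young) (auto simp: power_mult_distrib)
  have y2: "(- (2 * q)) * (a \<bullet> z) \<le> q\<^sup>2 * (norm a)\<^sup>2 + 1 * (norm z)\<^sup>2"
    using q \<mu> by (intro inner_young) (auto simp: power_mult_distrib)
  have "q * (\<mu> * q) \<le> q * ((1 + \<mu>) * (q - 1))" using q \<mu> by (intro mult_left_mono) (auto simp: algebra_simps)
  then have "2 * \<beta> / (1 + \<mu>) * (q * (\<mu> * q)) \<le> 2 * \<beta> / (1 + \<mu>) * (q * ((1 + \<mu>) * (q - 1)))"
    by (rule mult_left_mono) (use \<beta> \<mu> in simp)
  also have "\<dots> = 2 * \<beta> * (q * (q - 1))" using \<mu> by simp
  also have "2 * \<beta> / (1 + \<mu>) * (q * (\<mu> * q)) = 3 / lag_weight * q\<^sup>2"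
  proof -
    have "3 / lag_weight = 2 * \<beta> / (1 + \<mu>) * \<mu>" using \<mu> \<beta> by (simp add: lag_weight_def field_simps)
    then show ?thesis by (simp add: power2_eq_square)
  qed
  finally have "3 / lag_weight * q\<^sup>2 * (norm a)\<^sup>2 \<le> 2 * \<beta> * (q * (q - 1)) * (norm a)\<^sup>2" by (intro mult_right_mono) auto
  moreover have "1 / lag_weight * q\<^sup>2 * (norm a)\<^sup>2 \<le> 3 / (2 * lag_weight) * q\<^sup>2 * (norm a)\<^sup>2"
    using lag_weight_pos by (intro mult_right_mono) (auto simp: field_simps)
  moreover have "3 / lag_weight * q\<^sup>2 * (norm a)\<^sup>2 = 2 * (3 / (2 * lag_weight) * q\<^sup>2 * (norm a)\<^sup>2)" by simp
  ultimately show "1 / lag_weight * (t (int k - 1))\<^sup>2 * (norm a)\<^sup>2 + lag_weight / 3 * (norm z)\<^sup>2 \<le> energy k a z"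
    using y1 unfolding energy_def q_def[symmetric] by (simp add: algebra_simps)
  have "2 * \<beta> * (q * (q - 1)) * (norm a)\<^sup>2 \<le> 2 * \<beta> * q\<^sup>2 * (norm a)\<^sup>2"
    using q \<mu> \<beta> by (intro mult_right_mono mult_left_mono) (auto simp: power2_eq_square)
  then show "energy k a z \<le> (2 * \<beta> + 1) * (t (int k - 1))\<^sup>2 * (norm a)\<^sup>2 + (lag_weight + 1) * (norm z)\<^sup>2"
    using y2 unfolding energy_def q_def[symmetric] by (simp add: algebra_simps)
qed

lemma integrable_energy: "integrable M (\<lambda>\<omega>. energy k (w k \<omega>) (s k \<omega> - u k \<omega>))"
  unfolding energy_def by (intro Bochner_Integration.integrable_add Bochner_Integration.integrable_diff integrable_mult_right integrable_terms)

lemma mean_energy_bounds: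
  shows "1 / lag_weight * (t (int k - 1))\<^sup>2 * residual_ms k + lag_weight / 3 * lag_ms k \<le> mean_energy k"
    and "mean_energy k \<le> (2 * \<beta> + 1) * (t (int k - 1))\<^sup>2 * residual_ms k + (lag_weight + 1) * lag_ms k"
proof -
  have "(\<integral>\<omega>. 1 / lag_weight * (t (int k - 1))\<^sup>2 * (norm (w k \<omega>))\<^sup>2 + lag_weight / 3 * (norm (s k \<omega> - u k \<omega>))\<^sup>2 \<partial>M) \<le> mean_energy k"
    unfolding mean_energy_def by (intro integral_mono Bochner_Integration.integrable_add integrable_mult_right integrable_terms integrable_energy energy_bounds)
  then show "1 / lag_weight * (t (int k - 1))\<^sup>2 * residual_ms k + lag_weight / 3 * lag_ms k \<le> mean_energy k"
    unfolding residual_ms_def error_ms_def lag_ms_def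
    by (simp only: Bochner_Integration.integral_add integral_mult_right_zero Bochner_Integration.integrable_add
      integrable_mult_right integrable_terms)
  have "mean_energy k \<le> (\<integral>\<omega>. (2 * \<beta> + 1) * (t (int k - 1))\<^sup>2 * (norm (w k \<omega>))\<^sup>2 + (lag_weight + 1) * (norm (s k \<omega> - u k \<omega>))\<^sup>2 \<partial>M)"
    unfolding mean_energy_def by (intro integral_mono Bochner_Integration.integrable_add integrable_mult_right integrable_terms integrable_energy energy_bounds)
  then show "mean_energy k \<le> (2 * \<beta> + 1) * (t (int k - 1))\<^sup>2 * residual_ms k + (lag_weight + 1) * lag_ms k"
    unfolding residual_ms_def error_ms_def lag_ms_def
    by (simp only: Bochner_Integration.integral_add integral_mult_right_zero Bochner_Integration.integrable_add
      integrable_mult_right integrable_terms)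
qed

lemma mean_energy_quasi_decreasing:
  "mean_energy (Suc k) \<le> mean_energy k + ((8 * \<beta> * \<mu> + 1 + 16 * lag_weight * \<beta>\<^sup>2) * (t (int k) * residual_ms k) + (1 + lag_weight) * (lag_ms k / t (int k))
     + (3 * \<beta> / \<mu> + 8 * lag_weight * \<beta>\<^sup>2 / \<mu>) * (t (int k) * (t (int k) - 1) * error_ms k))"
proof -
  have "energy (Suc k) (w (Suc k) \<omega>) (s (Suc k) \<omega> - u (Suc k) \<omega>)
     \<le> energy k (w k \<omega>) (s k \<omega> - u k \<omega>) + (8 * \<beta> * \<mu> + 1 + 16 * lag_weight * \<beta>\<^sup>2) * t (int k) * (norm (w k \<omega>))\<^sup>2
       + (1 + lag_weight) / t (int k) * (norm (s k \<omega> - u k \<omega>))\<^sup>2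
       + (3 * \<beta> / \<mu> + 8 * lag_weight * \<beta>\<^sup>2 / \<mu>) * (t (int k) * (t (int k) - 1)) * (norm (e k \<omega>))\<^sup>2"
    if "\<omega> \<in> space M" for \<omega>
    using energy_step[OF \<mu> \<nu> t_nat(1) \<beta> \<eta> u_Suc[OF that] s_Suc[OF that] coco_Suc[OF that] less_imp_le[OF lag_weight_pos]]
    unfolding energy_def unfolding t_Suc unfolding t_pred by simp
  then have "mean_energy (Suc k) \<le> (\<integral>\<omega>. energy k (w k \<omega>) (s k \<omega> - u k \<omega>) + (8 * \<beta> * \<mu> + 1 + 16 * lag_weight * \<beta>\<^sup>2) * t (int k) * (norm (w k \<omega>))\<^sup>2
       + (1 + lag_weight) / t (int k) * (norm (s k \<omega> - u k \<omega>))\<^sup>2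
       + (3 * \<beta> / \<mu> + 8 * lag_weight * \<beta>\<^sup>2 / \<mu>) * (t (int k) * (t (int k) - 1)) * (norm (e k \<omega>))\<^sup>2 \<partial>M)"
    unfolding mean_energy_def by (intro integral_mono Bochner_Integration.integrable_add integrable_mult_right integrable_terms integrable_energy) auto
  then have "mean_energy (Suc k) \<le> mean_energy k + (8 * \<beta> * \<mu> + 1 + 16 * lag_weight * \<beta>\<^sup>2) * t (int k) * residual_ms k
       + (1 + lag_weight) / t (int k) * lag_ms k
       + (3 * \<beta> / \<mu> + 8 * lag_weight * \<beta>\<^sup>2 / \<mu>) * (t (int k) * (t (int k) - 1)) * error_ms k"
    unfolding residual_ms_def error_ms_def lag_ms_def mean_energy_def[of k]
    by (simp only: Bochner_Integration.integral_add integral_mult_right_zero Bochner_Integration.integrable_add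
      integrable_mult_right integrable_terms integrable_energy)
  then show ?thesis by (simp add: mult.assoc)
qed

text \<open>The energy is at most a constant times \<open>t\<^sup>2 |w|\<^sup>2 + |z|\<^sup>2\<close> in mean, and \<open>t\<close> grows linearly, so after division by the
index it is dominated by the summable \<open>t |w|\<^sup>2 + |z|\<^sup>2 / t\<close>.\<close>

lemma mean_energy_tendsto_0: "mean_energy \<longlonglongrightarrow> 0"
proof (rule tendsto_0_of_quasi_decreasing)
  show "mean_energy (Suc k) \<le> mean_energy k + ((8 * \<beta> * \<mu> + 1 + 16 * lag_weight * \<beta>\<^sup>2) * (t (int k) * residual_ms k) + (1 + lag_weight) * (lag_ms k / t (int k))
     + (3 * \<beta> / \<mu> + 8 * lag_weight * \<beta>\<^sup>2 / \<mu>) * (t (int k) * (t (int k) - 1) * error_ms k))" for k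
    by (rule mean_energy_quasi_decreasing)
  show Q0: "0 \<le> mean_energy k" for k
  proof -
    have "0 \<le> 1 / lag_weight * (t (int k - 1))\<^sup>2 * residual_ms k + lag_weight / 3 * lag_ms k" using lag_weight_pos moments_nonneg by simp
    then show ?thesis using mean_energy_bounds(1)[of k] by linarith
  qed
  show "summable (\<lambda>k. (8 * \<beta> * \<mu> + 1 + 16 * lag_weight * \<beta>\<^sup>2) * (t (int k) * residual_ms k) + (1 + lag_weight) * (lag_ms k / t (int k))
     + (3 * \<beta> / \<mu> + 8 * lag_weight * \<beta>\<^sup>2 / \<mu>) * (t (int k) * (t (int k) - 1) * error_ms k))"
    by (intro summable_add summable_mult summable_weighted_lag summable_weighted_residual summable_weighted_error)
  show "0 \<le> (8 * \<beta> * \<mu> + 1 + 16 * lag_weight * \<beta>\<^sup>2) * (t (int k) * residual_ms k) + (1 + lag_weight) * (lag_ms k / t (int k))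
     + (3 * \<beta> / \<mu> + 8 * lag_weight * \<beta>\<^sup>2 / \<mu>) * (t (int k) * (t (int k) - 1) * error_ms k)" for k
    using lag_weight_pos \<beta> \<mu> moments_nonneg t_pos[of k]
    by (intro add_nonneg_nonneg mult_nonneg_nonneg divide_nonneg_nonneg) auto
  show "summable (\<lambda>k. mean_energy k / real (Suc k))"
  proof (rule summable_dominated)
    show "summable (\<lambda>k. (2 * \<beta> + 1) * (t (int k) * residual_ms k) + (lag_weight + 1) * (lag_ms k / t (int k)))"
      by (intro summable_add summable_mult summable_weighted_lag summable_weighted_residual)
    fix k
    show "0 \<le> mean_energy k / real (Suc k)" using Q0 by simp
    have "mean_energy k / real (Suc k) \<le> ((2 * \<beta> + 1) * (t (int k - 1))\<^sup>2 * residual_ms k + (lag_weight + 1) * lag_ms k) / real (Suc k)"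
      using mean_energy_bounds(2)[of k] by (intro divide_right_mono) auto
    also have "\<dots> = (2 * \<beta> + 1) * ((t (int k - 1))\<^sup>2 / real (Suc k) * residual_ms k) + (lag_weight + 1) * (1 / real (Suc k) * lag_ms k)"
      by (simp add: add_divide_distrib)
    also have "\<dots> \<le> (2 * \<beta> + 1) * (\<mu> * r * t (int k) * residual_ms k) + (lag_weight + 1) * (\<mu> * r / t (int k) * lag_ms k)"
      using t_weights(3,4)[of k] moments_nonneg lag_weight_pos \<beta> by (intro add_mono mult_left_mono mult_right_mono) auto
    finally show "mean_energy k / real (Suc k) \<le> \<mu> * r * ((2 * \<beta> + 1) * (t (int k) * residual_ms k) + (lag_weight + 1) * (lag_ms k / t (int k)))"
      by (simp add: algebra_simps)
  qed
qed

lemma lag_tendsto_0: "lag_ms \<longlonglongrightarrow> 0"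
proof (rule tendsto_0_of_le)
  show "(\<lambda>k. 3 / lag_weight * mean_energy k) \<longlonglongrightarrow> 0" using tendsto_mult_right_zero[OF mean_energy_tendsto_0] .
  have "lag_ms k \<le> 3 / lag_weight * mean_energy k" for k
  proof -
    have "0 \<le> 1 / lag_weight * (t (int k - 1))\<^sup>2 * residual_ms k" using lag_weight_pos moments_nonneg by simp
    then have "lag_weight / 3 * lag_ms k \<le> mean_energy k" using mean_energy_bounds(1)[of k] by linarith
    then show ?thesis using lag_weight_pos by (simp add: field_simps)
  qed
  then show "lag_ms k \<le> 3 / lag_weight * mean_energy k" for k .
qed (use moments_nonneg in auto)

lemma residual_tendsto_0: "(\<lambda>k. (real k)\<^sup>2 * residual_ms k) \<longlonglongrightarrow> 0"
proof (rule tendsto_0_of_le)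
  show "(\<lambda>k. lag_weight / \<mu>\<^sup>2 * mean_energy k) \<longlonglongrightarrow> 0" using tendsto_mult_right_zero[OF mean_energy_tendsto_0] .
  have "(real k)\<^sup>2 * residual_ms k \<le> lag_weight / \<mu>\<^sup>2 * mean_energy k" for k
  proof -
    have "\<mu> * real k \<le> t (int k - 1)" using t_lower[of "int k - 1"] \<mu> by (simp add: algebra_simps)
    then have "(\<mu> * real k)\<^sup>2 \<le> (t (int k - 1))\<^sup>2" using \<mu> by (intro power_mono) auto
    then have "(\<mu> * real k)\<^sup>2 * residual_ms k \<le> (t (int k - 1))\<^sup>2 * residual_ms k" using moments_nonneg by (intro mult_right_mono)
    also have "\<dots> \<le> lag_weight * mean_energy k"
    proof -
      have "0 \<le> lag_weight / 3 * lag_ms k" using lag_weight_pos moments_nonneg by simp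
      then have "1 / lag_weight * (t (int k - 1))\<^sup>2 * residual_ms k \<le> mean_energy k" using mean_energy_bounds(1)[of k] by linarith
      then show ?thesis using lag_weight_pos by (simp add: field_simps)
    qed
    finally show ?thesis using \<mu> by (simp add: power_mult_distrib field_simps)
  qed
  then show "(real k)\<^sup>2 * residual_ms k \<le> lag_weight / \<mu>\<^sup>2 * mean_energy k" for k .
qed (use moments_nonneg in auto)

lemma error_tendsto_0: "(\<lambda>k. (real k)\<^sup>2 * error_ms k) \<longlonglongrightarrow> 0"
proof (rule tendsto_0_of_le)
  show "(\<lambda>k. (real (k + 1))\<^sup>2 * error_ms k) \<longlonglongrightarrow> 0" by (rule summable_LIMSEQ_zero[OF summable_error])
  have "(real k)\<^sup>2 * error_ms k \<le> (real (k + 1))\<^sup>2 * error_ms k" for k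
    using moments_nonneg by (intro mult_right_mono power_mono) auto
  then show "(real k)\<^sup>2 * error_ms k \<le> (real (k + 1))\<^sup>2 * error_ms k" for k .
qed (use moments_nonneg in auto)

lemma step_tendsto_0: "(\<lambda>k. (real k)\<^sup>2 * step_ms k) \<longlonglongrightarrow> 0"
proof (rule tendsto_0_of_le)
  show "(\<lambda>k. 3 / \<mu>\<^sup>2 * lag_ms k + 12 * \<beta>\<^sup>2 * ((real k)\<^sup>2 * residual_ms k) + 12 * \<beta>\<^sup>2 * ((real k)\<^sup>2 * error_ms k)) \<longlonglongrightarrow> 0"
    by (intro tendsto_add_zero tendsto_mult_right_zero lag_tendsto_0 residual_tendsto_0 error_tendsto_0)
  have "(real k)\<^sup>2 * step_ms k \<le> 3 / \<mu>\<^sup>2 * lag_ms k + 12 * \<beta>\<^sup>2 * ((real k)\<^sup>2 * residual_ms k) + 12 * \<beta>\<^sup>2 * ((real k)\<^sup>2 * error_ms k)" for k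
  proof -
    have "\<mu> * real k \<le> t (int k)" using t_lower[of "int k"] \<mu> by (simp add: algebra_simps)
    then have "(\<mu> * real k)\<^sup>2 \<le> (t (int k))\<^sup>2" using \<mu> by (intro power_mono) auto
    then have "(real k)\<^sup>2 / (t (int k))\<^sup>2 \<le> 1 / \<mu>\<^sup>2" using \<mu> t_pos(1)[of k] by (simp add: power_mult_distrib field_simps)
    then have "3 * ((real k)\<^sup>2 / (t (int k))\<^sup>2) * lag_ms k \<le> 3 * (1 / \<mu>\<^sup>2) * lag_ms k"
      using moments_nonneg by (intro mult_right_mono mult_left_mono) auto
    moreover have "(real k)\<^sup>2 * step_ms k \<le> (real k)\<^sup>2 * (3 / (t (int k))\<^sup>2 * lag_ms k + 12 * \<beta>\<^sup>2 * residual_ms k + 12 * \<beta>\<^sup>2 * error_ms k)"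
      by (intro mult_left_mono step_ms_le) auto
    ultimately show ?thesis by (simp add: algebra_simps)
  qed
  then show "(real k)\<^sup>2 * step_ms k
      \<le> 3 / \<mu>\<^sup>2 * lag_ms k + 12 * \<beta>\<^sup>2 * ((real k)\<^sup>2 * residual_ms k) + 12 * \<beta>\<^sup>2 * ((real k)\<^sup>2 * error_ms k)" for k .
qed (use step_ms_nonneg in auto)

end

section \<open>Convergence of the scheme\<close>

theorem theorem26:
  fixes F :: "'a::euclidean_space \<Rightarrow> 'a"
    and T :: "'a \<Rightarrow> 'a set"
    and Fs :: "('s, 'a) stoch_op"
    and M :: "'w measure" and \<F> :: "nat \<Rightarrow> 'w measure"
    and x u s v Ft \<xi> :: "nat \<Rightarrow> 'w \<Rightarrow> 'a"
    and x0 \<xi>0 :: 'a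
    and \<Delta> :: "nat \<Rightarrow> 'w \<Rightarrow> real"
    and \<kappa> \<Theta> \<sigma> \<eta> :: "nat \<Rightarrow> real"
    and \<Gamma> t :: "int \<Rightarrow> real"
    and L Lh \<rho> lam \<beta> \<beta>bar \<Lambda> \<mu> \<nu> r B :: real
  assumes M: "prob_space M"
    and setting: "represents Fs F"
    and A1: "zer (sum_op F T) \<noteq> {}"
    and A2: "bounded_variance Fs F"
    and A3: "\<rho> \<ge> 0" "max_co_hypomonotone \<rho> T"
    and A4: "L > 0" "cocoercive_in_mean Fs F L"
    and L\<rho>: "L * \<rho> < 1"
    and Lh: "Lh > L" "Lh * \<rho> < 1"
    and \<beta>bar: "\<beta>bar = (lam * (4 - Lh * lam) - 4 * \<rho>) / (4 * (1 - \<rho> * Lh))"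
    and \<Lambda>: "\<Lambda> = (Lh - L) / (L * Lh)"
    and lam: "lam > 0" "2 * \<rho> \<le> lam" "lam < 2 * (1 + sqrt (1 - Lh * \<rho>)) / Lh"
    and \<mu>: "0 < \<mu>" "\<mu> < 2 / 3"
    and r: "r \<ge> 2 + 1 / \<mu>"
    and \<nu>: "\<nu> = \<mu> / 2"
    and \<beta>: "0 < \<beta>" "\<beta> \<le> (2 - \<mu>) * \<beta>bar / (2 + \<mu>)"
    and t: "\<And>k. t k = \<mu> * (real_of_int k + r)"
    and \<eta>: "\<And>k. \<eta> k = 2 * \<beta> * (t (int k) - 1) / (t (int k) - \<nu>)"
    and iter: "vfosa_minus M \<F> F T lam \<nu> t \<eta> x0 \<xi>0 x u s v Ft"
    and vr: "VR M \<F> Fs F x Ft \<Delta> \<kappa> \<Theta> \<sigma>"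
    and \<Theta>_pos: "\<And>k. \<Theta> k > 0"
    and \<Gamma>_pos: "\<And>k. k \<ge> -1 \<Longrightarrow> \<Gamma> k > 0"
    and \<kappa>: "\<And>k. \<kappa> k \<ge> 1
        - (\<Gamma> (int k - 1) * t (int k - 2) * (t (int k - 2) - 1))
            / (\<Gamma> (int k) * t (int k - 1) * (t (int k - 1) - 1))
        + 5 * \<beta> / (\<mu> * \<Gamma> (int k))"
    and \<Gamma>\<Theta>: "\<And>k. \<Gamma> (int k) * \<Theta> k \<le> 2 * \<Lambda>"
    and B_finite: "summable (\<lambda>k. t (int k - 1) * (t (int k - 1) - 1) * ((\<sigma> k)\<^sup>2 / \<Theta> k))"
    and B: "B = \<Lambda> / \<beta> * (\<Sum>k. t (int k - 1) * (t (int k - 1) - 1) * ((\<sigma> k)\<^sup>2 / \<Theta> k))"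
    and \<xi>: "\<And>k \<omega>. \<xi> k \<omega> = (1 / lam) *\<^sub>R (u k \<omega> - x k \<omega>)"
  shows "(\<forall>ustar \<in> zer (bfs_residual F lam T). \<forall>\<Psi>0_sq E0_sq.
            \<Psi>0_sq = \<mu>\<^sup>2 * r\<^sup>2 * (\<integral>\<omega>. (norm (F (x 0 \<omega>) + \<xi> 0 \<omega>))\<^sup>2 \<partial>M)
              + (2 * r - 1) / (4 * \<beta>\<^sup>2 * (\<mu> * r - 1)) * (norm (x0 + lam *\<^sub>R \<xi>0 - ustar))\<^sup>2 \<longrightarrow>
            E0_sq = \<mu> * r\<^sup>2 * (\<mu> * \<Gamma> 0 + \<beta>) * (\<sigma> 0)\<^sup>2 / (2 * \<beta>) \<longrightarrow>
            (\<forall>k. mean_sq M (\<lambda>\<omega>. F (x k \<omega>) + \<xi> k \<omega>)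
                   \<le> ennreal (2 * (\<Psi>0_sq + E0_sq + B) / (\<mu>\<^sup>2 * (real k + r - 1)\<^sup>2))))
    \<and> (\<Sum>k. ennreal (real (k + 1)) * mean_sq M (\<lambda>\<omega>. F (x k \<omega>) + \<xi> k \<omega>)) < \<infinity>
    \<and> (\<beta> < (2 - \<mu>) * \<beta>bar / (2 + \<mu>) \<longrightarrow>
          (\<Sum>k. ennreal ((real (k + 1))\<^sup>2) * mean_sq M (\<lambda>\<omega>. Ft k \<omega> - F (x k \<omega>))) < \<infinity>
        \<and> (\<Sum>k. ennreal (real (k + 1)) * mean_sq M (\<lambda>\<omega>. u (k + 1) \<omega> - u k \<omega>)) < \<infinity>
        \<and> (\<Sum>k. ennreal (real (k + 1)) * mean_sq M (\<lambda>\<omega>. x (k + 1) \<omega> - x k \<omega>)) < \<infinity>)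
    \<and> (\<lambda>k. ennreal ((real k)\<^sup>2) * mean_sq M (\<lambda>\<omega>. u (k + 1) \<omega> - u k \<omega>)) \<longlonglongrightarrow> 0
    \<and> (\<lambda>k. ennreal ((real k)\<^sup>2) * mean_sq M (\<lambda>\<omega>. x (k + 1) \<omega> - x k \<omega>)) \<longlonglongrightarrow> 0
    \<and> (\<lambda>k. ennreal ((real k)\<^sup>2) * mean_sq M (\<lambda>\<omega>. F (x k \<omega>) + \<xi> k \<omega>)) \<longlonglongrightarrow> 0"
proof -
  interpret prob_space M by (rule M)
  note finM = finite_measure_axioms
  define w where "w k \<omega> = F (x k \<omega>) + \<xi> k \<omega>" for k \<omega>
  define e where "e k \<omega> = Ft k \<omega> - F (x k \<omega>)" for k \<omega>

  have \<beta>': "\<beta> * (2 + \<mu>) \<le> (2 - \<mu>) * \<beta>bar" using \<beta>(2) \<mu> by (simp add: pos_le_divide_eq)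
  interpret vfosa_step_sizes \<mu> \<nu> \<beta> \<beta>bar r t \<eta>
    by unfold_locales (fact \<mu> r \<nu> \<beta>(1) \<beta>' t \<eta>)+
  have T: "co_hypomonotone \<rho> T" using A3 by (simp add: max_co_hypomonotone_def)
  have \<Lambda>0: "\<Lambda> > 0" using \<Lambda> A4(1) Lh(1) by simp

  have sub: "subalgebra M (\<F> k)" for k using iter by (auto simp: vfosa_minus_def)
  have meas: "x k \<in> borel_measurable M" "u k \<in> borel_measurable M" "Ft k \<in> borel_measurable M" for k
    using iter measurable_from_subalg[OF sub] unfolding vfosa_minus_def by blast+
  have \<xi>0: "\<xi>0 \<in> T x0" using iter by (simp add: vfosa_minus_def)
  have init: "u 0 \<omega> = x0 + lam *\<^sub>R \<xi>0" "s 0 \<omega> = u 0 \<omega>"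
    and res: "x k \<omega> \<in> resolvent lam T (u k \<omega>)"
    and v: "v k \<omega> = ((t (int k) - 1) / t (int k)) *\<^sub>R u k \<omega> + (1 / t (int k)) *\<^sub>R s k \<omega>"
    and u': "u (Suc k) \<omega> = v k \<omega> - \<eta> k *\<^sub>R (Ft k \<omega> + (1 / lam) *\<^sub>R (u k \<omega> - x k \<omega>))"
    and s': "s (Suc k) \<omega> = s k \<omega> + \<nu> *\<^sub>R (u (Suc k) \<omega> - v k \<omega>)"
    if "\<omega> \<in> space M" for k \<omega>
    using iter that unfolding vfosa_minus_def by blast+
  have we: "Ft k \<omega> + (1 / lam) *\<^sub>R (u k \<omega> - x k \<omega>) = w k \<omega> + e k \<omega>" for k \<omega>
    by (simp add: w_def e_def \<xi>)
  have u_Suc: "u (Suc k) \<omega> = u k \<omega> + (1 / t (int k)) *\<^sub>R (s k \<omega> - u k \<omega>) - \<eta> k *\<^sub>R (w k \<omega> + e k \<omega>)"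
    if "\<omega> \<in> space M" for k \<omega>
  proof -
    have "(t (int k) - 1) / t (int k) = 1 - 1 / t (int k)" using t_nat(1)[of k] \<mu> by (simp add: diff_divide_distrib)
    then have "v k \<omega> = (1 - 1 / t (int k)) *\<^sub>R u k \<omega> + (1 / t (int k)) *\<^sub>R s k \<omega>" using v[OF that, of k] by simp
    then have "v k \<omega> = u k \<omega> + (1 / t (int k)) *\<^sub>R (s k \<omega> - u k \<omega>)"
      by (simp only: scaleR_left_diff_distrib scaleR_right_diff_distrib scaleR_one) simp
    then show ?thesis using u'[OF that, of k] by (simp only: we)
  qed
  have s_Suc: "s (Suc k) \<omega> = s k \<omega> - (\<nu> * \<eta> k) *\<^sub>R (w k \<omega> + e k \<omega>)" if "\<omega> \<in> space M" for k \<omega>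
  proof -
    have "u (Suc k) \<omega> - v k \<omega> = - (\<eta> k *\<^sub>R (w k \<omega> + e k \<omega>))" using u'[OF that, of k] by (simp only: we) simp
    then show ?thesis using s'[OF that, of k] by simp
  qed
  have \<xi>T: "\<xi> k \<omega> \<in> T (x k \<omega>)" and u_eq: "u k \<omega> = x k \<omega> + lam *\<^sub>R \<xi> k \<omega>" if "\<omega> \<in> space M" for k \<omega>
    using res[OF that, of k] resolvent_iff[OF lam(1)] lam(1) by (auto simp: \<xi>)

  note coco = splitting_residual_cocoercive[OF setting A2 A4(2) T A4(1) Lh lam(1) \<beta>bar, folded \<Lambda>]
  \<comment> \<open>The gap is measurable because \<open>F\<close> is continuous, and dominates
    \<open>\<Lambda>\<close> times the mean square difference.\<close>
  define gap where "gap k \<omega> = (w (Suc k) \<omega> - w k \<omega>) \<bullet> (u (Suc k) \<omega> - u k \<omega>) - \<beta>bar * (norm (w (Suc k) \<omega> - w k \<omega>))\<^sup>2" for k \<omega>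
  have gap: "\<Lambda> * mean_sq_diff Fs (x (Suc k) \<omega>) (x k \<omega>) \<le> gap k \<omega>" if "\<omega> \<in> space M" for k \<omega>
    using coco[OF \<xi>T[OF that, of "Suc k"] \<xi>T[OF that, of k]]
    unfolding gap_def u_eq[OF that, of "Suc k"] u_eq[OF that, of k] w_def by simp
  have msd0: "0 \<le> mean_sq_diff Fs y z" for y z
    using norm_diff_le_mean_sq_diff[OF setting A2, of y z] zero_le_power2 by (rule order_trans[rotated])
  have gap0: "0 \<le> gap k \<omega>" if "\<omega> \<in> space M" for k \<omega>
    using gap[OF that, of k] msd0 \<Lambda>0 by (meson mult_nonneg_nonneg less_imp_le order_trans)
  have nonexp: "norm (x k \<omega> - y) \<le> norm (u k \<omega> - y')" if "\<omega> \<in> space M" "y \<in> resolvent lam T y'" for k \<omega> y y'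
    by (rule resolvent_nonexpansive[OF T lam(1,2) res[OF that(1)] that(2)])
  have lip: "norm (F y - F z) \<le> L * norm (y - z)" for y z
    by (rule cocoercive_in_mean_lipschitz[OF setting A2 A4(2,1)])
  have "L-lipschitz_on UNIV F" using lip A4(1) by (intro lipschitz_onI) (auto simp: dist_norm)
  then have Fm: "F \<in> borel_measurable borel"
    by (intro borel_measurable_continuous_onI lipschitz_on_continuous_on)
  have Fxm: "(\<lambda>\<omega>. F (x k \<omega>)) \<in> borel_measurable M" for k
    using measurable_compose[OF meas(1) Fm] by simp

  have x0: "x0 \<in> resolvent lam T (x0 + lam *\<^sub>R \<xi>0)" using \<xi>0 lam(1) by (simp add: resolvent_iff)
  have sq_w: "sq_integrable M (w k)" if u: "sq_integrable M (u k)" for k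
  proof -
    have du: "sq_integrable M (\<lambda>\<omega>. u k \<omega> - (x0 + lam *\<^sub>R \<xi>0))" by (intro sq_integrable_diff sq_integrable_const u finM)
    have dx: "sq_integrable M (\<lambda>\<omega>. x k \<omega> - x0)"
      by (rule sq_integrable_bound[OF du, where C = 1]) (use nonexp[OF _ x0] meas in auto)
    have dF: "sq_integrable M (\<lambda>\<omega>. F (x k \<omega>) - F x0)"
      by (rule sq_integrable_bound[OF dx, where C = L]) (use lip Fxm in auto)
    have "sq_integrable M (\<lambda>\<omega>. (F (x k \<omega>) - F x0) + F x0 + (1 / lam) *\<^sub>R (u k \<omega> - ((x k \<omega> - x0) + x0)))"
      by (intro sq_integrable_add sq_integrable_diff sq_integrable_scaleR sq_integrable_const dF dx u finM)
    then show ?thesis by (simp add: w_def[abs_def] \<xi>)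
  qed
  have gap_int: "integrable M (gap k)" if "sq_integrable M (u k)" "sq_integrable M (u (Suc k))" for k
    unfolding gap_def[abs_def]
    by (intro Bochner_Integration.integrable_diff integrable_mult_right sq_integrable_norm sq_integrable_inner
        sq_integrable_diff sq_w that)

  define D where "D k = (\<integral>\<omega>. \<Delta> k \<omega> \<partial>M)" for k
  \<comment> \<open>At index 0 the preceding iterate is \<open>x 0\<close> itself, so the mean
    square difference vanishes there.\<close>
  define g where "g k \<omega> = (case k of 0 \<Rightarrow> 0 | Suc j \<Rightarrow> gap j \<omega> / \<Lambda>)" for k \<omega>
  have g_ge: "mean_sq_diff Fs (x k \<omega>) (x (k - 1) \<omega>) \<le> g k \<omega>" "0 \<le> g k \<omega>" if "\<omega> \<in> space M" for k \<omega>
    using gap[OF that] gap0[OF that] \<Lambda>0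
    by (auto simp: g_def mean_sq_diff_same pos_le_divide_eq mult.commute split: nat.split)
  have moments: "integrable M (\<Delta> k) \<and> sq_integrable M (e k) \<and> (\<integral>\<omega>. (norm (e k \<omega>))\<^sup>2 \<partial>M) \<le> D k \<and>
      D k \<le> (1 - \<kappa> k) * (\<integral>\<omega>. (case k of 0 \<Rightarrow> 0 | Suc j \<Rightarrow> \<Delta> j \<omega>) \<partial>M) + \<Theta> k * (\<integral>\<omega>. g k \<omega> \<partial>M) + (\<sigma> k)\<^sup>2"
    if "\<And>j. j \<le> k \<Longrightarrow> sq_integrable M (u j)" "\<And>j. j < k \<Longrightarrow> integrable M (\<Delta> j)" for k
  proof -
    have "integrable M (\<lambda>\<omega>. case k of 0 \<Rightarrow> 0 | Suc j \<Rightarrow> \<Delta> j \<omega>)" using that(2) by (cases k) auto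
    moreover have "integrable M (g k)" using that(1) gap_int by (cases k) (auto simp: g_def[abs_def])
    moreover have "(\<lambda>\<omega>. Ft k \<omega> - F (x k \<omega>)) \<in> borel_measurable M" using meas Fxm by measurable
    ultimately show ?thesis
      using VR_moments[OF M sub vr, of k "g k"] g_ge unfolding D_def e_def[abs_def] by blast
  qed
  \<comment> \<open>Square integrability of the iterates and integrability of
    \<open>\<Delta>\<close> depend on each other: the gap before step \<open>k\<close> bounds
    \<open>\<Delta> k\<close>, hence the error, hence the next iterate.\<close>
  have all: "(\<forall>j\<le>k. sq_integrable M (u j) \<and> sq_integrable M (s j)) \<and> (\<forall>j<k. integrable M (\<Delta> j))" for k
  proof (induction k)
    case 0
    have "sq_integrable M (u 0)" by (subst sq_integrable_cong[OF init(1)]) (auto intro: sq_integrable_const finM)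
    moreover from this have "sq_integrable M (s 0)" by (subst sq_integrable_cong[OF init(2)])
    ultimately show ?case by simp
  next
    case (Suc k)
    then have m: "integrable M (\<Delta> k)" "sq_integrable M (e k)" using moments[of k] by auto
    have k: "sq_integrable M (u k)" "sq_integrable M (s k)" using Suc by auto
    have "sq_integrable M (u (Suc k))"
      by (subst sq_integrable_cong[OF u_Suc]) (auto intro!: sq_integrable_diff sq_integrable_add sq_integrable_scaleR k m sq_w)
    moreover have "sq_integrable M (s (Suc k))"
      by (subst sq_integrable_cong[OF s_Suc]) (auto intro!: sq_integrable_diff sq_integrable_add sq_integrable_scaleR k m sq_w)
    ultimately show ?case using Suc m by (auto simp: le_Suc_eq less_Suc_eq)
  qed
  have sq: "sq_integrable M (u k)" "sq_integrable M (s k)" for k using all[of k] by auto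
  have mom: "sq_integrable M (e k)" "(\<integral>\<omega>. (norm (e k \<omega>))\<^sup>2 \<partial>M) \<le> D k"
      "D k \<le> (1 - \<kappa> k) * (\<integral>\<omega>. (case k of 0 \<Rightarrow> 0 | Suc j \<Rightarrow> \<Delta> j \<omega>) \<partial>M) + \<Theta> k * (\<integral>\<omega>. g k \<omega> \<partial>M) + (\<sigma> k)\<^sup>2" for k
    using moments[of k] all[of "Suc k"] by auto

  have process: "vfosa_process \<mu> \<nu> \<beta> \<beta>bar r t \<eta> M w (\<lambda>k \<omega>. u k \<omega> - ustar) (\<lambda>k \<omega>. s k \<omega> - ustar) e D \<kappa> \<Theta> \<sigma> \<Gamma> \<Lambda>"
    if star: "ustar \<in> zer (bfs_residual F lam T)" for ustar
  proof unfold_locales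
    obtain y where y: "- F y \<in> T y" "ustar = y - lam *\<^sub>R F y" using star zer_bfs_residual_iff[OF lam(1)] by metis
    show "sq_integrable M (w k)" "sq_integrable M (e k)" for k by (intro sq_w sq mom)+
    show "sq_integrable M (\<lambda>\<omega>. u k \<omega> - ustar)" "sq_integrable M (\<lambda>\<omega>. s k \<omega> - ustar)" for k
      by (intro sq_integrable_diff sq sq_integrable_const finM)+
    show "\<beta>bar * (norm (w k \<omega>))\<^sup>2 \<le> w k \<omega> \<bullet> (u k \<omega> - ustar)" if "\<omega> \<in> space M" for k \<omega>
    proof -
      have "0 \<le> \<Lambda> * mean_sq_diff Fs (x k \<omega>) y" using \<Lambda>0 msd0 by simp
      then show ?thesis
        using coco[OF \<xi>T[OF that, of k] y(1)] u_eq[OF that, of k] by (simp add: w_def y(2))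
    qed
    show "D 0 \<le> (\<sigma> 0)\<^sup>2" using mom(3)[of 0] by (simp add: g_def)
    show "D (Suc k) \<le> (1 - \<kappa> (Suc k)) * D k + \<Theta> (Suc k) / \<Lambda>
        * (\<integral>\<omega>. (w (Suc k) \<omega> - w k \<omega>) \<bullet> (u (Suc k) \<omega> - ustar - (u k \<omega> - ustar)) - \<beta>bar * (norm (w (Suc k) \<omega> - w k \<omega>))\<^sup>2 \<partial>M)
        + (\<sigma> (Suc k))\<^sup>2" for k
      using mom(3)[of "Suc k"] by (simp add: g_def gap_def D_def)
    show "\<beta>bar * (norm (w (Suc k) \<omega> - w k \<omega>))\<^sup>2 \<le> (w (Suc k) \<omega> - w k \<omega>) \<bullet> (u (Suc k) \<omega> - ustar - (u k \<omega> - ustar))"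
      if "\<omega> \<in> space M" for k \<omega> using gap0[OF that, of k] by (simp add: gap_def)
    show "\<Gamma> (int k) > 0" for k using \<Gamma>_pos by simp
    show "u (Suc k) \<omega> - ustar = u k \<omega> - ustar + (1 / t (int k)) *\<^sub>R (s k \<omega> - ustar - (u k \<omega> - ustar)) - \<eta> k *\<^sub>R (w k \<omega> + e k \<omega>)"
      "s (Suc k) \<omega> - ustar = s k \<omega> - ustar - (\<nu> * \<eta> k) *\<^sub>R (w k \<omega> + e k \<omega>)" if "\<omega> \<in> space M" for k \<omega>
      using u_Suc[OF that, of k] s_Suc[OF that, of k] by simp_all
  qed (use mom(2) init \<Lambda>0 \<Theta>_pos \<Gamma>\<Theta> \<kappa> B_finite in auto)

  have rate: "mean_sq M (w k) \<le> ennreal (2 * (\<Psi> + E0 + B) / (\<mu>\<^sup>2 * (real k + r - 1)\<^sup>2))"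
    if star: "ustar \<in> zer (bfs_residual F lam T)"
      and \<Psi>: "\<Psi> = \<mu>\<^sup>2 * r\<^sup>2 * (\<integral>\<omega>. (norm (w 0 \<omega>))\<^sup>2 \<partial>M)
              + (2 * r - 1) / (4 * \<beta>\<^sup>2 * (\<mu> * r - 1)) * (norm (x0 + lam *\<^sub>R \<xi>0 - ustar))\<^sup>2"
      and E0: "E0 = \<mu> * r\<^sup>2 * (\<mu> * \<Gamma> 0 + \<beta>) * (\<sigma> 0)\<^sup>2 / (2 * \<beta>)" for ustar \<Psi> E0 k
  proof -
    interpret P: vfosa_process \<mu> \<nu> \<beta> \<beta>bar r t \<eta> M w "\<lambda>k \<omega>. u k \<omega> - ustar" "\<lambda>k \<omega>. s k \<omega> - ustar" e D \<kappa> \<Theta> \<sigma> \<Gamma> \<Lambda>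
      by (rule process[OF star])
    have r1: "\<mu> * r - 1 > 0" using t_nat(1)[of 0] \<mu> by (simp add: t)
    have i: "(\<integral>\<omega>. (norm (u 0 \<omega> - ustar))\<^sup>2 \<partial>M) = (norm (x0 + lam *\<^sub>R \<xi>0 - ustar))\<^sup>2"
    proof -
      have "(\<integral>\<omega>. (norm (u 0 \<omega> - ustar))\<^sup>2 \<partial>M) = (\<integral>\<omega>. (norm (x0 + lam *\<^sub>R \<xi>0 - ustar))\<^sup>2 \<partial>M)"
        by (intro Bochner_Integration.integral_cong) (auto simp: init)
      then show ?thesis by (simp add: prob_space)
    qed
    have c: "1 / (\<nu> * \<eta> 0) = 2 * \<beta> * ((2 * r - 1) / (4 * \<beta>\<^sup>2 * (\<mu> * r - 1)))"
    proof -
      have "t 0 - \<nu> = \<nu> * (2 * r - 1)" by (simp add: t \<nu> field_simps)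
      moreover have "t 0 - 1 = \<mu> * r - 1" by (simp add: t)
      ultimately have "\<eta> 0 = 2 * \<beta> * (\<mu> * r - 1) / (\<nu> * (2 * r - 1))" using \<eta>[of 0] by simp
      moreover have "1 / (\<nu> * (2 * \<beta> * a / (\<nu> * b))) = 2 * \<beta> * (b / (4 * \<beta>\<^sup>2 * a))" for a b
        using \<nu>_bounds \<beta> by (simp add: power2_eq_square)
      ultimately show ?thesis by (simp only:)
    qed
    have "\<beta> * (t (int k - 1))\<^sup>2 * P.residual_ms k \<le> 2 * \<beta> * \<mu>\<^sup>2 * r\<^sup>2 * P.residual_ms 0
        + 2 * \<beta> * ((2 * r - 1) / (4 * \<beta>\<^sup>2 * (\<mu> * r - 1))) * (norm (x0 + lam *\<^sub>R \<xi>0 - ustar))\<^sup>2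
        + \<Gamma> 0 * (\<mu>\<^sup>2 * r\<^sup>2) * (\<sigma> 0)\<^sup>2 + 2 * \<Lambda> * (\<Sum>k. t (int k - 1) * (t (int k - 1) - 1) * ((\<sigma> k)\<^sup>2 / \<Theta> k))"
      using P.residual_rate[of k] unfolding i c .
    also have "2 * \<Lambda> * (\<Sum>k. t (int k - 1) * (t (int k - 1) - 1) * ((\<sigma> k)\<^sup>2 / \<Theta> k)) = 2 * \<beta> * B"
      using \<beta> by (simp add: B)
    also have "\<Gamma> 0 * (\<mu>\<^sup>2 * r\<^sup>2) * (\<sigma> 0)\<^sup>2 \<le> 2 * \<beta> * E0"
    proof -
      have "2 * \<beta> * E0 = \<Gamma> 0 * (\<mu>\<^sup>2 * r\<^sup>2) * (\<sigma> 0)\<^sup>2 + \<mu> * r\<^sup>2 * \<beta> * (\<sigma> 0)\<^sup>2"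
      proof -
        have "2 * \<beta> * E0 = \<mu> * r\<^sup>2 * (\<mu> * \<Gamma> 0 + \<beta>) * (\<sigma> 0)\<^sup>2" using \<beta>(1) by (simp add: E0)
        also have "\<dots> = \<Gamma> 0 * (\<mu>\<^sup>2 * r\<^sup>2) * (\<sigma> 0)\<^sup>2 + \<mu> * r\<^sup>2 * \<beta> * (\<sigma> 0)\<^sup>2"
          by (simp add: algebra_simps power2_eq_square[of \<mu>])
        finally show ?thesis .
      qed
      moreover have "0 \<le> \<mu> * r\<^sup>2 * \<beta> * (\<sigma> 0)\<^sup>2" using \<mu> \<beta> by simp
      ultimately show ?thesis by linarith
    qed
    also have "2 * \<beta> * \<mu>\<^sup>2 * r\<^sup>2 * P.residual_ms 0 + 2 * \<beta> * ((2 * r - 1) / (4 * \<beta>\<^sup>2 * (\<mu> * r - 1))) * (norm (x0 + lam *\<^sub>R \<xi>0 - ustar))\<^sup>2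
        = 2 * \<beta> * \<Psi>" unfolding \<Psi> P.residual_ms_def by (simp only: distrib_left mult.assoc)
    finally have "\<beta> * ((t (int k - 1))\<^sup>2 * P.residual_ms k) \<le> \<beta> * (2 * (\<Psi> + E0 + B))"
      by (simp only: distrib_left mult.assoc mult.left_commute[of \<beta>])
    then have "(t (int k - 1))\<^sup>2 * P.residual_ms k \<le> 2 * (\<Psi> + E0 + B)" using \<beta>(1) by (rule mult_left_le_imp_le)
    moreover have "(t (int k - 1))\<^sup>2 = \<mu>\<^sup>2 * (real k + r - 1)\<^sup>2"
    proof -
      have "t (int k - 1) = \<mu> * (real k + r - 1)" by (simp add: t algebra_simps)
      then show ?thesis by (simp only: power_mult_distrib)
    qed
    moreover have "(t (int k - 1))\<^sup>2 > 0" using t_nat(2)[of k] \<mu> by simp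
    ultimately have "P.residual_ms k \<le> 2 * (\<Psi> + E0 + B) / (\<mu>\<^sup>2 * (real k + r - 1)\<^sup>2)" by (simp add: pos_le_divide_eq mult.commute)
    then show ?thesis using mean_sq_eq[OF sq_w[OF sq(1)], of k] by (simp add: P.residual_ms_def ennreal_leI)
  qed

  obtain ustar where star: "ustar \<in> zer (bfs_residual F lam T)"
  proof -
    obtain z where "0 \<in> sum_op F T z" using A1 by (auto simp: zer_def)
    then obtain y where "y \<in> T z" "F z + y = 0" by (auto simp: sum_op_def)
    then have "- F z \<in> T z" by (metis add_eq_0_iff)
    then show ?thesis using that zer_bfs_residual_iff[OF lam(1)] by metis
  qed
  interpret P: vfosa_process \<mu> \<nu> \<beta> \<beta>bar r t \<eta> M w "\<lambda>k \<omega>. u k \<omega> - ustar" "\<lambda>k \<omega>. s k \<omega> - ustar" e D \<kappa> \<Theta> \<sigma> \<Gamma> \<Lambda>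
    by (rule process[OF star])
  have Ww: "ennreal c * mean_sq M (w k) = ennreal (c * P.residual_ms k)" if "0 \<le> c" for c k
    unfolding P.residual_ms_def by (intro weighted_mean_sq sq_w sq that)
  have Ee: "ennreal c * mean_sq M (e k) = ennreal (c * P.error_ms k)" if "0 \<le> c" for c k
    unfolding P.error_ms_def by (intro weighted_mean_sq mom that)
  have Uu: "ennreal c * mean_sq M (\<lambda>\<omega>. u (k + 1) \<omega> - u k \<omega>) = ennreal (c * P.step_ms k)" if "0 \<le> c" for c k
    using weighted_mean_sq[OF sq_integrable_diff[OF sq(1)[of "k + 1"] sq(1)[of k]] that] by (simp add: P.step_ms_def)
  have Ux: "ennreal c * mean_sq M (\<lambda>\<omega>. x (k + 1) \<omega> - x k \<omega>) \<le> ennreal (c * P.step_ms k)" if "0 \<le> c" for c k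
  proof -
    have "mean_sq M (\<lambda>\<omega>. x (k + 1) \<omega> - x k \<omega>) \<le> mean_sq M (\<lambda>\<omega>. u (k + 1) \<omega> - u k \<omega>)"
      unfolding mean_sq_def using nonexp[OF _ res] by (intro nn_integral_mono ennreal_leI power_mono) auto
    then show ?thesis using Uu[OF that] by (metis mult_left_mono zero_le)
  qed
  have lim: "(\<lambda>k. ennreal (f k)) \<longlonglongrightarrow> 0" if "f \<longlonglongrightarrow> 0" for f :: "nat \<Rightarrow> real"
    using tendsto_ennrealI[OF that] by simp
  have lim_U: "(\<lambda>k. ennreal ((real k)\<^sup>2) * mean_sq M (\<lambda>\<omega>. u (k + 1) \<omega> - u k \<omega>)) \<longlonglongrightarrow> 0"
    using lim[OF P.step_tendsto_0] by (simp only: Uu zero_le_power2)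
  have lim_x: "(\<lambda>k. ennreal ((real k)\<^sup>2) * mean_sq M (\<lambda>\<omega>. x (k + 1) \<omega> - x k \<omega>)) \<longlonglongrightarrow> 0"
  proof (rule tendsto_sandwich[OF _ _ tendsto_const lim[OF P.step_tendsto_0]])
    show "\<forall>\<^sub>F k in sequentially. ennreal ((real k)\<^sup>2) * mean_sq M (\<lambda>\<omega>. x (k + 1) \<omega> - x k \<omega>) \<le> ennreal ((real k)\<^sup>2 * P.step_ms k)"
      by (intro always_eventually allI Ux) simp
  qed simp
  have sum_U: "(\<Sum>k. ennreal (real (k + 1) * P.step_ms k)) < \<infinity>"
    by (rule suminf_ennreal_less_top[OF P.summable_step]) (simp add: P.step_ms_nonneg)
  have sum_x: "(\<Sum>k. ennreal (real (k + 1)) * mean_sq M (\<lambda>\<omega>. x (k + 1) \<omega> - x k \<omega>)) < \<infinity>"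
  proof -
    have "(\<Sum>k. ennreal (real (k + 1)) * mean_sq M (\<lambda>\<omega>. x (k + 1) \<omega> - x k \<omega>)) \<le> (\<Sum>k. ennreal (real (k + 1) * P.step_ms k))"
      by (intro suminf_le Ux) auto
    then show ?thesis using sum_U by (rule order_le_less_trans)
  qed
  have sum_u: "(\<Sum>k. ennreal (real (k + 1)) * mean_sq M (\<lambda>\<omega>. u (k + 1) \<omega> - u k \<omega>)) < \<infinity>"
    using sum_U by (simp only: Uu of_nat_0_le_iff)
  have sum_w: "(\<Sum>k. ennreal (real (k + 1)) * mean_sq M (w k)) < \<infinity>"
    using suminf_ennreal_less_top[OF P.summable_residual] P.moments_nonneg by (simp only: Ww of_nat_0_le_iff mult_nonneg_nonneg)
  have sum_e: "(\<Sum>k. ennreal ((real (k + 1))\<^sup>2) * mean_sq M (e k)) < \<infinity>"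
    using suminf_ennreal_less_top[OF P.summable_error] P.moments_nonneg by (simp only: Ee zero_le_power2 mult_nonneg_nonneg)
  have lim_w: "(\<lambda>k. ennreal ((real k)\<^sup>2) * mean_sq M (w k)) \<longlonglongrightarrow> 0"
    using lim[OF P.residual_tendsto_0] by (simp only: Ww zero_le_power2)
  show ?thesis
  proof (intro conjI impI ballI allI)
    fix ustar \<Psi>0_sq E0_sq k
    assume "ustar \<in> zer (bfs_residual F lam T)"
      and "\<Psi>0_sq = \<mu>\<^sup>2 * r\<^sup>2 * (\<integral>\<omega>. (norm (F (x 0 \<omega>) + \<xi> 0 \<omega>))\<^sup>2 \<partial>M)
              + (2 * r - 1) / (4 * \<beta>\<^sup>2 * (\<mu> * r - 1)) * (norm (x0 + lam *\<^sub>R \<xi>0 - ustar))\<^sup>2"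
      and "E0_sq = \<mu> * r\<^sup>2 * (\<mu> * \<Gamma> 0 + \<beta>) * (\<sigma> 0)\<^sup>2 / (2 * \<beta>)"
    then show "mean_sq M (\<lambda>\<omega>. F (x k \<omega>) + \<xi> k \<omega>) \<le> ennreal (2 * (\<Psi>0_sq + E0_sq + B) / (\<mu>\<^sup>2 * (real k + r - 1)\<^sup>2))"
      using rate[unfolded w_def[abs_def]] by blast
  qed (rule sum_w[unfolded w_def[abs_def]] sum_e[unfolded e_def[abs_def]] sum_u sum_x lim_U lim_x
      lim_w[unfolded w_def[abs_def]])+
qed

end
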